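(* Let $n,r$ be positive integers and $u=n/r$. If $\sqrt{n\log n}\le r<n$, then $$\kappa(n,r)=e^{-H_r+\gamma}\,\omega(u)+O\left(\frac{R(u)\,u^{3/2}\log^2(u+1)}{r^2}\right).$$
   Context: $S_n$ is the symmetric group on $n$ symbols and $k_j(\sigma)$ is the number of cycles of length $j$ in $\sigma\in S_n$. For $1\le r<n$, $$\kappa(n,r)=\frac1{n!}\left|\{\sigma\in S_n:\ k_j(\sigma)=0\text{ for all }1\le j\le r\}\right|.$$ $H_r=\sum_{j=1}^r1/j$; $\gamma$ is the Euler–Mascheroni constant. $\omega$ is the Buchstab function: the continuous function on $[1,\infty)$ with $v\omega(v)=1$ for $v\in[1,2]$ and $(v\omega(v))'=\omega(v-1)$ for $v>2$. Definition of $R$. For $v>1$ let $\xi(v)$ be the positive solution to $e^{\xi(v)}=1+v\xi(v)$, and let $I(s)=\int_0^s\frac{e^t-1}{t}\,dt$ for $s\in\mathbb C$. There is a sufficiently large constant $v_1>1$ such that for $v\ge v_1$ there exists a unique complex solution $\zeta=\zeta_0(v)$ of $e^\zeta=1-v\zeta$ satisfying $|\zeta_0(v)-\xi(v)+i\pi|\le\pi$. For $v\ge v_1$, $$R(v)=\left|\frac{\exp\{-v\zeta_0(v)-I(\zeta_0(v))\}}{\zeta_0(v)\sqrt{2\pi v(1-1/\zeta_0(v))}}\right|.$$ For $1\le v<v_1$ one sets $R(v)=O(1)$, i.e. when $u<v_1$ the factor $R(u)$ in the error term is to be read as $O(1)$ (equivalently, replaced by $1$). The implied constant in $O(\cdot)$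 is absolute (uniform over all $n,r$ in the stated range). $\log$ is the natural logarithm. *)

theory Defs
  imports "HOL-Complex_Analysis.Complex_Analysis" "HOL-Combinatorics.Combinatorics"
begin

definition num_cycles :: "nat \<Rightarrow> nat \<Rightarrow> (nat \<Rightarrow> nat) \<Rightarrow> nat" where
  "num_cycles n j \<sigma> = card {c \<in> orbit \<sigma> ` {1..n}. card c = j}"

definition kappa :: "nat \<Rightarrow> nat \<Rightarrow> real" where
  "kappa n r =
     real (card {\<sigma>. \<sigma> permutes {1..n} \<and> (\<forall>j\<in>{1..r}. num_cycles n j \<sigma> = 0)}) / fact n"

(* The value 0 below 1 is a convention; it only serves to make the total function unique. *)
definition is_buchstab :: "(real \<Rightarrow> real) \<Rightarrow> bool" where
  "is_buchstab w \<longleftrightarrow>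
     (\<forall>v<1. w v = 0) \<and>
     continuous_on {1..} w \<and>
     (\<forall>v\<in>{1..2}. v * w v = 1) \<and>
     (\<forall>v>2. ((\<lambda>t. t * w t) has_real_derivative w (v - 1)) (at v))"

definition buchstab :: "real \<Rightarrow> real" where
  "buchstab = (THE w. is_buchstab w)"

definition xi :: "real \<Rightarrow> real" where
  "xi v = (THE x. 0 < x \<and> exp x = 1 + v * x)"

(* The integrand is 0 instead of 1 at the removable singularity t = 0; being an end point
   of the path, it does not affect the integral. *)
definition I_fun :: "complex \<Rightarrow> complex" where
  "I_fun s = contour_integral (linepath 0 s) (\<lambda>t. (exp t - 1) / t)"

definition is_zeta0 :: "real \<Rightarrow> complex \<Rightarrow> bool" where
  "is_zeta0 v z \<longleftrightarrow>
     exp z = 1 - of_real v * z \<and> norm (z - of_real (xi v) + \<i> * of_real pi) \<le> pi"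

definition zeta0 :: "real \<Rightarrow> complex" where
  "zeta0 v = (THE z. is_zeta0 v z)"

(* v1 is an admissible choice of the ``sufficiently large constant'' beyond which
   zeta0 is well-defined. *)
definition admissible :: "real \<Rightarrow> bool" where
  "admissible v1 \<longleftrightarrow> 1 < v1 \<and> (\<forall>v\<ge>v1. \<exists>!z. is_zeta0 v z)"

(* Below the threshold v1 the factor R(v) is to be read as O(1), hence as 1. *)
definition R_fun :: "real \<Rightarrow> real \<Rightarrow> real" where
  "R_fun v1 v =
     (if v < v1 then 1
      else norm (exp (- of_real v * zeta0 v - I_fun (zeta0 v)) /
                 (zeta0 v * csqrt (2 * of_real pi * of_real v * (1 - 1 / zeta0 v)))))"

end

theory Submission
  imports Defs "HOL-Real_Asymp.Real_Asymp"
begin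

text \<open>
Write \<open>p\<^sub>n = kappa n r\<close>, \<open>u = n / r\<close>, \<open>H = harm r\<close> and \<open>I = I_fun\<close>. The numbers \<open>p\<^sub>n\<close> and the function
\<open>\<omega> = buchstab\<close> solve a difference and a differential equation of the same shape. For bounded \<open>u\<close> this
alone shows \<open>p\<^sub>n = exp (\<gamma> - H) \<omega>(u) + O(1 / r\<^sup>2)\<close>, because each step is an average of earlier ones
and adds an error of size \<open>1 / r\<^sup>2\<close> (\<open>kappa_buchstab_bounded\<close>); there \<open>R\<close> is bounded below.

For large \<open>u\<close> the error must be as small as \<open>R(u)\<close>, and this takes a contour integral. The
generating function of \<open>p\<^sub>n\<close> is \<open>exp (- (\<Sum>j=1..r. z^j / j)) / (1 - z)\<close>. With \<open>z = exp (s / r)\<close> the sum over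
\<open>j\<close> is a Riemann sum for \<open>H + I(s)\<close>, and Cauchy's formula on a curve around the unit disc becomes

  \<open>p\<^sub>n exp H - 1 = 1 / (2 \<pi> i) \<integral> exp (- u s) (exp (- I s) / (- s)) exp (- \<eta>(s)) ds\<close>,  \<open>|Im s| \<le> \<pi> r\<close>,

where \<open>\<eta>(s) = O((|Im s| + exp (Re s)) / r)\<close> (\<open>normalized_path_integral\<close>). Apart from the end points,
\<open>n\<close> and \<open>r\<close> enter only through \<open>u\<close> and through \<open>\<eta>\<close>. So the integrals for \<open>(n, r)\<close> and for
\<open>(n m, r m)\<close> are close, and for \<open>m \<rightarrow> \<infinity>\<close> the left-hand side of the latter tends to \<open>exp \<gamma> \<omega>(u) - 1\<close> by
the elementary estimate (\<open>kappa_refine_limit\<close>). In this way no inversion formula for the Laplace transform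
of \<open>\<omega>\<close> is used, and everything is reduced to a bound for the integral of
\<open>|exp (- I s) / s| exp ((1 - u) Re s)\<close> along a suitable path (\<open>kappa_buchstab_path_bound\<close>).

The path follows the vertical line through the saddle point \<open>\<zeta> = zeta0 u\<close> as long as
\<open>|Im s| \<le> exp (Re \<zeta>)\<close>, and then the curves \<open>Re s = ln |Im s|\<close>. On the curves \<open>|exp s / s| \<le> 1\<close>, so that \<open>exp (- I s)\<close>
is only of polynomial size, while \<open>exp (- u s)\<close> decays like a high power of \<open>|Im s|\<close>. On the line,
\<open>|exp (- I s) / s|\<close> is at most a constant times its value at \<open>\<zeta>\<close> (\<open>log_growth_le_critical\<close>,
\<open>damped_log_growth_antimono\<close>), and it is smaller by an exponential factor for \<open>|Im s| > 3 Re \<zeta>\<close> (\<open>log_growth_crude\<close>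
against \<open>log_growth_at_pi\<close>). The integral is therefore \<open>O(M exp (Re \<zeta>))\<close> with \<open>M = |exp (- u \<zeta> - I \<zeta>)|\<close>. Finally
\<open>exp (Re \<zeta>) = |1 - u \<zeta>|\<close>, \<open>|\<zeta>| = O(ln u)\<close> and \<open>M = O(R(u) u\<^sup>1\<^sup>/\<^sup>2 ln u)\<close>, which gives the factor \<open>u\<^sup>3\<^sup>/\<^sup>2 ln\<^sup>2 u\<close>.
The hypothesis on \<open>r\<close> gives \<open>r \<ge> u ln u\<close>, hence \<open>exp (Re \<zeta>) = O(r)\<close>, so that \<open>\<eta>\<close> stays bounded on the path.
\<close>

section \<open>Permutations without short cycles\<close>

definition long_cycle_perms :: "nat \<Rightarrow> nat set \<Rightarrow> (nat \<Rightarrow> nat) set" where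
  "long_cycle_perms r A = {p. p permutes A \<and> (\<forall>x\<in>A. r < card (orbit p x))}"

definition cyclic_perms :: "nat set \<Rightarrow> (nat \<Rightarrow> nat) set" where
  "cyclic_perms A = {p. p permutes A \<and> cyclic_on p A}"

text \<open>The recursion satisfied by \<open>kappa\<close>, solved abstractly: the count of permutations of a set can then be
compared with it by induction over the set. The test \<open>m < n\<close> makes the recursion terminate.\<close>
fun rough_ratio :: "nat \<Rightarrow> nat \<Rightarrow> real" where
  "rough_ratio r n = (if n = 0 then 1 else (\<Sum>m<n - r. if m < n then rough_ratio r m else 0) / real n)"

declare rough_ratio.simps [simp del]

lemma rough_ratio_0: "rough_ratio r 0 = 1"
  by (simp add: rough_ratio.simps)

lemma rough_ratio_rec:
  assumes "n > 0"
  shows "real n * rough_ratio r n = (\<Sum>m<n - r. rough_ratio r m)"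
  using assms by (subst rough_ratio.simps) (auto intro!: sum.cong)

lemma self_in_orbit_permutes:
  assumes "p permutes A" "finite A"
  shows "x \<in> orbit p x"
proof -
  have "permutation p" using assms permutation_permutes by blast
  then show ?thesis by (rule permutation_self_in_orbit)
qed

lemma card_orbit_pos:
  assumes "p permutes A" "finite A"
  shows "0 < card (orbit p x)"
  using finite_orbit[OF self_in_orbit_permutes[OF assms]] orbit_nonempty[of p x]
  by (simp add: card_gt_0_iff)

lemma orbit_perm_restrict:
  assumes "p permutes A" "finite A" "cyclic_on p C" "C \<subseteq> B" "x \<in> C"
  shows "orbit (perm_restrict p B) x = orbit p x"
proof -
  have "orbit p x = C" using assms by (simp add: orbit_cyclic_eq3)
  moreover have "cyclic_on (perm_restrict p B) C"
    using assms(3,4) cyclic_cong[of C "perm_restrict p B" p] by (auto simp: perm_restrict_simps subset_iff)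
  ultimately show ?thesis using assms by (simp add: orbit_cyclic_eq3)
qed

lemma orbits_disjoint:
  assumes "p permutes A" "finite A" "y \<notin> orbit p x"
  shows "orbit p y \<inter> orbit p x = {}"
proof -
  have c: "cyclic_on p (orbit p x)" "cyclic_on p (orbit p y)"
    by (rule cyclic_on_orbit[OF assms(1,2)])+
  show ?thesis
  proof (rule ccontr)
    assume "\<not> ?thesis"
    then obtain z where "z \<in> orbit p y" "z \<in> orbit p x" by auto
    then have "orbit p y = orbit p x" using c by (metis cyclic_on_alldef)
    moreover have "y \<in> orbit p y" by (rule self_in_orbit_permutes[OF assms(1,2)])
    ultimately show False using assms by simp
  qed
qed

text \<open>A permutation consists of its cycle \<open>C\<close> through \<open>a\<close> and of a permutation of the remaining points,
whose cycles are the other cycles of the original permutation.\<close>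
lemma bij_betw_split_cycle:
  assumes fin: "finite A" and C: "C \<subseteq> A" "a \<in> C" "r < card C"
  shows "bij_betw (\<lambda>p. (perm_restrict p C, perm_restrict p (A - C)))
           {p \<in> long_cycle_perms r A. orbit p a = C}
           (cyclic_perms C \<times> long_cycle_perms r (A - C))"
proof (rule bij_betwI[where g = "\<lambda>(p, q). p \<circ> q"])
  show "(\<lambda>p. (perm_restrict p C, perm_restrict p (A - C)))
     \<in> {p \<in> long_cycle_perms r A. orbit p a = C} \<rightarrow> cyclic_perms C \<times> long_cycle_perms r (A - C)"
  proof
    fix p assume "p \<in> {p \<in> long_cycle_perms r A. orbit p a = C}"
    then have p: "p permutes A" "\<And>x. x \<in> A \<Longrightarrow> r < card (orbit p x)" "orbit p a = C"
      by (auto simp: long_cycle_perms_def)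
    have cyc': "cyclic_on p (orbit p x)" for x by (rule cyclic_on_orbit[OF p(1) fin])
    have cyc: "cyclic_on p C" using cyc'[of a] p(3) by simp
    have bij: "bij_betw p C C"
    proof -
      have "p ` C \<subseteq> C" using cyc cyclic_on_inI by fastforce
      moreover have "inj_on p C" using p(1) by (meson inj_on_subset permutes_inj subset_UNIV)
      moreover have "finite C" using C fin finite_subset by blast
      ultimately show ?thesis by (simp add: bij_betw_def endo_inj_surj)
    qed
    have "bij_betw (perm_restrict p C) C C"
      using bij bij_betw_cong[of C p "perm_restrict p C" C] by (auto simp: perm_restrict_simps)
    then have 1: "perm_restrict p C permutes C"
      by (auto intro!: bij_imp_permutes simp: perm_restrict_simps)
    have 2: "cyclic_on (perm_restrict p C) C" using cyc by (simp add: cyclic_on_perm_restrict)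
    have 3: "perm_restrict p (A - C) permutes (A - C)"
      using p cyc by (intro perm_restrict_diff_cyclic)
    have 4: "orbit (perm_restrict p (A - C)) x = orbit p x" if "x \<in> A - C" for x
    proof (rule orbit_perm_restrict[OF p(1) fin])
      show "cyclic_on p (orbit p x)" by (rule cyc')
      have "orbit p x \<subseteq> A" using that p(1) permutes_orbit_subset by fastforce
      moreover have "orbit p x \<inter> C = {}" using orbits_disjoint[OF p(1) fin, of x a] that p(3) by auto
      ultimately show "orbit p x \<subseteq> A - C" by auto
      show "x \<in> orbit p x" by (rule self_in_orbit_permutes[OF p(1) fin])
    qed
    show "(perm_restrict p C, perm_restrict p (A - C)) \<in> cyclic_perms C \<times> long_cycle_perms r (A - C)"
      using 1 2 3 4 p by (auto simp: cyclic_perms_def long_cycle_perms_def)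
  qed
next
  show "(\<lambda>(p, q). p \<circ> q) \<in> cyclic_perms C \<times> long_cycle_perms r (A - C)
      \<rightarrow> {p \<in> long_cycle_perms r A. orbit p a = C}"
  proof clarify
    fix p q assume pq: "p \<in> cyclic_perms C" "q \<in> long_cycle_perms r (A - C)"
    then have p: "p permutes C" "cyclic_on p C" and q: "q permutes (A - C)"
      "\<And>x. x \<in> A - C \<Longrightarrow> r < card (orbit q x)"
      by (auto simp: cyclic_perms_def long_cycle_perms_def)
    have "p permutes A" "q permutes A" using p(1) q(1) C by (auto intro: permutes_subset)
    then have perm: "p \<circ> q permutes A" by (rule permutes_compose[rotated])
    have c1: "cyclic_on (p \<circ> q) C"
      using permutes_comp_preserves_cyclic1[OF q(1) p(2), of C] by auto
    then have oC: "orbit (p \<circ> q) x = C" if "x \<in> C" for x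
      using orbit_cyclic_eq3 that by metis
    have o2: "orbit (p \<circ> q) x = orbit q x" if "x \<in> A - C" for x
    proof -
      have fin': "finite (A - C)" using fin by simp
      have cq: "cyclic_on q (orbit q x)" by (rule cyclic_on_orbit[OF q(1) fin'])
      have sub: "orbit q x \<subseteq> A - C" using q that permutes_orbit_subset by fastforce
      have "cyclic_on (p \<circ> q) (orbit q x)"
        by (rule permutes_comp_preserves_cyclic2[OF p(1) cq _ sub]) auto
      moreover have "x \<in> orbit q x" by (rule self_in_orbit_permutes[OF q(1) fin'])
      ultimately show ?thesis using orbit_cyclic_eq3 by metis
    qed
    show "p \<circ> q \<in> long_cycle_perms r A \<and> orbit (p \<circ> q) a = C"
    proof -
      have "r < card (orbit (p \<circ> q) x)" if "x \<in> A" for x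
        using oC[of x] o2[of x] C(3) q(2)[of x] that by (cases "x \<in> C") simp_all
      then show ?thesis using perm oC[OF C(2)] by (simp add: long_cycle_perms_def)
    qed
  qed
next
  fix p assume "p \<in> {p \<in> long_cycle_perms r A. orbit p a = C}"
  then have p: "p permutes A" "orbit p a = C" by (auto simp: long_cycle_perms_def)
  have cyc: "cyclic_on p C" using cyclic_on_orbit[OF p(1) fin, of a] p(2) by simp
  have *: "x \<in> C" if "p x \<in> C" for x using p(1) cyc that by (rule cyclic_on_f_in)
  have **: "p x = x" if "x \<notin> A" for x using p(1) that by (simp add: permutes_not_in)
  have "perm_restrict p C (perm_restrict p (A - C) x) = p x" for x
    using *[of x] **[of x] by (cases "x \<in> C"; cases "x \<in> A"; cases "p x \<in> C") (simp_all add: perm_restrict_def cyclic_on_inI[OF cyc])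
  then show "(case (perm_restrict p C, perm_restrict p (A - C)) of (p, q) \<Rightarrow> p \<circ> q) = p"
    by (auto simp: fun_eq_iff)
next
  fix y assume "y \<in> cyclic_perms C \<times> long_cycle_perms r (A - C)"
  then obtain p q where y: "y = (p, q)" and p: "p permutes C" and q: "q permutes (A - C)"
    by (auto simp: cyclic_perms_def long_cycle_perms_def)
  have p': "p x = x" if "x \<notin> C" for x using p that by (simp add: permutes_not_in)
  have q': "q x = x" if "x \<notin> A - C" for x using q that by (simp add: permutes_not_in)
  have q'': "q x \<in> A - C" if "x \<in> A - C" for x using permutes_in_image[OF q] that by blast
  have "perm_restrict (p \<circ> q) C = p" 
    using p' q' by (auto simp: fun_eq_iff perm_restrict_def)
  moreover have "perm_restrict (p \<circ> q) (A - C) x = q x" for x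
    using p' q' q''[of x] by (cases "x \<in> A - C") (auto simp: perm_restrict_def)
  ultimately show "(perm_restrict (case y of (p, q) \<Rightarrow> p \<circ> q) C,
           perm_restrict (case y of (p, q) \<Rightarrow> p \<circ> q) (A - C)) = y"
    using y by (auto simp: fun_eq_iff)
qed

lemma finite_long_cycle_perms [simp]: "finite A \<Longrightarrow> finite (long_cycle_perms r A)"
  unfolding long_cycle_perms_def by (rule finite_subset[OF _ finite_permutations[of A]]) auto

lemma card_long_cycle_perms_split:
  assumes fin: "finite A" and a: "a \<in> A"
  shows "card (long_cycle_perms r A) =
    (\<Sum>C | C \<subseteq> A \<and> a \<in> C \<and> r < card C. card (cyclic_perms C) * card (long_cycle_perms r (A - C)))"
proof -
  let ?S = "{C. C \<subseteq> A \<and> a \<in> C \<and> r < card C}"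
  have finS: "finite ?S" using fin by simp
  have un: "long_cycle_perms r A = (\<Union>C\<in>?S. {p \<in> long_cycle_perms r A. orbit p a = C})"
  proof -
    have "orbit p a \<in> ?S" if "p \<in> long_cycle_perms r A" for p
      using that a fin permutes_orbit_subset[of p A a] self_in_orbit_permutes[of p A a]
      by (auto simp: long_cycle_perms_def)
    then show ?thesis by blast
  qed
  have "card (long_cycle_perms r A) = (\<Sum>C\<in>?S. card {p \<in> long_cycle_perms r A. orbit p a = C})"
    by (subst un, rule card_UN_disjoint) (use finS fin in auto)
  also have "\<dots> = (\<Sum>C\<in>?S. card (cyclic_perms C) * card (long_cycle_perms r (A - C)))"
    by (intro sum.cong refl)
       (use bij_betw_same_card[OF bij_betw_split_cycle[OF fin]] in \<open>auto simp: card_cartesian_product\<close>)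
  finally show ?thesis .
qed

text \<open>The sets \<open>C\<close> are grouped by the size \<open>m\<close> of their complement, which is an arbitrary
\<open>m\<close>-element subset of \<open>A - {a}\<close>.\<close>
lemma sum_subsets_containing:
  fixes f :: "nat \<Rightarrow> real"
  assumes fin: "finite A" and a: "a \<in> A"
  shows "(\<Sum>C | C \<subseteq> A \<and> a \<in> C \<and> r < card C. fact (card C - 1) * f (card A - card C)) =
         fact (card A - 1) * (\<Sum>m<card A - r. f m / fact m)"
proof -
  let ?S = "{C. C \<subseteq> A \<and> a \<in> C \<and> r < card C}"
  let ?n = "card A"
  have finS: "finite ?S" using fin by simp
  have cnt: "card {C \<in> ?S. card A - card C = m} = (?n - 1) choose m" if m: "m < ?n - r" for m
  proof -
    have "bij_betw (\<lambda>C. A - C) {C \<in> ?S. card A - card C = m} {B. B \<subseteq> A - {a} \<and> card B = m}"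
    proof (rule bij_betwI[where g = "\<lambda>B. A - B"])
      show "(\<lambda>B. A - B) \<in> {B. B \<subseteq> A - {a} \<and> card B = m} \<rightarrow> {C \<in> ?S. card A - card C = m}"
      proof
        fix B assume "B \<in> {B. B \<subseteq> A - {a} \<and> card B = m}"
        then have B: "B \<subseteq> A - {a}" "m = card B" by auto
        then have "finite B" "B \<subseteq> A" using fin finite_subset by auto
        then have "card (A - B) = card A - card B" "card B \<le> card A"
          using fin by (auto simp: card_Diff_subset card_mono)
        then show "A - B \<in> {C \<in> ?S. card A - card C = m}" using B a m by auto
      qed
      show "(\<lambda>C. A - C) \<in> {C \<in> ?S. card A - card C = m} \<rightarrow> {B. B \<subseteq> A - {a} \<and> card B = m}"
        using fin by (auto simp: card_Diff_subset finite_subset)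
    qed auto
    then have "card {C \<in> ?S. card A - card C = m} = card {B. B \<subseteq> A - {a} \<and> card B = m}"
      by (rule bij_betw_same_card)
    also have "\<dots> = (card (A - {a})) choose m" using fin by (intro n_subsets) auto
    finally show ?thesis using a fin by simp
  qed
  have cA: "card C \<le> ?n" if "C \<in> ?S" for C using that fin by (auto intro: card_mono)
  have "?n - card C < ?n - r" if "C \<in> ?S" for C
  proof -
    have "r < card C" using that by blast
    then show ?thesis using cA[OF that] by linarith
  qed
  then have sub: "(\<lambda>C. card A - card C) ` ?S \<subseteq> {..<?n - r}"
    by blast
  have "(\<Sum>C\<in>?S. fact (card C - 1) * f (card A - card C)) =
        (\<Sum>m<?n - r. \<Sum>C\<in>{C \<in> ?S. card A - card C = m}. fact (card C - 1) * f (card A - card C))"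
    by (rule sum.group[symmetric]) (use finS sub in auto)
  also have "\<dots> = (\<Sum>m<?n - r. fact (?n - 1) * (f m / fact m))"
  proof (rule sum.cong[OF refl])
    fix m assume m: "m \<in> {..<?n - r}"
    have "(\<Sum>C\<in>{C \<in> ?S. card A - card C = m}. fact (card C - 1) * f (card A - card C)) =
          (\<Sum>C\<in>{C \<in> ?S. card A - card C = m}. fact (?n - 1 - m) * f m)"
    proof (rule sum.cong[OF refl])
      fix C assume "C \<in> {C \<in> ?S. card A - card C = m}"
      then have *: "C \<in> ?S" "?n - card C = m" by blast+
      then have "card C \<le> ?n" by (intro cA)
      then have "card C - 1 = ?n - 1 - m" "?n - card C = m" using *(2) by linarith+
      then show "fact (card C - 1) * f (card A - card C) = fact (?n - 1 - m) * f m" by simp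
    qed
    also have "\<dots> = real ((?n - 1) choose m) * (fact (?n - 1 - m) * f m)"
      using cnt[of m] m by simp
    also have "\<dots> = fact (?n - 1) * (f m / fact m)"
      using m by (subst binomial_fact) (auto simp: field_simps)
    finally show "(\<Sum>C\<in>{C \<in> ?S. card A - card C = m}. fact (card C - 1) * f (card A - card C)) =
        fact (?n - 1) * (f m / fact m)" .
  qed
  finally show ?thesis by (simp add: sum_distrib_left)
qed

lemma long_cycle_perms_0: "finite A \<Longrightarrow> long_cycle_perms 0 A = {p. p permutes A}"
  unfolding long_cycle_perms_def by (auto simp: card_orbit_pos)

text \<open>Cyclic permutations need not be listed: for \<open>r = 0\<close> the splitting formula counts all permutations,
and this determines the number of cyclic ones by induction.\<close>
lemma card_cyclic_perms:
  assumes "finite A" "A \<noteq> {}"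
  shows "card (cyclic_perms A) = fact (card A - 1)"
  using assms
proof (induction A rule: finite_psubset_induct)
  case (psubset A)
  then obtain a where a: "a \<in> A" by auto
  let ?S = "{C. C \<subseteq> A \<and> a \<in> C \<and> 0 < card C}"
  have finS: "finite ?S" using psubset by simp
  have AS: "A \<in> ?S" using a psubset by (auto simp: card_gt_0_iff)
  have f0: "card (long_cycle_perms 0 B) = fact (card B)" if "finite B" for B
    using that by (simp add: long_cycle_perms_0 card_permutations)
  have "real (fact (card A)) = (\<Sum>C\<in>?S. real (card (cyclic_perms C) * card (long_cycle_perms 0 (A - C))))"
    using card_long_cycle_perms_split[OF psubset(1) a, of 0] f0[OF psubset(1)] by simp
  also have "\<dots> = (\<Sum>C\<in>?S. real (card (cyclic_perms C)) * fact (card A - card C))"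
    using psubset.hyps by (intro sum.cong refl) (auto simp: f0 card_Diff_subset finite_subset)
  also have "\<dots> = real (card (cyclic_perms A)) + (\<Sum>C\<in>?S - {A}. real (card (cyclic_perms C)) * fact (card A - card C))"
    by (subst sum.remove[OF finS AS]) simp
  also have "(\<Sum>C\<in>?S - {A}. real (card (cyclic_perms C)) * fact (card A - card C)) =
      (\<Sum>C\<in>?S - {A}. fact (card C - 1) * fact (card A - card C))"
  proof (rule sum.cong[OF refl])
    fix C assume "C \<in> ?S - {A}"
    then have "C \<subset> A" "C \<noteq> {}" by auto
    from psubset.IH[OF this] show "real (card (cyclic_perms C)) * fact (card A - card C) =
       fact (card C - 1) * fact (card A - card C)" by simp
  qed
  also have "\<dots> = (\<Sum>C\<in>?S. fact (card C - 1) * fact (card A - card C)) - fact (card A - 1)"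
    by (subst sum.remove[OF finS AS]) simp
  also have "(\<Sum>C\<in>?S. fact (card C - 1) * (fact (card A - card C) :: real)) = fact (card A - 1) * real (card A)"
    using sum_subsets_containing[OF psubset(1) a, where r = 0 and f = fact] by simp
  also have "fact (card A - 1) * real (card A) = real (fact (card A))"
    using AS by (simp add: fact_reduce)
  finally have "real (card (cyclic_perms A)) = real (fact (card A - 1))" by simp
  then show ?case by (simp only: of_nat_eq_iff)
qed

lemma card_long_cycle_perms:
  assumes "finite A"
  shows "real (card (long_cycle_perms r A)) = fact (card A) * rough_ratio r (card A)"
  using assms
proof (induction A rule: finite_psubset_induct)
  case (psubset A)
  show ?case
  proof (cases "A = {}")
    case True
    then show ?thesis by (simp add: long_cycle_perms_def rough_ratio_0)
  next
    case False
    then obtain a where a: "a \<in> A" by auto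
    have pos: "card A > 0" using False psubset by (simp add: card_gt_0_iff)
    let ?S = "{C. C \<subseteq> A \<and> a \<in> C \<and> r < card C}"
    let ?f = "\<lambda>m. fact m * rough_ratio r m"
    have "real (card (long_cycle_perms r A)) =
        (\<Sum>C\<in>?S. real (card (cyclic_perms C)) * real (card (long_cycle_perms r (A - C))))"
      using card_long_cycle_perms_split[OF psubset(1) a, of r] by simp
    also have "\<dots> = (\<Sum>C\<in>?S. fact (card C - 1) * ?f (card A - card C))"
    proof (rule sum.cong[OF refl])
      fix C assume C: "C \<in> ?S"
      then have fC: "finite C" "C \<noteq> {}" using psubset finite_subset by auto
      have "card (cyclic_perms C) = fact (card C - 1)" using card_cyclic_perms fC by blast
      moreover have "real (card (long_cycle_perms r (A - C))) = ?f (card (A - C))"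
        using C by (intro psubset.IH) auto
      moreover have "card (A - C) = card A - card C" using C fC by (simp add: card_Diff_subset)
      ultimately show "real (card (cyclic_perms C)) * real (card (long_cycle_perms r (A - C))) =
          fact (card C - 1) * ?f (card A - card C)" by simp
    qed
    also have "\<dots> = fact (card A - 1) * (\<Sum>m<card A - r. ?f m / fact m)"
      by (rule sum_subsets_containing[OF psubset(1) a])
    also have "(\<Sum>m<card A - r. ?f m / fact m) = real (card A) * rough_ratio r (card A)"
      by (simp add: rough_ratio_rec[OF pos])
    also have "fact (card A - 1) * (real (card A) * rough_ratio r (card A)) = ?f (card A)"
      using pos by (simp add: fact_reduce)
    finally show ?thesis .
  qed
qed

lemma kappa_eq_rough_ratio: "kappa n r = rough_ratio r n"
proof -
  have "(\<forall>j\<in>{1..r}. num_cycles n j p = 0) \<longleftrightarrow> (\<forall>x\<in>{1..n}. r < card (orbit p x))"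
    if "p permutes {1..n}" for p
  proof -
    have "0 < card (orbit p x)" for x
      by (rule card_orbit_pos[OF that]) simp
    moreover have "num_cycles n j p = 0 \<longleftrightarrow> (\<forall>x\<in>{1..n}. card (orbit p x) \<noteq> j)" for j
    proof -
      have "finite {c \<in> orbit p ` {1..n}. card c = j}" by simp
      then have "num_cycles n j p = 0 \<longleftrightarrow> {c \<in> orbit p ` {1..n}. card c = j} = {}"
        unfolding num_cycles_def by (rule card_0_eq)
      then show ?thesis by blast
    qed
    ultimately show ?thesis
      by (metis One_nat_def Suc_leI atLeastAtMost_iff not_less)
  qed
  then have "{\<sigma>. \<sigma> permutes {1..n} \<and> (\<forall>j\<in>{1..r}. num_cycles n j \<sigma> = 0)} = long_cycle_perms r {1..n}"
    unfolding long_cycle_perms_def by blast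
  then show ?thesis
    using card_long_cycle_perms[of "{1..n}" r] by (simp add: kappa_def)
qed

lemma kappa_0: "kappa 0 r = 1"
  by (simp add: kappa_eq_rough_ratio rough_ratio_0)

lemma kappa_rec: "n > 0 \<Longrightarrow> real n * kappa n r = (\<Sum>m<n - r. kappa m r)"
  by (simp add: kappa_eq_rough_ratio rough_ratio_rec)

section \<open>The Buchstab function\<close>

text \<open>Picard iteration for the integrated equation \<open>v \<omega>(v) = 1 + \<integral>\<^sub>2\<^sup>v \<omega>(t - 1) dt\<close>. Because of the delay the
\<open>k\<close>-th iterate is already exact for \<open>v \<le> k + 2\<close>.\<close>
primrec buchstab_iter :: "nat \<Rightarrow> real \<Rightarrow> real" where
  "buchstab_iter 0 v = 1 / v"
| "buchstab_iter (Suc k) v = (1 + integral {2..v} (\<lambda>t. buchstab_iter k (t - 1))) / v"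

lemma at_within_Ici_eq_Icc:
  fixes x :: real
  shows "at x within {a..} = at x within {a..x + 1}"
  by (rule at_within_nhd[where S = "{..<x + 1}"]) auto

lemma continuous_on_indefinite_integral:
  fixes f :: "real \<Rightarrow> real"
  assumes "continuous_on {a..} f"
  shows "continuous_on {a..} (\<lambda>x. integral {a..x} f)"
  unfolding continuous_on_eq_continuous_within
proof
  fix x :: real assume "x \<in> {a..}"
  have "continuous_on {a..x + 1} f" using assms by (rule continuous_on_subset) auto
  then have "continuous_on {a..x + 1} (\<lambda>x. integral {a..x} f)"
    by (intro indefinite_integral_continuous_1 integrable_continuous_real)
  then show "continuous (at x within {a..}) (\<lambda>x. integral {a..x} f)"
    using \<open>x \<in> {a..}\<close> by (subst at_within_Ici_eq_Icc) (simp add: continuous_on_eq_continuous_within)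
qed

lemma continuous_on_buchstab_iter: "continuous_on {1..} (buchstab_iter k)"
proof (induction k)
  case 0
  have "continuous_on {1..} (\<lambda>v::real. 1 / v)" by (intro continuous_intros) auto
  then show ?case by (simp add: buchstab_iter.simps[abs_def])
next
  case (Suc k)
  let ?J = "\<lambda>v. integral {2..v} (\<lambda>t. buchstab_iter k (t - 1))"
  have "continuous_on {2..} (\<lambda>t. buchstab_iter k (t - 1))"
    by (rule continuous_on_compose2[OF Suc]) (auto intro!: continuous_intros)
  then have "continuous_on {2..} ?J" by (rule continuous_on_indefinite_integral)
  then have "continuous_on {1..} (\<lambda>v. ?J (max 2 v))"
    by (rule continuous_on_compose2) (auto intro!: continuous_intros)
  moreover have "?J (max 2 v) = ?J v" for v
    by (cases "v < 2") (auto simp: max_def)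
  ultimately have "continuous_on {1..} ?J" by simp
  then have "continuous_on {1..} (\<lambda>v. (1 + ?J v) / v)" by (intro continuous_intros) auto
  then show ?case by (simp add: buchstab_iter.simps[abs_def])
qed

lemma buchstab_iter_stable_Suc: "1 \<le> v \<Longrightarrow> v \<le> real k + 2 \<Longrightarrow> buchstab_iter (Suc k) v = buchstab_iter k v"
proof (induction k arbitrary: v)
  case 0
  then have "integral {2..v} (\<lambda>t. buchstab_iter 0 (t - 1)) = 0"
    by (cases "v = 2") auto
  then show ?case by simp
next
  case (Suc k)
  have "integral {2..v} (\<lambda>t. buchstab_iter (Suc k) (t - 1)) = integral {2..v} (\<lambda>t. buchstab_iter k (t - 1))"
  proof (rule integral_cong)
    fix t assume "t \<in> {2..v}"
    then show "buchstab_iter (Suc k) (t - 1) = buchstab_iter k (t - 1)"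
      using Suc.prems by (intro Suc.IH) auto
  qed
  then show ?case by simp
qed

lemma buchstab_iter_stable:
  assumes "1 \<le> v" "v \<le> real k + 2" "k \<le> l"
  shows "buchstab_iter l v = buchstab_iter k v"
  using assms(3)
proof (induction l rule: dec_induct)
  case (step l)
  then show ?case using buchstab_iter_stable_Suc[of v l] assms by simp
qed simp

text \<open>The index \<open>\<lceil>v\<rceil>\<close> is one choice beyond which the iterates at \<open>v\<close> no longer change.\<close>
definition buchstab_limit :: "real \<Rightarrow> real" where
  "buchstab_limit v = (if v < 1 then 0 else buchstab_iter (nat \<lceil>v\<rceil>) v)"

lemma buchstab_limit_eq:
  assumes "1 \<le> v" "v \<le> real k + 2"
  shows "buchstab_limit v = buchstab_iter k v"
proof -
  have "v \<le> real (nat \<lceil>v\<rceil>) + 2" using assms by linarith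
  then have "buchstab_iter (nat \<lceil>v\<rceil>) v = buchstab_iter k v"
    using assms buchstab_iter_stable[of v k "nat \<lceil>v\<rceil>"] buchstab_iter_stable[of v "nat \<lceil>v\<rceil>" k]
      nat_le_linear[of k "nat \<lceil>v\<rceil>"] by argo
  then show ?thesis using assms by (simp add: buchstab_limit_def)
qed

lemma continuous_on_buchstab_limit: "continuous_on {1..} buchstab_limit"
  unfolding continuous_on_eq_continuous_within
proof
  fix x :: real assume x: "x \<in> {1..}"
  define k where "k = nat \<lceil>x\<rceil>"
  have k: "x + 1 \<le> real k + 2" using x by (simp add: k_def) linarith
  have "continuous_on {1..x + 1} (buchstab_iter k)"
    using continuous_on_buchstab_iter by (rule continuous_on_subset) auto
  moreover have "buchstab_iter k v = buchstab_limit v" if "v \<in> {1..x + 1}" for v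
    using buchstab_limit_eq[of v k] that k by auto
  ultimately have "continuous_on {1..x + 1} buchstab_limit"
    by (subst continuous_on_cong[OF refl, of _ _ "buchstab_iter k"]) auto
  then show "continuous (at x within {1..}) buchstab_limit"
    using x by (subst at_within_Ici_eq_Icc) (simp add: continuous_on_eq_continuous_within)
qed

lemma is_buchstab_limit: "is_buchstab buchstab_limit"
  unfolding is_buchstab_def
proof (intro conjI allI ballI impI)
  show "buchstab_limit v = 0" if "v < 1" for v using that by (simp add: buchstab_limit_def)
  show "continuous_on {1..} buchstab_limit" by (rule continuous_on_buchstab_limit)
  show "v * buchstab_limit v = 1" if "v \<in> {1..2}" for v
    using that buchstab_limit_eq[of v 0] by simp
next
  fix v :: real assume v: "v > 2"
  let ?f = "\<lambda>t. buchstab_limit (t - 1)"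
  define k where "k = nat \<lceil>v\<rceil>"
  have k: "v + 1 \<le> real k + 2" using v by (simp add: k_def) linarith
  have cont: "continuous_on {2..v + 1} ?f"
    by (rule continuous_on_compose2[OF continuous_on_buchstab_limit]) (auto intro!: continuous_intros)
  have "((\<lambda>x. integral {2..x} ?f) has_real_derivative ?f v) (at v within {2..v + 1})"
    using v by (intro integral_has_real_derivative cont) auto
  then have "((\<lambda>x. integral {2..x} ?f) has_real_derivative ?f v) (at v)"
    using v by (simp add: at_within_Icc_at)
  then have "((\<lambda>x. 1 + integral {2..x} ?f) has_real_derivative ?f v) (at v)"
    by (auto intro!: derivative_eq_intros)
  then show "((\<lambda>t. t * buchstab_limit t) has_real_derivative buchstab_limit (v - 1)) (at v)"
  proof (rule has_field_derivative_transform_within_open)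
    show "open {2<..<v + 1}" "v \<in> {2<..<v + 1}" using v by auto
    fix x assume x: "x \<in> {2<..<v + 1}"
    have "integral {2..x} ?f = integral {2..x} (\<lambda>t. buchstab_iter k (t - 1))"
      using x k by (intro integral_cong buchstab_limit_eq) auto
    moreover have "buchstab_limit x = buchstab_iter (Suc k) x"
      using x k by (intro buchstab_limit_eq) auto
    ultimately show "1 + integral {2..x} ?f = x * buchstab_limit x"
      using x by simp
  qed
qed

text \<open>Method of steps: if two solutions agree up to \<open>n + 2\<close>, then \<open>v\<close> times their difference has
derivative zero up to \<open>n + 3\<close>.\<close>
lemma is_buchstab_unique:
  assumes w: "is_buchstab w" and w': "is_buchstab w'"
  shows "w = w'"
proof -
  have *: "v \<le> real n + 2 \<Longrightarrow> w v = w' v" for n v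
  proof (induction n arbitrary: v)
    case 0
    show ?case
    proof (cases "v < 1")
      case True
      then show ?thesis using w w' by (simp add: is_buchstab_def)
    next
      case False
      then have "v * w v = 1" "v * w' v = 1" using 0 w w' by (simp_all add: is_buchstab_def)
      then show ?thesis using False by (metis mult_cancel_left zero_less_one)
    qed
  next
    case (Suc n)
    show ?case
    proof (cases "v \<le> 2")
      case True
      then show ?thesis using Suc.IH[of v] by simp
    next
      case False
      let ?d = "\<lambda>t. t * w t - t * w' t"
      have "?d v = ?d 2"
      proof (rule DERIV_isconst_end[where f = ?d])
        show "2 < v" using False by simp
        have "continuous_on {2..v} w" "continuous_on {2..v} w'"
          using w w' by (auto simp: is_buchstab_def elim!: continuous_on_subset)
        then show "continuous_on {2..v} ?d" by (intro continuous_intros)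
        fix x assume x: "2 < x" "x < v"
        have "w (x - 1) = w' (x - 1)" using x Suc.prems by (intro Suc.IH) auto
        moreover have "((\<lambda>t. t * w t) has_real_derivative w (x - 1)) (at x)"
          "((\<lambda>t. t * w' t) has_real_derivative w' (x - 1)) (at x)"
          using w w' x by (auto simp: is_buchstab_def)
        ultimately show "(?d has_real_derivative 0) (at x)"
          using DERIV_diff by fastforce
      qed
      also have "\<dots> = 0" using Suc.IH[of 2] by simp
      finally show ?thesis using False by simp
    qed
  qed
  show ?thesis
  proof
    fix v
    have "v \<le> real (nat \<lceil>v\<rceil>) + 2" by linarith
    then show "w v = w' v" by (rule *)
  qed
qed

lemma is_buchstab_buchstab: "is_buchstab buchstab"
  unfolding buchstab_def
  by (rule theI[of is_buchstab, OF is_buchstab_limit]) (rule is_buchstab_unique[OF _ is_buchstab_limit])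

lemma buchstab_on_1_2: "1 \<le> v \<Longrightarrow> v \<le> 2 \<Longrightarrow> v * buchstab v = 1"
  and continuous_on_buchstab: "continuous_on {1..} buchstab"
  and buchstab_deriv: "2 < v \<Longrightarrow> ((\<lambda>t. t * buchstab t) has_real_derivative buchstab (v - 1)) (at v)"
  using is_buchstab_buchstab by (simp_all add: is_buchstab_def)

text \<open>The exact counterpart of one step of the recursion for \<open>kappa\<close>, with \<open>c - 1\<close> in place of the lattice
point. It replaces the comparison of a Riemann sum with an integral.\<close>
lemma buchstab_mean_value:
  assumes "2 \<le> a" "a < b"
  obtains c where "a < c" "c < b" "b * buchstab b - a * buchstab a = (b - a) * buchstab (c - 1)"
proof -
  let ?g = "\<lambda>t. t * buchstab t"
  have "continuous_on {a..b} buchstab"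
    using continuous_on_buchstab by (rule continuous_on_subset) (use assms in auto)
  then have "continuous_on {a..b} ?g" by (intro continuous_intros)
  then have "\<exists>l z. a < z \<and> z < b \<and> DERIV ?g z :> l \<and> ?g b - ?g a = (b - a) * l"
  proof (intro MVT)
    fix x assume x: "a < x" "x < b"
    then have "(?g has_real_derivative buchstab (x - 1)) (at x)"
      using assms by (intro buchstab_deriv) auto
    then show "?g differentiable (at x)" by (auto simp: real_differentiable_def)
  qed (use assms in auto)
  then obtain l z where z: "a < z" "z < b" "DERIV ?g z :> l" "?g b - ?g a = (b - a) * l" by blast
  moreover have "l = buchstab (z - 1)"
    using z assms buchstab_deriv[of z] DERIV_unique by auto
  ultimately show ?thesis using that by auto
qed

text \<open>It is \<open>v \<omega>(v)\<close> that has a bounded derivative away from the corner at \<open>v = 2\<close>, hence the detour through it.\<close>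
lemma buchstab_lipschitz:
  obtains L where "0 < L"
    "\<And>a b. 1 \<le> a \<Longrightarrow> a \<le> K \<Longrightarrow> 1 \<le> b \<Longrightarrow> b \<le> K \<Longrightarrow> \<bar>buchstab a - buchstab b\<bar> \<le> L * \<bar>a - b\<bar>"
proof -
  let ?g = "\<lambda>t. t * buchstab t"
  have "continuous_on {1..K} buchstab"
    using continuous_on_buchstab by (rule continuous_on_subset) auto
  then have "compact (buchstab ` {1..K})" by (rule compact_continuous_image) simp
  then obtain B where B: "B > 0" "\<And>v. v \<in> {1..K} \<Longrightarrow> \<bar>buchstab v\<bar> \<le> B"
    using compact_imp_bounded[of "buchstab ` {1..K}"] unfolding bounded_pos by auto
  have g2: "\<bar>?g b - ?g a\<bar> \<le> B * (b - a)" if "2 \<le> a" "a \<le> b" "b \<le> K" for a b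
  proof (cases "a = b")
    case False
    then have "a < b" using that by simp
    with that obtain c where "a < c" "c < b" "?g b - ?g a = (b - a) * buchstab (c - 1)"
      using buchstab_mean_value[of a b] by blast
    then show ?thesis using B(2)[of "c - 1"] that by (simp add: abs_mult mult.commute mult_right_mono)
  qed simp
  have g: "\<bar>?g b - ?g a\<bar> \<le> B * (b - a)" if "1 \<le> a" "a \<le> b" "b \<le> K" for a b
  proof -
    consider "2 \<le> a" | "b \<le> 2" | "a < 2" "2 < b" by linarith
    then show ?thesis
    proof cases
      case 1 then show ?thesis using g2 that by blast
    next
      case 2 then show ?thesis using that B buchstab_on_1_2[of a] buchstab_on_1_2[of b] by simp
    next
      case 3
      have "\<bar>?g b - ?g a\<bar> = \<bar>?g b - ?g 2\<bar>"
        using 3 that buchstab_on_1_2[of a] buchstab_on_1_2[of 2] by simp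
      also have "\<dots> \<le> B * (b - 2)" using 3 that by (intro g2) auto
      also have "\<dots> \<le> B * (b - a)" using 3 B by (intro mult_left_mono) auto
      finally show ?thesis .
    qed
  qed
  have w: "\<bar>buchstab b - buchstab a\<bar> \<le> 2 * B * (b - a)" if "1 \<le> a" "a \<le> b" "b \<le> K" for a b
  proof -
    have "buchstab b - buchstab a = ((?g b - ?g a) - (b - a) * buchstab a) / b"
      using that by (simp add: field_simps)
    also have "\<bar>\<dots>\<bar> \<le> \<bar>(?g b - ?g a) - (b - a) * buchstab a\<bar> / 1"
      unfolding abs_divide using that by (intro divide_left_mono) auto
    also have "\<dots> \<le> \<bar>?g b - ?g a\<bar> + (b - a) * \<bar>buchstab a\<bar>"
      using that by (simp add: abs_mult order_trans[OF abs_triangle_ineq4])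
    also have "\<dots> \<le> B * (b - a) + (b - a) * B"
      using that B(2)[of a] by (intro add_mono g mult_left_mono) auto
    finally show ?thesis by (simp add: algebra_simps)
  qed
  show ?thesis
  proof (rule that[of "2 * B"])
    show "0 < 2 * B" using B by simp
    fix a b assume ab: "1 \<le> a" "a \<le> K" "1 \<le> b" "b \<le> K"
    then show "\<bar>buchstab a - buchstab b\<bar> \<le> 2 * B * \<bar>a - b\<bar>"
      using w[of a b] w[of b a] by (cases "a \<le> b") (auto simp: abs_minus_commute)
  qed
qed

lemma kappa_small: "0 < n \<Longrightarrow> n \<le> r \<Longrightarrow> kappa n r = 0"
  using kappa_rec[of n r] by simp

lemma kappa_first: 
  assumes "r < n" "n \<le> 2 * r + 1"
  shows "real n * kappa n r = 1"
proof -
  have "(\<Sum>m<n - r. kappa m r) = (\<Sum>m<n - r. if m = 0 then 1 else 0)"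
    using assms by (intro sum.cong refl) (auto simp: kappa_0 kappa_small)
  also have "\<dots> = 1" using assms by simp
  finally show ?thesis using kappa_rec[of n r] assms by simp
qed

lemma kappa_step:
  assumes "r < n"
  shows "real (Suc n) * kappa (Suc n) r = real n * kappa n r + kappa (n - r) r"
  using kappa_rec[of "Suc n" r] kappa_rec[of n r] assms by (simp add: Suc_diff_le)

text \<open>Let \<open>e\<^sub>n = r kappa n r - \<omega>(n / r)\<close>. Then \<open>n e\<^sub>n = m e\<^sub>m + e\<^sub>m\<^sub>-\<^sub>r\<close> for \<open>n = m + 1\<close>, up to \<open>O(1 / r)\<close>, so \<open>e\<^sub>n\<close> is an
average of earlier errors up to \<open>O(1 / r\<^sup>2)\<close>. For \<open>r < n \<le> 2 r\<close> both quantities are known and \<open>e\<^sub>n = 0\<close>. The only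
large value is \<open>e\<^sub>r = -1\<close>, because \<open>kappa r r = 0\<close> whereas \<open>\<omega>(1) = 1\<close>; it enters once, at \<open>n = 2 r + 1\<close>, where it
is divided by \<open>n\<close>.\<close>
lemma kappa_buchstab_bounded:
  obtains C where "0 < C"
    "\<And>n r. 0 < r \<Longrightarrow> r < n \<Longrightarrow> real n \<le> K * real r \<Longrightarrow> \<bar>real r * kappa n r - buchstab (real n / real r)\<bar> \<le> C / real r"
proof -
  obtain L where L: "0 < L"
    "\<And>a b. 1 \<le> a \<Longrightarrow> a \<le> K \<Longrightarrow> 1 \<le> b \<Longrightarrow> b \<le> K \<Longrightarrow> \<bar>buchstab a - buchstab b\<bar> \<le> L * \<bar>a - b\<bar>"
    using buchstab_lipschitz[of K] by blast
  have main: "\<bar>real r * kappa n r - buchstab (real n / real r)\<bar>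
      \<le> (1 + L) / real r + real (n - 2 * r) * (L / (real r)\<^sup>2)"
    if r: "0 < r" and n: "r < n" "real n \<le> K * real r" for n r
    using n
  proof (induction n rule: less_induct)
    case (less n)
    define e where "e = (\<lambda>m. real r * kappa m r - buchstab (real m / real r))"
    define D where "D = (\<lambda>m. (1 + L) / real r + real (m - 2 * r) * (L / (real r)\<^sup>2))"
    have Dmono: "D l \<le> D m" if "l \<le> m" for l m
      unfolding D_def using that L r by (intro add_mono mult_right_mono) auto
    have Dge: "D m \<ge> (1 + L) / real r" for m unfolding D_def using L r by auto
    have IH: "\<bar>e m\<bar> \<le> D m" if "m < n" "r < m" for m
      using less.IH[of m] that less.prems by (auto simp: e_def D_def)
    have e0: "e m = 0" if m: "r < m" "m \<le> 2 * r" for m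
    proof -
      have "real m * kappa m r = 1" using m by (intro kappa_first) auto
      moreover have "real m / real r * buchstab (real m / real r) = 1"
        using m r by (intro buchstab_on_1_2) (auto simp: field_simps)
      moreover have "real m * e m = real r * (real m * kappa m r) - real r * (real m / real r * buchstab (real m / real r))"
        using r by (simp add: e_def algebra_simps)
      ultimately have "real m * e m = 0" by simp
      then show ?thesis using m by simp
    qed
    show ?case
    proof (cases "n \<le> 2 * r")
      case True
      then have "e n = 0" using less.prems by (intro e0) auto
      then show ?thesis using L by (simp add: e_def)
    next
      case False
      then obtain m where m: "n = Suc m" "2 * r \<le> m" by (cases n) auto
      let ?a = "real m / real r" and ?b = "real n / real r"
      have "2 \<le> ?a" "?a < ?b" using m r by (auto simp: field_simps)
      then obtain c where c: "?a < c" "c < ?b"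
        "?b * buchstab ?b - ?a * buchstab ?a = (?b - ?a) * buchstab (c - 1)"
        using buchstab_mean_value by blast
      have ba: "?b - ?a = 1 / real r" using m r by (simp add: diff_divide_distrib[symmetric])
      have mr: "real (m - r) = real m - real r" using m by simp
      have dist: "\<bar>buchstab (c - 1) - buchstab (real (m - r) / real r)\<bar> \<le> L * (1 / real r)"
      proof -
        have eq: "real (m - r) / real r = ?a - 1" using r mr by (simp add: field_simps)
        have bK: "?b \<le> K" using less.prems r by (simp add: field_simps)
        have "\<bar>buchstab (c - 1) - buchstab (?a - 1)\<bar> \<le> L * \<bar>(c - 1) - (?a - 1)\<bar>"
          using c \<open>2 \<le> ?a\<close> bK by (intro L(2)) auto
        also have "\<dots> \<le> L * (1 / real r)" using c ba L by (intro mult_left_mono) auto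
        finally show ?thesis unfolding eq .
      qed
      have "real n * buchstab ?b - real m * buchstab ?a = buchstab (c - 1)"
      proof -
        have "real r * (?b * buchstab ?b - ?a * buchstab ?a) = buchstab (c - 1)"
          using c(3) ba r by simp
        then show ?thesis using r by (simp add: right_diff_distrib)
      qed
      moreover have "real n * kappa n r = real m * kappa m r + kappa (m - r) r"
        using m r unfolding m(1) by (intro kappa_step) auto
      then have "real r * (real n * kappa n r) = real r * (real m * kappa m r + kappa (m - r) r)"
        by (rule arg_cong)
      ultimately have rec: "real n * e n = real m * e m + e (m - r) - (buchstab (c - 1) - buchstab (real (m - r) / real r))"
        unfolding e_def by (simp add: algebra_simps)
      then have bound: "real n * \<bar>e n\<bar> \<le> real m * \<bar>e m\<bar> + \<bar>e (m - r)\<bar> + L / real r"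
      proof -
        have "real n * \<bar>e n\<bar> = \<bar>real n * e n\<bar>" by (simp add: abs_mult)
        also have "\<dots> \<le> \<bar>real m * e m\<bar> + \<bar>e (m - r)\<bar> + \<bar>buchstab (c - 1) - buchstab (real (m - r) / real r)\<bar>"
          unfolding rec by linarith
        finally show ?thesis using dist by (simp add: abs_mult)
      qed
      show ?thesis
      proof (cases "m = 2 * r")
        case True
        have em: "e m = 0" using True r by (intro e0) auto
        have "e r = - 1" using buchstab_on_1_2[of 1] kappa_small[of r r] r by (simp add: e_def)
        then have "real n * \<bar>e n\<bar> \<le> 1 + L / real r" using bound em True by simp
        also have "\<dots> \<le> 1 + L" using L r by (simp add: field_simps)
        also have "\<dots> \<le> real n * ((1 + L) / real r)"
        proof -
          have "real r * (1 + L) \<le> real n * (1 + L)" using m L by (intro mult_right_mono) auto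
          then show ?thesis using r by (simp add: field_simps)
        qed
        finally have "\<bar>e n\<bar> \<le> (1 + L) / real r"
          by (rule mult_left_le_imp_le) (use m in simp)
        then show ?thesis using Dge[of n] by (simp add: e_def D_def)
      next
        case False
        then have mr': "r < m - r" using m r by linarith
        have "real n * \<bar>e n\<bar> \<le> real m * D m + D m + L / real r"
        proof -
          have "\<bar>e m\<bar> \<le> D m" using m r by (intro IH) auto
          moreover have "\<bar>e (m - r)\<bar> \<le> D (m - r)" using m r mr' by (intro IH) auto
          moreover have "D (m - r) \<le> D m" by (rule Dmono) simp
          ultimately show ?thesis using bound mult_left_mono[of "\<bar>e m\<bar>" "D m" "real m"] by linarith
        qed
        also have "\<dots> = real n * D m + L / real r" using m by (simp add: algebra_simps)
        also have "\<dots> \<le> real n * D m + real n * (L / (real r)\<^sup>2)"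
        proof -
          have "L / real r = real r * (L / (real r)\<^sup>2)" using r by (simp add: power2_eq_square)
          also have "\<dots> \<le> real n * (L / (real r)\<^sup>2)" using m L by (intro mult_right_mono) auto
          finally show ?thesis by simp
        qed
        also have "\<dots> = real n * (D m + L / (real r)\<^sup>2)" by (simp add: distrib_left)
        also have "D m + L / (real r)\<^sup>2 = D n"
          using m by (simp add: D_def Suc_diff_le distrib_right add_divide_distrib)
        finally have "\<bar>e n\<bar> \<le> D n"
          by (rule mult_left_le_imp_le) (use m in simp)
        then show ?thesis by (simp add: e_def D_def)
      qed
    qed
  qed
  show ?thesis
  proof (rule that[of "1 + L + \<bar>K\<bar> * L"])
    show "0 < 1 + L + \<bar>K\<bar> * L" using L by (simp add: add_pos_nonneg)
    fix n r :: nat assume nr: "0 < r" "r < n" "real n \<le> K * real r"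
    have "real (n - 2 * r) * (L / (real r)\<^sup>2) \<le> (\<bar>K\<bar> * real r) * (L / (real r)\<^sup>2)"
    proof (intro mult_right_mono)
      have "real (n - 2 * r) \<le> real n" by simp
      also have "\<dots> \<le> \<bar>K\<bar> * real r" using nr by (meson abs_ge_self mult_right_mono of_nat_0_le_iff order_trans)
      finally show "real (n - 2 * r) \<le> \<bar>K\<bar> * real r" .
    qed (use L in auto)
    also have "\<dots> = \<bar>K\<bar> * L / real r" using nr by (simp add: power2_eq_square)
    finally show "\<bar>real r * kappa n r - buchstab (real n / real r)\<bar> \<le> (1 + L + \<bar>K\<bar> * L) / real r"
      using main[OF nr] by (simp add: add_divide_distrib)
  qed
qed

lemma abs_euler_mascheroni_diff_le:
  assumes "0 < r"
  shows "\<bar>ln (real r) - harm r + euler_mascheroni\<bar> \<le> 1 / real r"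
proof -
  have e: "euler_mascheroni \<in> {(harm r - ln (real (Suc r))) + inverse (real (2*(r+1)))..
      (harm r - ln (real (Suc r))) + inverse (real (2*r))}"
    using assms by (intro euler_mascheroni_bounds) auto
  have l: "ln (real (Suc r)) - ln (real r) \<le> 1 / real r"
    using ln_diff_le_inverse[of "real r"] assms by (simp add: add.commute)
  have l2: "ln (real (Suc r)) \<ge> ln (real r)" using assms by simp
  have "inverse (real (2*(r+1))) \<ge> 0" "inverse (real (2*r)) \<le> 1 / real r" using assms by (auto simp: field_simps)
  then show ?thesis using e l l2 unfolding atLeastAtMost_iff abs_le_iff by linarith
qed

lemma abs_exp_minus_one_le:
  fixes y :: real
  assumes "\<bar>y\<bar> \<le> 1"
  shows "\<bar>exp y - 1\<bar> \<le> 2 * \<bar>y\<bar>"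
proof (cases "0 \<le> y")
  case True
  have "exp y \<le> 1 + y + y\<^sup>2" using exp_bound[of y] assms True by simp
  moreover have "y\<^sup>2 \<le> y" using assms True by (simp add: power2_eq_square mult_left_le)
  moreover have "1 + y \<le> exp y" by (rule exp_ge_add_one_self)
  ultimately show ?thesis using True by simp
next
  case False
  then have "exp y \<le> 1" by simp
  moreover have "1 + y \<le> exp y" by (rule exp_ge_add_one_self)
  ultimately show ?thesis using False by linarith
qed

lemma abs_exp_harm_diff_le:
  assumes "0 < r"
  shows "\<bar>real r * exp (- harm r + euler_mascheroni) - 1\<bar> \<le> 2 / real r"
proof -
  let ?x = "ln (real r) - harm r + euler_mascheroni"
  have x: "\<bar>?x\<bar> \<le> 1 / real r" by (rule abs_euler_mascheroni_diff_le[OF assms])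
  have r1: "1 / real r \<le> 1" using assms by simp
  have "real r * exp (- harm r + euler_mascheroni) = exp ?x"
    using assms by (simp add: exp_add exp_diff exp_minus field_simps)
  moreover have "\<bar>exp ?x - 1\<bar> \<le> 2 * \<bar>?x\<bar>"
    using x r1 by (intro abs_exp_minus_one_le) linarith
  ultimately show ?thesis using x by (simp add: divide_inverse)
qed

section \<open>Generating function and periodic primitives\<close>

definition short_cycle_poly :: "nat \<Rightarrow> complex \<Rightarrow> complex" where
  "short_cycle_poly r z = (\<Sum>j=1..r. z ^ j / of_nat j)"

lemma short_cycle_poly_1: "short_cycle_poly r 1 = of_real (harm r)"
  by (simp add: short_cycle_poly_def harm_def divide_inverse)

lemma has_field_derivative_short_cycle_poly:
  "(short_cycle_poly r has_field_derivative (\<Sum>j<r. z ^ j)) (at z)"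
proof -
  have "(short_cycle_poly r has_field_derivative (\<Sum>j=1..r. of_nat j * z ^ (j - 1) / of_nat j)) (at z)"
    unfolding short_cycle_poly_def[abs_def] by (auto intro!: derivative_eq_intros)
  also have "(\<Sum>j=1..r. of_nat j * z ^ (j - 1) / of_nat j) = (\<Sum>j=1..r. z ^ (j - 1))"
    by (intro sum.cong) auto
  also have "\<dots> = (\<Sum>j<r. z ^ j)"
    by (rule sum.reindex_bij_witness[of _ Suc "\<lambda>j. j - 1"]) auto
  finally show ?thesis .
qed

lemma holomorphic_short_cycle_poly: "short_cycle_poly r holomorphic_on A"
  using has_field_derivative_short_cycle_poly by (meson holomorphic_onI field_differentiable_def field_differentiable_at_within)

text \<open>With \<open>F = \<Sum> kappa n r z\<^sup>n\<close>, the recursion reads \<open>(1 - z) F' = z\<^sup>r F\<close>, and \<open>exp (- short_cycle_poly r z) / (1 - z)\<close>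
solves the same equation. Subtracting the pole at \<open>1\<close> leaves an entire function, whose coefficients are therefore
\<open>kappa n r\<close> minus \<open>exp (- harm r)\<close>, the coefficient of \<open>1 / (1 - z)\<close> at the pole.\<close>
lemma rough_generating_function:
  assumes r: "0 < r"
  defines "G \<equiv> \<lambda>z. exp (- short_cycle_poly r z)"
  obtains C where "fps_conv_radius C = \<infinity>"
    "\<And>n. fps_nth C n = of_real (kappa n r - exp (- harm r))"
    "\<And>z. (1 - z) * eval_fps C z = G z - of_real (exp (- harm r))"
proof -
  let ?b = "of_real (exp (- harm r)) :: complex"
  have hG: "G holomorphic_on UNIV"
    unfolding G_def by (intro holomorphic_intros holomorphic_short_cycle_poly)
  have G1: "G 1 = ?b" by (simp add: G_def short_cycle_poly_1 flip: of_real_minus exp_of_real)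
  define A where "A = fps_expansion G 0"
  have A: "G has_fps_expansion A"
    unfolding A_def by (rule has_fps_expansion_fps_expansion[of UNIV]) (use hG in auto)
  have dG: "deriv G = (\<lambda>z. - (\<Sum>j<r. z ^ j) * G z)"
  proof
    fix z
    have "(G has_field_derivative - (\<Sum>j<r. z ^ j) * G z) (at z)"
      unfolding G_def by (auto intro!: derivative_eq_intros has_field_derivative_short_cycle_poly)
    then show "deriv G z = - (\<Sum>j<r. z ^ j) * G z" by (rule DERIV_imp_deriv)
  qed
  have "deriv G has_fps_expansion fps_deriv A" using A by (rule has_fps_expansion_deriv)
  moreover have "deriv G has_fps_expansion - (\<Sum>j<r. fps_X ^ j) * A"
    unfolding dG by (intro fps_expansion_intros A)
  ultimately have dA: "fps_deriv A = - (\<Sum>j<r. fps_X ^ j) * A"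
    by (rule fps_expansion_unique_complex)
  define E where "E = (Abs_fps (\<lambda>_. 1) :: complex fps)"
  have En: "fps_nth E n = 1" for n by (simp add: E_def)
  have E: "E * (1 - fps_X) = 1"
    by (rule fps_ext) (simp add: right_diff_distrib En)
  define F where "F = A * E"
  \<comment> \<open>\<open>F\<close> is the candidate for the generating function of \<open>kappa\<close>, and \<open>E\<close> the geometric series.\<close>
  have FA: "F * (1 - fps_X) = A" unfolding F_def mult.assoc E by simp
  have gp: "(\<Sum>j<r. fps_X ^ j) * (1 - fps_X) = (1 - fps_X ^ r :: complex fps)"
    using one_diff_power_eq[of "fps_X :: complex fps" r] by (simp add: mult.commute)
  have dF: "fps_deriv F * (1 - fps_X) = fps_X ^ r * F"
  proof -
    have "fps_deriv A = fps_deriv F * (1 - fps_X) - F"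
      unfolding FA[symmetric] by (simp add: algebra_simps)
    moreover have "fps_deriv A = - (1 - fps_X ^ r) * F"
    proof -
      have "fps_deriv A = - (\<Sum>j<r. fps_X ^ j) * (F * (1 - fps_X))" using dA FA by simp
      also have "\<dots> = - ((\<Sum>j<r. fps_X ^ j) * (1 - fps_X)) * F" by (simp only: mult_ac mult_minus_left mult_minus_right)
      finally show ?thesis unfolding gp .
    qed
    ultimately show ?thesis by (simp add: algebra_simps)
  qed
  have rec: "of_nat (Suc n) * fps_nth F (Suc n) = of_nat n * fps_nth F n + (if n < r then 0 else fps_nth F (n - r))" for n
  proof -
    have "fps_nth (fps_deriv F * (1 - fps_X)) n = fps_nth (fps_X ^ r * F) n" by (simp add: dF)
    then show ?thesis
      by (cases n) (auto simp: algebra_simps fps_X_power_mult_nth fps_X_power_mult_right_nth)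
  qed
  have F: "fps_nth F n = of_real (kappa n r)" for n
  proof (induction n rule: less_induct)
    case (less n)
    show ?case
    proof (cases n)
      case 0
      have "fps_nth F 0 = fps_nth A 0" by (simp add: F_def En)
      also have "\<dots> = G 0" using A by (simp add: has_fps_expansion_imp_0_eq_fps_nth_0)
      also have "\<dots> = 1" by (simp add: G_def short_cycle_poly_def power_0_left)
      finally show ?thesis using 0 by (simp add: kappa_0)
    next
      case (Suc m)
      have kap: "real (Suc m) * kappa (Suc m) r = real m * kappa m r + (if m < r then 0 else kappa (m - r) r)"
      proof (cases "m < r")
        case True
        then show ?thesis using kappa_rec[of "Suc m" r] kappa_rec[of m r] by (cases "m = 0") auto
      next
        case False
        then show ?thesis using kappa_rec[of "Suc m" r] kappa_rec[of m r] r
          by (simp add: Suc_diff_le)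
      qed
      have "of_nat (Suc m) * fps_nth F (Suc m) = (of_real (real (Suc m) * kappa (Suc m) r) :: complex)"
        unfolding rec kap using less[of m] less[of "m - r"] Suc by simp
      then have "of_nat (Suc m) * fps_nth F (Suc m) = of_nat (Suc m) * (of_real (kappa (Suc m) r) :: complex)"
        by simp
      then show ?thesis unfolding Suc mult_cancel_left of_nat_eq_0_iff by simp
    qed
  qed
  define Q where "Q = (\<lambda>z. if z = 1 then - deriv G 1 else (G z - ?b) / (1 - z))"
  have "(\<lambda>z. if z = 1 then deriv G 1 else (G z - G 1) / (z - 1)) holomorphic_on UNIV"
    by (rule pole_lemma_open[OF hG]) simp
  then have "(\<lambda>z. - (if z = 1 then deriv G 1 else (G z - G 1) / (z - 1))) holomorphic_on UNIV"
    by (rule holomorphic_on_minus)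
  moreover have "(\<lambda>z. - (if z = 1 then deriv G 1 else (G z - G 1) / (z - 1))) = Q"
  proof
    fix z
    have "- ((G z - ?b) / (z - 1)) = (G z - ?b) / (1 - z)"
      by (metis minus_diff_eq minus_divide_right)
    then show "- (if z = 1 then deriv G 1 else (G z - G 1) / (z - 1)) = Q z"
      by (simp add: Q_def G1)
  qed
  ultimately have hQ: "Q holomorphic_on UNIV" by simp
  have QG: "(1 - z) * Q z = G z - ?b" for z by (simp add: Q_def G1)
  define C where "C = fps_expansion Q 0"
  have C: "Q has_fps_expansion C"
    unfolding C_def by (rule has_fps_expansion_fps_expansion[of UNIV]) (use hQ in auto)
  have "(\<lambda>z. (1 - z) * Q z) has_fps_expansion (1 - fps_X) * C"
    by (intro fps_expansion_intros C)
  moreover have "(\<lambda>z. G z - ?b) has_fps_expansion A - fps_const ?b"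
    by (intro fps_expansion_intros A)
  ultimately have "(1 - fps_X) * C = A - fps_const ?b"
    unfolding QG by (rule fps_expansion_unique_complex)
  then have "E * (1 - fps_X) * C = E * (A - fps_const ?b)" by (simp add: mult.assoc)
  then have CF: "C = F - fps_const ?b * E" unfolding E F_def by (simp add: algebra_simps)
  have hQ': "Q holomorphic_on eball 0 \<infinity>" using hQ by (rule holomorphic_on_subset) auto
  show ?thesis
  proof (rule that)
    show "fps_conv_radius C = \<infinity>" using conv_radius_fps_expansion[OF hQ'] by (simp add: C_def)
    show "fps_nth C n = of_real (kappa n r - exp (- harm r))" for n
      by (simp add: CF F En)
    show "(1 - z) * eval_fps C z = G z - ?b" for z
      using eval_fps_expansion'[OF hQ', of z] QG[of z] by (simp add: C_def)
  qed
qed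

lemma exp_shift_period:
  "r \<noteq> 0 \<Longrightarrow> exp ((s + 2 * of_real pi * of_real r * \<i>) / of_real r) = exp (s / of_real r)"
proof -
  assume "r \<noteq> 0"
  then have "(s + 2 * of_real pi * of_real r * \<i>) / of_real r = s / of_real r + 2 * of_real pi * \<i>"
    by (simp add: field_simps)
  then show ?thesis by (simp only: exp_add exp_two_pi_i mult_1_right)
qed

text \<open>Cauchy's coefficient formula for an entire function, in a form that applies to every path from \<open>s\<close> to
\<open>s + 2 \<pi> r i\<close>: in the expansion of the integrand into multiples of \<open>exp ((k - n) s / r)\<close>, all terms but
\<open>k = n\<close> have a periodic primitive.\<close>
lemma periodic_primitive_fps:
  fixes C :: "complex fps"
  assumes r: "0 < (r::real)" and C: "fps_conv_radius C = \<infinity>"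
  obtains P where
    "\<And>s. (P has_field_derivative exp (- of_nat n * (s / of_real r)) * eval_fps C (exp (s / of_real r))) (at s)"
    "\<And>s. P (s + 2 * of_real pi * of_real r * \<i>) = P s + 2 * of_real pi * of_real r * \<i> * fps_nth C n"
proof -
  define B where "B = Abs_fps (\<lambda>k. if k = n then 0 else fps_nth C k / (of_nat k - of_nat n))"
  have "conv_radius (fps_nth B) \<ge> \<infinity>"
  proof (rule conv_radius_geI_ex')
    fix R :: real assume R: "0 < R"
    have "ereal (norm (of_real R :: complex)) < fps_conv_radius C" by (simp add: C)
    then have "summable (\<lambda>k. norm (fps_nth C k * of_real R ^ k))"
      unfolding fps_conv_radius_def by (rule abs_summable_in_conv_radius)
    then show "summable (\<lambda>k. fps_nth B k * of_real R ^ k)"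
    proof (rule summable_comparison_test'[where N = 0])
      fix k :: nat
      have "norm (fps_nth B k) \<le> norm (fps_nth C k)"
      proof (cases "k = n")
        case False
        have "(1::real) \<le> \<bar>of_int (int k - int n)\<bar>" using False by linarith
        also have "\<dots> = norm (of_int (int k - int n) :: complex)" by (rule norm_of_int[symmetric])
        finally have "1 \<le> norm (of_nat k - of_nat n :: complex)" by simp
        then show ?thesis using False
          by (simp add: B_def norm_divide divide_le_eq mult_left_le_one_le mult_le_cancel_left1)
      qed (simp add: B_def)
      then show "norm (fps_nth B k * of_real R ^ k) \<le> norm (fps_nth C k * of_real R ^ k)"
        unfolding norm_mult by (intro mult_right_mono) auto
    qed
  qed
  then have B: "fps_conv_radius B = \<infinity>" by (simp add: fps_conv_radius_def)
  have dB: "fps_conv_radius (fps_deriv B) = \<infinity>"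
    using fps_conv_radius_deriv[of B] B by simp
  \<comment> \<open>Dividing the \<open>k\<close>-th coefficient by \<open>k - n\<close> inverts the operator \<open>z d/dz - n\<close>, except on \<open>z\<^sup>n\<close>.\<close>
  have fe: "fps_X * fps_deriv B - of_nat n * B = C - fps_const (fps_nth C n) * fps_X ^ n"
  proof (rule fps_ext)
    fix k
    have "fps_nth (fps_X * fps_deriv B - of_nat n * B) k = (of_nat k - of_nat n) * fps_nth B k"
      by (cases k) (simp_all add: algebra_simps fps_of_nat[symmetric])
    also have "\<dots> = fps_nth (C - fps_const (fps_nth C n) * fps_X ^ n) k"
      by (auto simp: B_def fps_X_power_nth)
    finally show "fps_nth (fps_X * fps_deriv B - of_nat n * B) k = fps_nth (C - fps_const (fps_nth C n) * fps_X ^ n) k" .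
  qed
  have ev: "z * eval_fps (fps_deriv B) z - of_nat n * eval_fps B z = eval_fps C z - fps_nth C n * z ^ n" for z
  proof -
    have "eval_fps (fps_X * fps_deriv B - of_nat n * B) z = z * eval_fps (fps_deriv B) z - of_nat n * eval_fps B z"
    proof -
      have "fps_conv_radius (fps_X * fps_deriv B) = \<infinity>"
        using fps_conv_radius_mult[of fps_X "fps_deriv B"] dB by simp
      moreover have "fps_conv_radius (of_nat n * B) = \<infinity>"
        using fps_conv_radius_mult[of "of_nat n" B] B by simp
      ultimately show ?thesis using B dB by (simp add: eval_fps_diff eval_fps_mult)
    qed
    moreover have "eval_fps (C - fps_const (fps_nth C n) * fps_X ^ n) z = eval_fps C z - fps_nth C n * z ^ n"
    proof -
      have "fps_conv_radius (fps_X ^ n :: complex fps) = \<infinity>"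
        using fps_conv_radius_power[of fps_X n] by simp
      moreover from this have "fps_conv_radius (fps_const (fps_nth C n) * fps_X ^ n) = \<infinity>"
        using fps_conv_radius_mult[of "fps_const (fps_nth C n)" "fps_X ^ n"] by simp
      ultimately show ?thesis using C by (simp add: eval_fps_diff eval_fps_mult eval_fps_power)
    qed
    ultimately show ?thesis using fe by simp
  qed
  define P where "P = (\<lambda>s. fps_nth C n * s + of_real r * (exp (- of_nat n * (s / of_real r)) * eval_fps B (exp (s / of_real r))))"
  show ?thesis
  proof (rule that)
    fix s :: complex
    let ?z = "exp (s / of_real r)"
    have "(eval_fps B has_field_derivative eval_fps (fps_deriv B) ?z) (at ?z)"
      by (rule has_field_derivative_eval_fps) (simp add: B)
    moreover have "((\<lambda>s. exp (s / of_real r)) has_field_derivative ?z / of_real r) (at s)"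
      using r by (auto intro!: derivative_eq_intros)
    ultimately have d: "((\<lambda>s. eval_fps B (exp (s / of_real r))) has_field_derivative eval_fps (fps_deriv B) ?z * (?z / of_real r)) (at s)"
      by (rule DERIV_chain2)
    have e: "((\<lambda>s. exp (- of_nat n * (s / of_real r))) has_field_derivative exp (- of_nat n * (s / of_real r)) * (- of_nat n / of_real r)) (at s)"
      using r by (auto intro!: derivative_eq_intros)
    have l: "((\<lambda>s. fps_nth C n * s) has_field_derivative fps_nth C n * 1) (at s)"
      by (intro DERIV_cmult DERIV_ident)
    let ?e = "exp (- of_nat n * (s / of_real r))"
    have "(P has_field_derivative fps_nth C n * 1 + of_real r * (?e * (- of_nat n / of_real r) * eval_fps B ?z
        + eval_fps (fps_deriv B) ?z * (?z / of_real r) * ?e)) (at s)"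
      unfolding P_def by (intro DERIV_add l DERIV_cmult DERIV_mult e d)
    also have "fps_nth C n * 1 + of_real r * (?e * (- of_nat n / of_real r) * eval_fps B ?z
        + eval_fps (fps_deriv B) ?z * (?z / of_real r) * ?e)
        = fps_nth C n + ?e * (?z * eval_fps (fps_deriv B) ?z - of_nat n * eval_fps B ?z)"
      using r by (simp add: field_simps)
    also have "\<dots> = fps_nth C n * (1 - ?e * ?z ^ n) + ?e * eval_fps C ?z"
      unfolding ev by (simp add: algebra_simps)
    also have "?e * ?z ^ n = 1"
      by (simp flip: exp_of_nat_mult exp_add)
    finally show "(P has_field_derivative ?e * eval_fps C ?z) (at s)" by simp
    have 1: "exp ((s + 2 * of_real pi * of_real r * \<i>) / of_real r) = ?z"
      using r by (intro exp_shift_period) simp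
    have "exp (- of_nat n * ((s + 2 * of_real pi * of_real r * \<i>) / of_real r)) = inverse (exp ((s + 2 * of_real pi * of_real r * \<i>) / of_real r) ^ n)"
      by (simp add: exp_minus exp_of_nat_mult del: times_divide_eq_right)
    also have "\<dots> = ?e" unfolding 1 by (simp add: exp_minus exp_of_nat_mult del: times_divide_eq_right)
    finally have 2: "exp (- of_nat n * ((s + 2 * of_real pi * of_real r * \<i>) / of_real r)) = ?e" .
    show "P (s + 2 * of_real pi * of_real r * \<i>) = P s + 2 * of_real pi * of_real r * \<i> * fps_nth C n"
      unfolding P_def 1 2 by (simp add: algebra_simps)
  qed
qed

text \<open>The polar part contributes nothing to the right of the imaginary axis. With \<open>y = exp (- s / r)\<close> its primitive
is a tail of the series of \<open>- Ln (1 - y)\<close>, which is periodic because \<open>|y| < 1\<close>.\<close>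
lemma periodic_primitive_pole:
  assumes r: "0 < (r::real)"
  obtains U where
    "\<And>s. 0 < Re s \<Longrightarrow> (U has_field_derivative exp (- of_nat n * (s / of_real r)) / (1 - exp (s / of_real r))) (at s)"
    "\<And>s. U (s + 2 * of_real pi * of_real r * \<i>) = (U s :: complex)"
proof -
  define y where "y = (\<lambda>s::complex. exp (- (s / of_real r)))"
  define U where "U = (\<lambda>s. of_real r * (- Ln (1 - y s) - short_cycle_poly n (y s)))"
  show ?thesis
  proof (rule that)
    fix s :: complex assume s: "0 < Re s"
    have dy: "(y has_field_derivative - (y s / of_real r)) (at s)"
      unfolding y_def using r by (auto intro!: derivative_eq_intros)
    have ny: "norm (y s) < 1" using s r by (simp add: y_def)
    then have y1: "1 - y s \<noteq> 0" by auto
    have "Re (1 - y s) > 0" using ny complex_Re_le_cmod[of "y s"] by simp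
    then have nn: "1 - y s \<notin> \<real>\<^sub>\<le>\<^sub>0" by (auto simp: complex_nonpos_Reals_iff)
    have d1: "((\<lambda>s. 1 - y s) has_field_derivative y s / of_real r) (at s)"
      by (auto intro!: derivative_eq_intros dy)
    have d2: "((\<lambda>s. Ln (1 - y s)) has_field_derivative inverse (1 - y s) * (y s / of_real r)) (at s)"
      by (rule DERIV_chain2[OF has_field_derivative_Ln[OF nn] d1])
    have d3: "((\<lambda>s. short_cycle_poly n (y s)) has_field_derivative (\<Sum>j<n. y s ^ j) * (- (y s / of_real r))) (at s)"
      by (rule DERIV_chain2[OF has_field_derivative_short_cycle_poly dy])
    have "(U has_field_derivative of_real r * (- (inverse (1 - y s) * (y s / of_real r)) - (\<Sum>j<n. y s ^ j) * (- (y s / of_real r)))) (at s)"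
      unfolding U_def by (intro DERIV_cmult DERIV_diff DERIV_minus d2 d3)
    also have "of_real r * (- (inverse (1 - y s) * (y s / of_real r)) - (\<Sum>j<n. y s ^ j) * (- (y s / of_real r)))
        = y s * ((\<Sum>j<n. y s ^ j) - inverse (1 - y s))"
    proof -
      have "c * (- (i * (w / c)) - S * (- (w / c))) = w * (S - i)" if "c \<noteq> 0" for c i w S :: complex
        using that by (simp add: field_simps)
      then show ?thesis using r by simp
    qed
    also have "(\<Sum>j<n. y s ^ j) = (1 - y s ^ n) / (1 - y s)"
      using y1 by (subst sum_gp_strict) auto
    also have "y s * ((1 - y s ^ n) / (1 - y s) - inverse (1 - y s)) = - (y s ^ n * y s / (1 - y s))"
      by (simp add: inverse_eq_divide diff_divide_distrib[symmetric] mult.commute)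
    also have "\<dots> = y s ^ n / (1 - inverse (y s))"
    proof -
      have "y s \<noteq> 0" by (simp add: y_def)
      then show ?thesis using y1 by (simp add: divide_simps) (simp add: algebra_simps)
    qed
    also have "\<dots> = exp (- of_nat n * (s / of_real r)) / (1 - exp (s / of_real r))"
      by (simp add: y_def exp_minus exp_of_nat_mult power_inverse del: times_divide_eq_right)
    finally show "(U has_field_derivative exp (- of_nat n * (s / of_real r)) / (1 - exp (s / of_real r))) (at s)" .
  next
    fix s :: complex
    have "y (s + 2 * of_real pi * of_real r * \<i>) = y s"
      using r by (simp only: y_def exp_minus exp_shift_period)
    then show "U (s + 2 * of_real pi * of_real r * \<i>) = U s" by (simp add: U_def)
  qed
qed

lemma rough_periodic_primitive:
  assumes r: "0 < r"
  obtains V where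
    "\<And>s. 0 < Re s \<Longrightarrow> (V has_field_derivative exp (- of_nat n * (s / of_nat r)) *
        (exp (- short_cycle_poly r (exp (s / of_nat r))) / (1 - exp (s / of_nat r)))) (at s)"
    "\<And>s. V (s + 2 * of_real pi * of_nat r * \<i>) = V s + 2 * of_real pi * of_nat r * \<i> * of_real (kappa n r - exp (- harm r))"
proof -
  obtain C where C: "fps_conv_radius C = \<infinity>" "\<And>n. fps_nth C n = of_real (kappa n r - exp (- harm r))"
    "\<And>z. (1 - z) * eval_fps C z = exp (- short_cycle_poly r z) - of_real (exp (- harm r))"
    using rough_generating_function[OF r] by metis
  have r': "0 < real r" using r by simp
  obtain P where P: "\<And>s. (P has_field_derivative exp (- of_nat n * (s / of_real (real r))) * eval_fps C (exp (s / of_real (real r)))) (at s)"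
    "\<And>s. P (s + 2 * of_real pi * of_real (real r) * \<i>) = P s + 2 * of_real pi * of_real (real r) * \<i> * fps_nth C n"
    using periodic_primitive_fps[OF r' C(1), of n] by metis
  obtain U where U: "\<And>s. 0 < Re s \<Longrightarrow> (U has_field_derivative exp (- of_nat n * (s / of_real (real r))) / (1 - exp (s / of_real (real r)))) (at s)"
    "\<And>s. U (s + 2 * of_real pi * of_real (real r) * \<i>) = U s"
    using periodic_primitive_pole[OF r', of n] by metis
  let ?b = "of_real (exp (- harm r)) :: complex"
  show ?thesis
  proof (rule that[of "\<lambda>s. P s + ?b * U s"])
    fix s :: complex assume s: "0 < Re s"
    let ?e = "exp (- of_nat n * (s / of_nat r))" and ?z = "exp (s / of_nat r)"
    have "norm ?z > 1" using s r by (simp add: Re_divide_of_nat)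
    then have "?z \<noteq> 1" by (metis norm_one less_irrefl)
    then have z1: "1 - ?z \<noteq> 0" by simp
    have "((\<lambda>s. P s + ?b * U s) has_field_derivative ?e * eval_fps C ?z + ?b * (?e / (1 - ?z))) (at s)"
      using P(1)[of s] U(1)[OF s] by (intro DERIV_add DERIV_cmult) simp_all
    also have "eval_fps C ?z = (exp (- short_cycle_poly r ?z) - ?b) / (1 - ?z)"
      using C(3)[of ?z] z1 by (simp add: field_simps)
    also have "?e * ((exp (- short_cycle_poly r ?z) - ?b) / (1 - ?z)) + ?b * (?e / (1 - ?z)) =
        ?e * (exp (- short_cycle_poly r ?z) / (1 - ?z))"
      using z1 by (simp add: diff_divide_distrib algebra_simps)
    finally show "((\<lambda>s. P s + ?b * U s) has_field_derivative ?e * (exp (- short_cycle_poly r ?z) / (1 - ?z))) (at s)" .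
  next
    fix s :: complex
    show "P (s + 2 * of_real pi * of_nat r * \<i>) + ?b * U (s + 2 * of_real pi * of_nat r * \<i>) =
      P s + ?b * U s + 2 * of_real pi * of_nat r * \<i> * of_real (kappa n r - exp (- harm r))"
      using P(2)[of s] U(2)[of s] C(2)[of n] by simp
  qed
qed

section \<open>Growth of the continuous transform\<close>

text \<open>The integrand of \<open>I_fun\<close> with the removable singularity filled in.\<close>
definition expm1_div :: "complex \<Rightarrow> complex" where
  "expm1_div s = (if s = 0 then 1 else (exp s - 1) / s)"

lemma holomorphic_expm1_div: "expm1_div holomorphic_on A"
proof -
  have "expm1_div = (\<lambda>z. if z = 0 then deriv exp 0 else (exp z - exp 0) / (z - 0))"
    using DERIV_imp_deriv[OF DERIV_exp, of "0::complex"] by (auto simp: expm1_div_def)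
  moreover have "\<dots> holomorphic_on (UNIV :: complex set)"
    by (intro pole_lemma_open holomorphic_on_exp) auto
  ultimately have "expm1_div holomorphic_on UNIV" by metis
  then show ?thesis by (rule holomorphic_on_subset) auto
qed

lemma I_fun_eq_primitive:
  assumes P: "\<And>z. (P has_field_derivative expm1_div z) (at z)"
  shows "I_fun s = P s - P 0"
proof -
  have "(expm1_div has_contour_integral (P (pathfinish (linepath 0 s)) - P (pathstart (linepath 0 s)))) (linepath 0 s)"
    by (rule contour_integral_primitive[where S = UNIV]) (use P in \<open>simp_all del: linepath_0\<close>)
  then have "((\<lambda>x. expm1_div (linepath 0 s x) * (s - 0)) has_integral (P s - P 0)) {0..1}"
    by (simp add: has_contour_integral_linepath)
  then have "((\<lambda>x. ((exp (linepath 0 s x) - 1) / linepath 0 s x) * (s - 0)) has_integral (P s - P 0)) {0..1}"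
    by (rule has_integral_spike_finite[where S = "{0}", rotated 2]) (auto simp: expm1_div_def linepath_def)
  then have "((\<lambda>t. (exp t - 1) / t) has_contour_integral (P s - P 0)) (linepath 0 s)"
    by (simp add: has_contour_integral_linepath)
  then show ?thesis unfolding I_fun_def by (rule contour_integral_unique)
qed

lemma has_field_derivative_I_fun: "(I_fun has_field_derivative expm1_div s) (at s)"
proof -
  obtain P where P: "\<And>z. (P has_field_derivative expm1_div z) (at z)"
    using holomorphic_convex_primitive'[OF convex_UNIV open_UNIV holomorphic_expm1_div] by auto
  have "I_fun = (\<lambda>s. P s - P 0)" using I_fun_eq_primitive[OF P] by auto
  moreover have "((\<lambda>s. P s - P 0) has_field_derivative expm1_div s) (at s)"
    using P[of s] by (auto intro!: derivative_eq_intros)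
  ultimately show ?thesis by simp
qed

lemma I_fun_0: "I_fun 0 = 0"
  by (simp add: I_fun_def)

lemma I_fun_cnj: "I_fun (cnj s) = cnj (I_fun s)"
proof -
  have "((cnj \<circ> I_fun \<circ> cnj) has_field_derivative cnj (expm1_div (cnj z))) (at z)" for z
    by (rule has_field_derivative_cnj_cnj) (rule has_field_derivative_I_fun)
  moreover have "cnj (expm1_div (cnj z)) = expm1_div z" for z
    by (simp add: expm1_div_def exp_cnj)
  ultimately have "I_fun s = (cnj \<circ> I_fun \<circ> cnj) s - (cnj \<circ> I_fun \<circ> cnj) 0"
    by (intro I_fun_eq_primitive) (simp only:)
  then have "cnj (I_fun s) = cnj (cnj (I_fun (cnj s)))" by (simp add: I_fun_0)
  then show ?thesis by simp
qed

text \<open>The logarithm of \<open>|exp (- I s)|\<close>, as a function of the real coordinates of \<open>s\<close>.\<close>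
definition log_growth :: "real \<Rightarrow> real \<Rightarrow> real" where
  "log_growth x t = - Re (I_fun (Complex x t))"

lemma norm_exp_minus_I_fun: "norm (exp (- I_fun (Complex x t))) = exp (log_growth x t)"
  by (simp add: log_growth_def)

lemma log_growth_minus: "log_growth x (- t) = log_growth x t"
  using I_fun_cnj[of "Complex x t"] by (simp add: log_growth_def complex_cnj)

lemma has_field_derivative_along:
  assumes "(c has_vector_derivative c') (at t)"
  shows "((\<lambda>t. - Re (I_fun (c t))) has_real_derivative - Re (c' * expm1_div (c t))) (at t)"
proof -
  have "((I_fun \<circ> c) has_vector_derivative (c' * expm1_div (c t))) (at t)"
    by (rule field_vector_diff_chain_at[OF assms has_field_derivative_I_fun])
  then have "((\<lambda>t. Re ((I_fun \<circ> c) t)) has_vector_derivative Re (c' * expm1_div (c t))) (at t)"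
    by (rule bounded_linear.has_vector_derivative[OF bounded_linear_Re])
  from has_vector_derivative_minus[OF this] show ?thesis
    by (simp add: has_real_derivative_iff_has_vector_derivative o_def)
qed

lemma log_growth_deriv_vertical:
  "((\<lambda>t. log_growth x t) has_real_derivative Im (expm1_div (Complex x t))) (at t)"
proof -
  have "((\<lambda>t. Complex x t) has_vector_derivative \<i>) (at t)"
    unfolding Complex_eq by (auto intro!: derivative_eq_intros)
  from has_field_derivative_along[OF this] show ?thesis by (simp add: log_growth_def)
qed

lemma log_growth_deriv_horizontal:
  "((\<lambda>x. log_growth x t) has_real_derivative - Re (expm1_div (Complex x t))) (at x)"
proof -
  have "((\<lambda>x. Complex x t) has_vector_derivative 1) (at x)"
    unfolding Complex_eq by (auto intro!: derivative_eq_intros)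
  from has_field_derivative_along[OF this] show ?thesis by (simp add: log_growth_def)
qed

lemma Im_expm1_div:
  "0 < x \<or> t \<noteq> 0 \<Longrightarrow> Im (expm1_div (Complex x t)) = (exp x * (x * sin t - t * cos t) + t) / (x\<^sup>2 + t\<^sup>2)"
  by (auto simp: expm1_div_def Im_divide Re_exp Im_exp complex_eq_iff algebra_simps)

lemma Re_expm1_div:
  "0 < x \<or> t \<noteq> 0 \<Longrightarrow> Re (expm1_div (Complex x t)) = (exp x * (x * cos t + t * sin t) - x) / (x\<^sup>2 + t\<^sup>2)"
  by (auto simp: expm1_div_def Re_divide Re_exp Im_exp complex_eq_iff algebra_simps)

lemma t_cos_le_sin:
  assumes "0 \<le> t" "t \<le> pi"
  shows "t * cos t \<le> sin t"
proof -
  have "sin 0 - 0 * cos 0 \<le> sin t - t * cos t"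
  proof (rule DERIV_nonneg_imp_nondecreasing[OF assms(1)])
    fix x assume x: "0 \<le> x" "x \<le> t"
    have "((\<lambda>t. sin t - t * cos t) has_real_derivative x * sin x) (at x)"
      by (auto intro!: derivative_eq_intros)
    moreover have "x * sin x \<ge> 0" using x assms by (intro mult_nonneg_nonneg sin_ge_zero) auto
    ultimately show "\<exists>y. ((\<lambda>t. sin t - t * cos t) has_real_derivative y) (at x) \<and> 0 \<le> y" by blast
  qed
  then show ?thesis by simp
qed

text \<open>The derivative with respect to \<open>t\<close> has the sign of \<open>exp x (x sin t - t cos t) + t\<close>. This is nonnegative up to
\<open>\<pi>\<close> because of \<open>t cos t \<le> sin t\<close>, and between \<open>\<pi>\<close> and \<open>4 \<pi> / 3\<close> it decreases, down to its zero \<open>t0\<close>.\<close>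
lemma log_growth_le_critical:
  assumes x: "4 \<le> x" and t0: "t0 \<le> pi + pi / 3"
    and crit: "exp x * (x * sin t0 - t0 * cos t0) + t0 = 0"
    and t: "0 \<le> t" "t \<le> t0"
  shows "log_growth x t \<le> log_growth x t0"
proof (rule DERIV_nonneg_imp_nondecreasing[OF t(2)])
  fix y assume y: "t \<le> y" "y \<le> t0"
  let ?j = "\<lambda>t. exp x * (x * sin t - t * cos t) + t"
  have "?j y \<ge> 0"
  proof (cases "y \<le> pi")
    case True
    have "1 * sin y \<le> x * sin y" using x y t True by (intro mult_right_mono sin_ge_zero) auto
    then have "x * sin y - y * cos y \<ge> 0" using t_cos_le_sin[of y] y t True by simp
    then show ?thesis using y t by simp
  next
    case False
    have "?j t0 \<le> ?j y"
    proof (rule DERIV_nonpos_imp_nonincreasing[OF y(2)])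
      fix z assume z: "y \<le> z" "z \<le> t0"
      have D: "(?j has_real_derivative exp x * ((x - 1) * cos z + z * sin z) + 1) (at z)"
        by (auto intro!: derivative_eq_intros simp: algebra_simps)
      have zp: "0 \<le> z - pi" "z - pi \<le> pi / 3" using z t0 False by auto
      have "cos z = - cos (z - pi)" "sin z = - sin (z - pi)" by (simp_all add: cos_diff sin_diff)
      moreover have "cos (pi / 3) \<le> cos (z - pi)" using zp by (intro cos_monotone_0_pi_le) auto
      moreover have "0 \<le> sin (z - pi)" using zp pi_gt_zero by (intro sin_ge_zero) linarith+
      ultimately have cz: "cos z \<le> - (1/2)" and sz: "sin z \<le> 0" by (auto simp: cos_60)
      have "(x - 1) * cos z \<le> (x - 1) * (- (1/2))" using cz x by (intro mult_left_mono) auto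
      moreover have "(x - 1) * (- (1/2)) \<le> - 1" using x by simp
      ultimately have "(x - 1) * cos z \<le> - 1" by (rule order_trans)
      moreover have "z * sin z \<le> 0" using sz False z pi_gt_zero
        by (intro mult_nonneg_nonpos) linarith+
      ultimately have "(x - 1) * cos z + z * sin z \<le> - 1" by linarith
      then have "exp x * ((x - 1) * cos z + z * sin z) \<le> exp x * (- 1)" by (intro mult_left_mono) auto
      moreover have "exp x \<ge> 1" using x by simp
      ultimately have "exp x * ((x - 1) * cos z + z * sin z) + 1 \<le> 0" by linarith
      with D show "\<exists>y. (?j has_real_derivative y) (at z) \<and> y \<le> 0" by blast
    qed
    then show ?thesis using crit by simp
  qed
  then have "0 \<le> Im (expm1_div (Complex x y))"
    using x by (subst Im_expm1_div) auto
  then show "\<exists>d. ((\<lambda>a. log_growth x a) has_real_derivative d) (at y) \<and> 0 \<le> d"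
    using log_growth_deriv_vertical by blast
qed

lemma abs_x_cos_plus_t_sin_le:
  fixes x t :: real
  shows "\<bar>x * cos t + t * sin t\<bar> \<le> sqrt (x\<^sup>2 + t\<^sup>2)"
proof -
  have "(x * cos t + t * sin t)\<^sup>2 + (x * sin t - t * cos t)\<^sup>2 = (x\<^sup>2 + t\<^sup>2) * ((sin t)\<^sup>2 + (cos t)\<^sup>2)"
    by algebra
  then have "(x * cos t + t * sin t)\<^sup>2 + (x * sin t - t * cos t)\<^sup>2 = x\<^sup>2 + t\<^sup>2" by simp
  then have "(x * cos t + t * sin t)\<^sup>2 \<le> x\<^sup>2 + t\<^sup>2"
    using zero_le_power2[of "x * sin t - t * cos t"] by linarith
  then show ?thesis using real_sqrt_le_mono by fastforce
qed

text \<open>Put \<open>\<psi> = t - arg s\<close> for \<open>s = x + i t\<close>. The derivative of \<open>ln |exp (- I s) / s|\<close> with respect to \<open>\<psi>\<close> is \<open>k sin \<psi>\<close> with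
the positive decreasing function \<open>k = exp x |s| / (|s|\<^sup>2 - x)\<close>. So \<open>ln |exp (- I s) / s|\<close> oscillates with decreasing
amplitude, and adding \<open>k (1 + cos \<psi>) \<ge> 0\<close> makes it decreasing: the derivative of the sum is
\<open>k' (1 + cos \<psi>) \<le> 0\<close>. The added term is \<open>exp x * (N t / D t)\<close>. Near the saddle point it is small since
\<open>cos \<psi>\<close> is close to \<open>-1\<close>.\<close>
lemma damped_log_growth_antimono:
  fixes x :: real
  defines "N \<equiv> (\<lambda>t. sqrt (x\<^sup>2 + t\<^sup>2) + x * cos t + t * sin t)"
  defines "D \<equiv> (\<lambda>t. x\<^sup>2 + t\<^sup>2 - x)"
  assumes x: "1 < x" and t: "0 \<le> a" "a \<le> b"
  shows "log_growth x b - ln (x\<^sup>2 + b\<^sup>2) / 2 + exp x * (N b / D b)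
       \<le> log_growth x a - ln (x\<^sup>2 + a\<^sup>2) / 2 + exp x * (N a / D a)"
proof (rule DERIV_nonpos_imp_nonincreasing[OF t(2)])
  fix t assume t': "a \<le> t" "t \<le> b"
  define p where "p = sqrt (x\<^sup>2 + t\<^sup>2)"
  have p2: "p\<^sup>2 = x\<^sup>2 + t\<^sup>2" and p0: "p > 0" using x by (auto simp: p_def add_pos_nonneg)
  have Dp: "D t = p\<^sup>2 - x" by (simp add: D_def p2)
  have xx: "x < x\<^sup>2" using x by (simp add: power2_eq_square)
  then have D0: "D t > 0" unfolding D_def using zero_le_power2[of t] by linarith
  let ?N' = "t / p - x * sin t + (sin t + t * cos t)"
  have dp: "((\<lambda>t. sqrt (x\<^sup>2 + t\<^sup>2)) has_real_derivative t / p) (at t)"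
    using p0 p2 unfolding p_def
    by (auto intro!: derivative_eq_intros simp: field_simps)
  have dN: "(N has_real_derivative ?N') (at t)"
    unfolding N_def by (rule derivative_eq_intros dp refl | simp)+
  have dD: "(D has_real_derivative 2 * t) (at t)"
    unfolding D_def by (auto intro!: derivative_eq_intros)
  have dq: "((\<lambda>t. N t / D t) has_real_derivative (?N' * D t - N t * (2 * t)) / (D t * D t)) (at t)"
    using D0 by (intro DERIV_divide dN dD) auto
  have dl: "((\<lambda>t. ln (x\<^sup>2 + t\<^sup>2) / 2) has_real_derivative t / p\<^sup>2) (at t)"
  proof -
    have pos: "x\<^sup>2 + t\<^sup>2 > 0" using p0 by (simp flip: p2)
    have "((\<lambda>t. x\<^sup>2 + t\<^sup>2) has_real_derivative 2 * t) (at t)" by (auto intro!: derivative_eq_intros)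
    then have "((\<lambda>t. ln (x\<^sup>2 + t\<^sup>2)) has_real_derivative inverse (x\<^sup>2 + t\<^sup>2) * (2 * t)) (at t)"
      using pos by (intro DERIV_chain2[where f = ln and g = "\<lambda>t. x\<^sup>2 + t\<^sup>2"] DERIV_ln)
    then have "((\<lambda>t. ln (x\<^sup>2 + t\<^sup>2) / 2) has_real_derivative inverse (x\<^sup>2 + t\<^sup>2) * (2 * t) / 2) (at t)"
      by (rule DERIV_cdivide)
    moreover have "inverse (x\<^sup>2 + t\<^sup>2) * (2 * t) / 2 = t / p\<^sup>2" 
    proof -
      have "inverse (x\<^sup>2 + t\<^sup>2) * (2 * t) / 2 = t * inverse (x\<^sup>2 + t\<^sup>2)" by simp
      then show ?thesis unfolding p2 by (simp only: divide_inverse)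
    qed
    ultimately show ?thesis by (simp only:)
  qed
  have dg: "((\<lambda>t. log_growth x t) has_real_derivative (exp x * (x * sin t - t * cos t) + t) / p\<^sup>2) (at t)"
    using log_growth_deriv_vertical[of x t] x by (simp add: Im_expm1_div p2)
  let ?Q' = "(exp x * (x * sin t - t * cos t) + t) / p\<^sup>2 - t / p\<^sup>2
      + exp x * ((?N' * D t - N t * (2 * t)) / (D t * D t))"
  have dQ: "((\<lambda>t. log_growth x t - ln (x\<^sup>2 + t\<^sup>2) / 2 + exp x * (N t / D t)) has_real_derivative ?Q') (at t)"
    by (intro DERIV_add DERIV_diff dg dl DERIV_cmult dq)
  have Np: "N t = p + x * cos t + t * sin t" by (simp add: N_def p_def)
  have tp: "p\<^sup>2 * (t / p) = p * t" using p0 by (simp add: power2_eq_square)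
  \<comment> \<open>The identity \<open>p\<^sup>2 = x\<^sup>2 + t\<^sup>2\<close> makes the oscillating terms cancel.\<close>
  have key: "(x * sin t - t * cos t) * D t + p\<^sup>2 * ?N' - t * N t = 0"
  proof -
    have "(x * sin t - t * cos t) * D t + p\<^sup>2 * ?N' - t * N t =
      (x * sin t - t * cos t) * (p\<^sup>2 - x) + p\<^sup>2 * (t / p) + p\<^sup>2 * (- x * sin t + sin t + t * cos t)
       - t * (p + x * cos t + t * sin t)"
      unfolding Dp Np by (simp add: algebra_simps)
    also have "\<dots> = (p\<^sup>2 - x\<^sup>2 - t\<^sup>2) * sin t"
      unfolding tp by (simp add: algebra_simps power2_eq_square)
    finally show ?thesis by (simp add: p2)
  qed
  have "?Q' = exp x * ((x * sin t - t * cos t) / p\<^sup>2 + (?N' * D t - N t * (2 * t)) / (D t * D t))"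
  proof -
    have "(exp x * (x * sin t - t * cos t) + t) / p\<^sup>2 - t / p\<^sup>2 = exp x * ((x * sin t - t * cos t) / p\<^sup>2)"
      by (simp only: add_divide_distrib add_diff_cancel_right' times_divide_eq_right)
    then show ?thesis by (simp only: distrib_left)
  qed
  also have "(x * sin t - t * cos t) / p\<^sup>2 + (?N' * D t - N t * (2 * t)) / (D t * D t) =
     (((x * sin t - t * cos t) * D t + p\<^sup>2 * ?N' - t * N t) * D t + t * N t * D t - 2 * t * N t * p\<^sup>2)
      / (p\<^sup>2 * D t * D t)"
    using p0 D0 by (simp add: divide_simps) (simp add: algebra_simps)
  also have "\<dots> = - (t * N t * (p\<^sup>2 + x)) / (p\<^sup>2 * D t * D t)"
    unfolding key by (simp add: Dp algebra_simps)
  finally have Q': "?Q' = exp x * (- (t * N t * (p\<^sup>2 + x)) / (p\<^sup>2 * D t * D t))" .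
  have "N t \<ge> 0" using abs_x_cos_plus_t_sin_le[of x t] unfolding N_def by linarith
  then have "t * N t * (p\<^sup>2 + x) / (p\<^sup>2 * D t * D t) \<ge> 0"
    using t t' x D0 by (intro divide_nonneg_nonneg mult_nonneg_nonneg add_nonneg_nonneg) auto
  then have "?Q' \<le> 0" unfolding Q' minus_divide_left[symmetric] by (intro mult_nonneg_nonpos) simp_all
  with dQ show "\<exists>y. ((\<lambda>t. log_growth x t - ln (x\<^sup>2 + t\<^sup>2) / 2 + exp x * (N t / D t)) has_real_derivative y) (at t) \<and> y \<le> 0"
    by blast
qed

text \<open>Integration from \<open>i\<close> up the imaginary axis to \<open>i t\<close>, and from there horizontally to \<open>x + i t\<close>, with
absolute values inside the integrals.\<close>
lemma log_growth_crude:
  assumes "0 \<le> x" "1 \<le> t"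
  shows "log_growth x t \<le> log_growth 0 1 + 2 * ln t + (exp x + x) / t"
proof -
  have "log_growth 0 t - 2 * ln t \<le> log_growth 0 1 - 2 * ln 1"
  proof (rule DERIV_nonpos_imp_nonincreasing[OF assms(2)])
    fix y :: real assume y: "1 \<le> y" "y \<le> t"
    have "((\<lambda>t. log_growth 0 t - 2 * ln t) has_real_derivative Im (expm1_div (Complex 0 y)) - 2 * (1 / y)) (at y)"
      using y by (auto intro!: derivative_eq_intros log_growth_deriv_vertical)
    moreover have "Im (expm1_div (Complex 0 y)) - 2 * (1 / y) \<le> 0"
    proof -
      have "Im (expm1_div (Complex 0 y)) = (1 - cos y) / y"
        using y by (simp add: Im_expm1_div power2_eq_square field_simps)
      also have "\<dots> \<le> 2 / y" using y cos_ge_minus_one[of y] by (intro divide_right_mono) linarith+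
      finally show ?thesis by simp
    qed
    ultimately show "\<exists>d. ((\<lambda>t. log_growth 0 t - 2 * ln t) has_real_derivative d) (at y) \<and> d \<le> 0" by blast
  qed
  moreover have "log_growth x t - (exp x + x) / t \<le> log_growth 0 t - (exp 0 + 0) / t"
  proof (rule DERIV_nonpos_imp_nonincreasing[OF assms(1)])
    fix y :: real assume y: "0 \<le> y" "y \<le> x"
    have "((\<lambda>x. log_growth x t - (exp x + x) / t) has_real_derivative - Re (expm1_div (Complex y t)) - (exp y + 1) / t) (at y)"
      using assms by (auto intro!: derivative_eq_intros log_growth_deriv_horizontal)
    moreover have "- Re (expm1_div (Complex y t)) \<le> (exp y + 1) / t"
    proof -
      have s0: "Complex y t \<noteq> 0" using assms by (auto simp: complex_eq_iff)
      have "- Re (expm1_div (Complex y t)) \<le> norm (expm1_div (Complex y t))"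
        using abs_Re_le_cmod[of "expm1_div (Complex y t)"] by linarith
      also have "\<dots> = norm (exp (Complex y t) - 1) / norm (Complex y t)"
        using s0 by (simp add: expm1_div_def norm_divide)
      also have "\<dots> \<le> (exp y + 1) / t"
      proof (intro frac_le)
        show "norm (exp (Complex y t) - 1) \<le> exp y + 1"
          using norm_triangle_ineq4[of "exp (Complex y t)" 1] by simp
        show "t \<le> norm (Complex y t)" using abs_Im_le_cmod[of "Complex y t"] assms by simp
      qed (use assms in \<open>auto simp: add_nonneg_nonneg\<close>)
      finally show ?thesis .
    qed
    ultimately show "\<exists>d. ((\<lambda>x. log_growth x t - (exp x + x) / t) has_real_derivative d) (at y) \<and> d \<le> 0"
      by (intro exI conjI) auto
  qed
  moreover have "(exp 0 + 0) / t \<ge> (0::real)" using assms by simp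
  ultimately show ?thesis unfolding ln_one by linarith
qed

text \<open>At height \<open>\<pi>\<close> the exponential in the integrand is negative, so that nothing cancels; the factor
\<open>1 / 2\<close> absorbs the lower order terms.\<close>
lemma log_growth_at_pi:
  assumes "4 \<le> x"
  shows "exp x / (2 * x) - exp 4 / 8 + log_growth 4 pi \<le> log_growth x pi"
proof -
  have "log_growth 4 pi - exp 4 / (2 * 4) \<le> log_growth x pi - exp x / (2 * x)"
  proof (rule DERIV_nonneg_imp_nondecreasing[OF assms])
    fix y :: real assume y: "4 \<le> y" "y \<le> x"
    have "((\<lambda>x. log_growth x pi - exp x / (2 * x)) has_real_derivative
        - Re (expm1_div (Complex y pi)) - exp y * (y - 1) / (2 * y\<^sup>2)) (at y)"
      using y by (auto intro!: derivative_eq_intros log_growth_deriv_horizontal simp: field_simps power2_eq_square)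
    moreover have "exp y * (y - 1) / (2 * y\<^sup>2) \<le> - Re (expm1_div (Complex y pi))"
    proof -
      \<comment> \<open>The claim reduces to \<open>(y - 1) (y\<^sup>2 + \<pi>\<^sup>2) \<le> 2 y\<^sup>3\<close>.\<close>
      have pi2: "pi\<^sup>2 \<le> 16" using power_mono[of pi 4 2] pi_less_4 by simp
      have "(y - 1) / (2 * y\<^sup>2) \<le> y / (y\<^sup>2 + pi\<^sup>2)"
      proof -
        have "(y - 1) * (y\<^sup>2 + pi\<^sup>2) \<le> (y - 1) * (y\<^sup>2 + 16)" using y pi2 by (intro mult_left_mono) auto
        also have "\<dots> \<le> y * (2 * y\<^sup>2)"
        proof -
          have "4 * 4 \<le> y * y" using y by (intro mult_mono) auto
          then have "4 * 4 * y \<le> y * y * y" using y by (intro mult_right_mono) auto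
          moreover have "(y - 1) * (y\<^sup>2 + 16) = y * y * y - y * y + 16 * y - 16"
            "y * (2 * y\<^sup>2) = 2 * (y * y * y)"
            by (simp_all add: power2_eq_square algebra_simps)
          ultimately show ?thesis using \<open>4 * 4 \<le> y * y\<close> by linarith
        qed
        finally show ?thesis using y by (simp add: divide_simps mult.commute add_pos_nonneg)
      qed
      then have "exp y * ((y - 1) / (2 * y\<^sup>2)) \<le> exp y * (y / (y\<^sup>2 + pi\<^sup>2))" by (intro mult_left_mono) auto
      also have "\<dots> \<le> (exp y * y + y) / (y\<^sup>2 + pi\<^sup>2)" using y by (simp add: add_divide_distrib)
      also have "\<dots> = - Re (expm1_div (Complex y pi))"
        using y by (subst Re_expm1_div) (auto simp: field_simps minus_divide_left[symmetric])
      finally show ?thesis by simp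
    qed
    ultimately show "\<exists>d. ((\<lambda>x. log_growth x pi - exp x / (2 * x)) has_real_derivative d) (at y) \<and> 0 \<le> d"
      by (intro exI conjI) auto
  qed
  then show ?thesis by simp
qed

section \<open>From the lattice to the continuous transform\<close>

text \<open>The path, parametrized by the imaginary part: vertical at abscissa \<open>ln T\<close> up to height \<open>T\<close>, then bent to the right
along \<open>Re s = ln |Im s|\<close>. The end points at \<open>t\<close> and \<open>- t\<close> have the same real part, so that on \<open>[- \<pi> r, \<pi> r]\<close> it spans a
full period.\<close>
definition bent_line :: "real \<Rightarrow> real \<Rightarrow> complex" where
  "bent_line T t = Complex (ln (max T \<bar>t\<bar>)) t"

definition bent_line_deriv :: "real \<Rightarrow> real \<Rightarrow> complex" where
  "bent_line_deriv T t = (if \<bar>t\<bar> < T then \<i> else Complex (1 / t) 1)"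

lemma continuous_on_bent_line:
  assumes "0 < T"
  shows "continuous_on A (bent_line T)"
proof -
  have "bent_line T = (\<lambda>t. of_real (ln (max T \<bar>t\<bar>)) + \<i> * of_real t)"
    by (auto simp: bent_line_def Complex_eq)
  moreover have "continuous_on A (\<lambda>t. of_real (ln (max T \<bar>t\<bar>)) + \<i> * of_real t :: complex)"
    using assms by (intro continuous_intros) auto
  ultimately show ?thesis by simp
qed

lemma bent_line_has_deriv:
  assumes T: "0 < T" and t: "\<bar>t\<bar> \<noteq> T"
  shows "(bent_line T has_vector_derivative bent_line_deriv T t) (at t)"
proof -
  consider "\<bar>t\<bar> < T" | "T < t" | "t < - T" using t by linarith
  then show ?thesis
  proof cases
    case 1
    have "((\<lambda>t. of_real (ln T) + \<i> * of_real t :: complex) has_vector_derivative \<i>) (at t)"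
      by (auto intro!: derivative_eq_intros)
    then have "(bent_line T has_vector_derivative \<i>) (at t)"
      by (rule has_vector_derivative_transform_within_open[where S = "{- T<..<T}"])
         (use 1 in \<open>auto simp: bent_line_def Complex_eq max_def\<close>)
    then show ?thesis using 1 by (simp add: bent_line_deriv_def)
  next
    case 2
    have "((\<lambda>t. of_real (ln t) + \<i> * of_real t :: complex) has_vector_derivative of_real (1 / t) + \<i>) (at t)"
      using 2 T by (auto intro!: derivative_eq_intros)
    then have "(bent_line T has_vector_derivative of_real (1 / t) + \<i>) (at t)"
      by (rule has_vector_derivative_transform_within_open[where S = "{T<..}"])
         (use 2 T in \<open>auto simp: bent_line_def Complex_eq max_def\<close>)
    then show ?thesis using 2 T by (simp add: bent_line_deriv_def Complex_eq)
  next
    case 3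
    have "((\<lambda>t. of_real (ln (- t)) + \<i> * of_real t :: complex) has_vector_derivative of_real (1 / t) + \<i>) (at t)"
      using 3 T by (auto intro!: derivative_eq_intros)
    then have "(bent_line T has_vector_derivative of_real (1 / t) + \<i>) (at t)"
      by (rule has_vector_derivative_transform_within_open[where S = "{..<- T}"])
         (use 3 T in \<open>auto simp: bent_line_def Complex_eq max_def\<close>)
    then show ?thesis using 3 T by (simp add: bent_line_deriv_def Complex_eq)
  qed
qed

lemma kappa_path_integral:
  assumes r: "0 < r" and T: "1 < T"
  shows "((\<lambda>t. exp (- of_nat n * (bent_line T t / of_nat r)) *
        (exp (- short_cycle_poly r (exp (bent_line T t / of_nat r))) / (1 - exp (bent_line T t / of_nat r)))
        * bent_line_deriv T t) has_integral
     2 * of_real pi * of_nat r * \<i> * of_real (kappa n r - exp (- harm r))) {- (pi * real r)..pi * real r}"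
proof -
  obtain V where V: "\<And>s. 0 < Re s \<Longrightarrow> (V has_field_derivative exp (- of_nat n * (s / of_nat r)) *
        (exp (- short_cycle_poly r (exp (s / of_nat r))) / (1 - exp (s / of_nat r)))) (at s)"
    "\<And>s. V (s + 2 * of_real pi * of_nat r * \<i>) = V s + 2 * of_real pi * of_nat r * \<i> * of_real (kappa n r - exp (- harm r))"
    using rough_periodic_primitive[OF r] by metis
  let ?b = "bent_line T" and ?X = "pi * real r"
  have re: "0 < Re (?b t)" for t using T by (simp add: bent_line_def)
  let ?f = "\<lambda>s. exp (- of_nat n * (s / of_nat r)) *
        (exp (- short_cycle_poly r (exp (s / of_nat r))) / (1 - exp (s / of_nat r)))"
  have "((\<lambda>t. ?f (?b t) * bent_line_deriv T t) has_integral (V (?b ?X) - V (?b (- ?X)))) {- ?X..?X}"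
  proof (rule fundamental_theorem_of_calculus_interior_strong[where S = "{- T, T}" and f = "\<lambda>t. V (?b t)"])
    show "- ?X \<le> ?X" by simp
    fix t assume t: "t \<in> {- ?X<..<?X} - {- T, T}"
    have "\<bar>t\<bar> \<noteq> T" using t by auto
    then have "(?b has_vector_derivative bent_line_deriv T t) (at t)"
      using T by (intro bent_line_has_deriv) auto
    from field_vector_diff_chain_at[OF this V(1)[OF re]]
    show "((\<lambda>t. V (?b t)) has_vector_derivative ?f (?b t) * bent_line_deriv T t) (at t)"
      by (simp add: o_def mult.commute)
  next
    have "continuous_on {s. 0 < Re s} V"
      using V(1) by (intro continuous_at_imp_continuous_on ballI) (blast intro: DERIV_isCont)
    then show "continuous_on {- ?X..?X} (\<lambda>t. V (?b t))"
      by (rule continuous_on_compose2[OF _ continuous_on_bent_line]) (use T re in auto)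
  qed auto
  moreover have "?b ?X = ?b (- ?X) + 2 * of_real pi * of_nat r * \<i>"
    by (simp add: bent_line_def complex_eq_iff)
  ultimately show ?thesis using V(2)[of "?b (- ?X)"] by simp
qed

text \<open>The logarithmic derivative of \<open>(exp x - 1) / x\<close>, that is \<open>1 / (1 - exp (- x)) - 1 / x\<close>: the difference between
the kernel of a geometric sum and the kernel of the corresponding integral.\<close>
definition lattice_correction :: "complex \<Rightarrow> complex" where
  "lattice_correction x = deriv expm1_div x / expm1_div x"

lemma expm1_div_nonzero:
  assumes "\<bar>Im x\<bar> < 2 * pi"
  shows "expm1_div x \<noteq> 0"
proof (cases "x = 0")
  case False
  have "exp x \<noteq> 1"
  proof
    assume "exp x = 1"
    then obtain n :: int where n: "Re x = 0" "Im x = of_int (2 * n) * pi"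
      by (auto simp: exp_eq_1)
    have "n \<noteq> 0" using n False by (auto simp: complex_eq_iff)
    then have "1 \<le> \<bar>real_of_int n\<bar>" by linarith
    then have "2 * pi \<le> \<bar>Im x\<bar>" using n by (simp add: abs_mult)
    then show False using assms by simp
  qed
  then show ?thesis using False by (simp add: expm1_div_def)
qed (simp add: expm1_div_def)

lemma has_field_derivative_expm1_div: "(expm1_div has_field_derivative deriv expm1_div x) (at x)"
  using holomorphic_expm1_div[of UNIV] holomorphic_derivI[of expm1_div UNIV x] by auto

text \<open>The quotient rule, with \<open>exp x - 1\<close> written as \<open>x expm1_div x\<close>.\<close>
lemma deriv_expm1_div:
  assumes "x \<noteq> 0"
  shows "deriv expm1_div x = (exp x - expm1_div x) / x"
proof (rule DERIV_imp_deriv)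
  have "((\<lambda>s. (exp s - 1) / s) has_field_derivative (exp x - expm1_div x) / x) (at x)"
    using assms by (auto intro!: derivative_eq_intros simp: expm1_div_def field_simps)
  then show "(expm1_div has_field_derivative (exp x - expm1_div x) / x) (at x)"
    by (rule has_field_derivative_transform_within_open[where S = "- {0}"])
       (use assms in \<open>auto simp: expm1_div_def\<close>)
qed

lemma strip_convex_open:
  fixes a :: real
  shows "convex {s. \<bar>Im s\<bar> < a}" "open {s. \<bar>Im s\<bar> < a}"
proof -
  have eq: "{s. \<bar>Im s\<bar> < a} = {s. Im s < a} \<inter> {s. - a < Im s}" by auto
  show "convex {s. \<bar>Im s\<bar> < a}" unfolding eq
    by (intro convex_Int convex_halfspace_Im_lt convex_halfspace_Im_gt)
  show "open {s. \<bar>Im s\<bar> < a}" unfolding eq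
    by (intro open_Int open_halfspace_Im_lt open_halfspace_Im_gt)
qed

lemma holomorphic_lattice_correction: "lattice_correction holomorphic_on {x. \<bar>Im x\<bar> < 2 * pi}"
proof -
  have "deriv expm1_div holomorphic_on {x. \<bar>Im x\<bar> < 2 * pi}"
    by (intro holomorphic_deriv holomorphic_expm1_div strip_convex_open)
  then show ?thesis unfolding lattice_correction_def[abs_def]
    using holomorphic_expm1_div expm1_div_nonzero by (intro holomorphic_on_divide) auto
qed

lemma lattice_correction_bounded:
  obtains G where "0 < G" "\<And>x. 0 \<le> Re x \<Longrightarrow> Re x \<le> B \<Longrightarrow> \<bar>Im x\<bar> \<le> pi \<Longrightarrow> norm (lattice_correction x) \<le> G"
proof -
  let ?K = "cbox (Complex 0 (- pi)) (Complex B pi)"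
  have mem: "x \<in> ?K \<longleftrightarrow> 0 \<le> Re x \<and> Re x \<le> B \<and> \<bar>Im x\<bar> \<le> pi" for x
    by (auto simp: in_cbox_complex_iff)
  have "?K \<subseteq> {x. \<bar>Im x\<bar> < 2 * pi}"
  proof
    fix x assume "x \<in> ?K"
    then have "\<bar>Im x\<bar> \<le> pi" using mem by blast
    then have "\<bar>Im x\<bar> < 2 * pi" using pi_gt3 by linarith
    then show "x \<in> {x. \<bar>Im x\<bar> < 2 * pi}" by simp
  qed
  then have "continuous_on ?K lattice_correction"
    using holomorphic_lattice_correction holomorphic_on_imp_continuous_on continuous_on_subset by blast
  then have "bounded (lattice_correction ` ?K)"
    by (intro compact_imp_bounded compact_continuous_image compact_cbox)
  then obtain G where "0 < G" "\<And>x. x \<in> ?K \<Longrightarrow> norm (lattice_correction x) \<le> G"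
    unfolding bounded_pos by auto
  then show ?thesis using that mem by blast
qed

text \<open>The difference between the geometric sum and the integral, which is \<open>(exp s - 1) lattice_correction (s / r) / r\<close>, combines
with the logarithmic derivative of \<open>(1 - exp (s / r)) / s\<close> so that only the term with \<open>exp s\<close> is left.\<close>
lemma lattice_log_derivative:
  assumes r: "0 < r" and s: "\<bar>Im s\<bar> < 2 * pi * real r"
  defines "z \<equiv> exp (s / of_nat r)"
  shows "- ((\<Sum>j<r. z ^ j) * (z / of_nat r)) + expm1_div s - lattice_correction (s / of_nat r) / of_nat r
     = - (exp s * lattice_correction (s / of_nat r) / of_nat r)"
proof (cases "s = 0")
  case True
  then show ?thesis using r by (simp add: z_def expm1_div_def)
next
  case False
  let ?x = "s / of_nat r"
  have x0: "?x \<noteq> 0" using False r by simp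
  have imx: "\<bar>Im ?x\<bar> < 2 * pi" using s r by (simp add: Im_divide_of_nat field_simps)
  have nz: "expm1_div ?x \<noteq> 0" by (rule expm1_div_nonzero[OF imx])
  then have z1: "z \<noteq> 1" using x0 by (simp add: expm1_div_def z_def)
  have zr: "z ^ r = exp s" using r by (simp add: z_def flip: exp_of_nat_mult)
  have gx: "lattice_correction ?x = z / (z - 1) - 1 / ?x"
    using x0 nz z1 unfolding lattice_correction_def deriv_expm1_div[OF x0]
    by (simp add: expm1_div_def z_def[symmetric] field_simps)
  have gs: "(\<Sum>j<r. z ^ j) = (exp s - 1) / (z - 1)"
    using z1 zr by (subst geometric_sum) auto
  define q p where "q = z / (z - 1)" and "p = 1 / ?x"
  have e1: "(\<Sum>j<r. z ^ j) * (z / of_nat r) = (exp s - 1) * q / of_nat r"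
    by (simp add: gs q_def)
  have e2: "expm1_div s = (exp s - 1) * p / of_nat r"
    using False r by (simp add: expm1_div_def p_def)
  have e3: "lattice_correction ?x = q - p" by (simp add: gx q_def p_def)
  show ?thesis unfolding e1 e2 e3 by (simp add: algebra_simps diff_divide_distrib add_divide_distrib)
qed

text \<open>By \<open>lattice_log_derivative\<close> both sides have the same logarithmic derivative on the strip, and the limits at \<open>0\<close> of
their products with \<open>s\<close> agree. The strip excludes the zeros of \<open>1 - exp (s / r)\<close> other than \<open>0\<close>.\<close>
lemma lattice_transform_ratio:
  assumes r: "0 < r"
  obtains \<eta> where
    "\<And>s. \<bar>Im s\<bar> < 2 * pi * real r \<Longrightarrow> (\<eta> has_field_derivative exp s * lattice_correction (s / of_nat r) / of_nat r) (at s)"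
    "\<eta> 0 = 0"
    "\<And>s. \<bar>Im s\<bar> < 2 * pi * real r \<Longrightarrow> s \<noteq> 0 \<Longrightarrow>
       exp (- short_cycle_poly r (exp (s / of_nat r))) / (1 - exp (s / of_nat r)) =
       of_nat r * of_real (exp (- harm r)) * (exp (- I_fun s) / (- s)) * exp (- \<eta> s)"
proof -
  let ?S = "{s. \<bar>Im s\<bar> < 2 * pi * real r}"
  let ?g = "\<lambda>s. exp s * lattice_correction (s / of_nat r) / of_nat r"
  have im: "\<bar>Im (s / of_nat r)\<bar> < 2 * pi" if "s \<in> ?S" for s
    using that r by (simp add: Im_divide_of_nat field_simps)
  have "(\<lambda>s. lattice_correction (s / of_nat r)) holomorphic_on ?S"
  proof -
    have "lattice_correction \<circ> (\<lambda>s. s / of_nat r) holomorphic_on ?S"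
      by (rule holomorphic_on_compose_gen[OF _ holomorphic_lattice_correction])
         (use im r in \<open>auto intro!: holomorphic_intros\<close>)
    then show ?thesis by (simp add: o_def)
  qed
  then have hol: "?g holomorphic_on ?S" using r by (intro holomorphic_intros) auto
  obtain h where h: "\<And>s. s \<in> ?S \<Longrightarrow> (h has_field_derivative ?g s) (at s within ?S)"
  proof (rule holomorphic_convex_primitive'[OF strip_convex_open hol])
    fix g assume "\<And>x. x \<in> ?S \<Longrightarrow> (g has_field_derivative ?g x) (at x within ?S)"
    then show thesis by (rule that)
  qed
  define \<eta> where "\<eta> = (\<lambda>s. h s - h 0)"
  have d\<eta>: "(\<eta> has_field_derivative ?g s) (at s)" if "s \<in> ?S" for s
  proof -
    have "(h has_field_derivative ?g s) (at s)"
      using h[OF that] at_within_open[OF that strip_convex_open(2)] by simp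
    then show ?thesis unfolding \<eta>_def by (auto intro!: derivative_eq_intros)
  qed
  define L where "L = (\<lambda>s. exp (- short_cycle_poly r (exp (s / of_nat r)) + of_real (harm r) + I_fun s + \<eta> s) / expm1_div (s / of_nat r))"
  \<comment> \<open>\<open>L\<close> is the quotient of the two sides of the asserted formula, with the factor \<open>s\<close> cancelled.\<close>
  have L1: "L s = 1" if s: "s \<in> ?S" for s
  proof -
    have dL: "(L has_field_derivative 0) (at s within ?S)" if s: "s \<in> ?S" for s
    proof -
      let ?z = "exp (s / of_nat r)" and ?x = "s / of_nat r"
      let ?E = "\<lambda>s. exp (- short_cycle_poly r (exp (s / of_nat r)) + of_real (harm r) + I_fun s + \<eta> s)"
      have nz: "expm1_div ?x \<noteq> 0" using im[OF s] by (rule expm1_div_nonzero)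
      have dz: "((\<lambda>s. exp (s / of_nat r)) has_field_derivative ?z / of_nat r) (at s)"
        using r by (auto intro!: derivative_eq_intros)
      have d1: "((\<lambda>s. short_cycle_poly r (exp (s / of_nat r))) has_field_derivative (\<Sum>j<r. ?z ^ j) * (?z / of_nat r)) (at s)"
        by (rule DERIV_chain2[OF has_field_derivative_short_cycle_poly dz])
      have dx: "((\<lambda>s. s / of_nat r :: complex) has_field_derivative 1 / of_nat r) (at s)"
        using r by (auto intro!: derivative_eq_intros)
      have d2: "((\<lambda>s. expm1_div (s / of_nat r)) has_field_derivative deriv expm1_div ?x * (1 / of_nat r)) (at s)"
        by (rule DERIV_chain2[OF has_field_derivative_expm1_div dx])
      let ?D = "- ((\<Sum>j<r. ?z ^ j) * (?z / of_nat r)) + 0 + expm1_div s + ?g s"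
      have "((\<lambda>s. - short_cycle_poly r (exp (s / of_nat r)) + of_real (harm r) + I_fun s + \<eta> s) has_field_derivative ?D) (at s)"
        by (intro DERIV_add DERIV_minus d1 DERIV_const has_field_derivative_I_fun d\<eta> s)
      then have dE: "(?E has_field_derivative ?E s * ?D) (at s)"
        by (rule DERIV_chain2[OF DERIV_exp])
      have D: "?D = lattice_correction ?x / of_nat r"
        using lattice_log_derivative[OF r, of s] s by (simp add: algebra_simps)
      have "(L has_field_derivative (?E s * ?D * expm1_div ?x - ?E s * (deriv expm1_div ?x * (1 / of_nat r))) / (expm1_div ?x * expm1_div ?x)) (at s)"
        unfolding L_def using nz by (intro DERIV_divide dE d2)
      also have "?E s * ?D * expm1_div ?x - ?E s * (deriv expm1_div ?x * (1 / of_nat r)) = 0"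
        unfolding D using nz by (simp add: lattice_correction_def)
      finally show ?thesis by (simp add: has_field_derivative_at_within)
    qed
    have "0 \<in> ?S" using r by simp
    have "\<exists>c. \<forall>s\<in>?S. L s = c"
      using strip_convex_open(1) dL by (rule has_field_derivative_zero_constant)
    then have "L s = L 0" using s \<open>0 \<in> ?S\<close> by metis
    also have "L 0 = 1"
      by (simp add: L_def \<eta>_def short_cycle_poly_1 I_fun_0 expm1_div_def)
    finally show ?thesis .
  qed
  show ?thesis
  proof (rule that[of \<eta>])
    show "(\<eta> has_field_derivative ?g s) (at s)" if "\<bar>Im s\<bar> < 2 * pi * real r" for s
      using that d\<eta> by simp
    show "\<eta> 0 = 0" by (simp add: \<eta>_def)
    fix s :: complex assume s: "\<bar>Im s\<bar> < 2 * pi * real r" "s \<noteq> 0"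
    let ?z = "exp (s / of_nat r)" and ?x = "s / of_nat r"
    have nz: "expm1_div ?x \<noteq> 0" using im s by (intro expm1_div_nonzero) auto
    have x0: "?x \<noteq> 0" using s r by simp
    have "exp (- short_cycle_poly r ?z) = expm1_div ?x * (exp (- of_real (harm r)) * exp (- I_fun s) * exp (- \<eta> s))"
    proof -
      have "exp (- short_cycle_poly r ?z + of_real (harm r) + I_fun s + \<eta> s) = expm1_div ?x"
        using L1[of s] s nz by (simp add: L_def)
      moreover have "exp (- short_cycle_poly r ?z) = exp (- short_cycle_poly r ?z + of_real (harm r) + I_fun s + \<eta> s)
           * (exp (- of_real (harm r)) * exp (- I_fun s) * exp (- \<eta> s))"
        by (simp flip: exp_add)
      ultimately show ?thesis by simp
    qed
    moreover have "1 - ?z = - (?x * expm1_div ?x)" using x0 by (simp add: expm1_div_def)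
    moreover have "of_real (exp (- harm r)) = exp (- of_real (harm r) :: complex)"
      by (simp flip: exp_of_real)
    moreover have "p * (h * i * e) / (- (s / c * p)) = c * h * (i / (- s)) * e"
      if "p \<noteq> 0" "c \<noteq> 0" for p h i e c :: complex
      using that s by (simp add: field_simps)
    ultimately show "exp (- short_cycle_poly r ?z) / (1 - ?z) =
       of_nat r * of_real (exp (- harm r)) * (exp (- I_fun s) / (- s)) * exp (- \<eta> s)"
      using nz r by (simp only:) simp
  qed
qed

text \<open>\<open>\<eta>\<close> is the integral of its derivative along the imaginary axis, where \<open>|exp w| = 1\<close>, and then along a horizontal
segment. This order avoids a factor \<open>exp (Re s)\<close> on the long vertical part.\<close>
lemma lattice_ratio_bound:
  assumes r: "0 < r" and G: "0 < G" "\<And>x. 0 \<le> Re x \<Longrightarrow> Re x \<le> B \<Longrightarrow> \<bar>Im x\<bar> \<le> pi \<Longrightarrow> norm (lattice_correction x) \<le> G"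
    and \<eta>: "\<And>s. \<bar>Im s\<bar> < 2 * pi * real r \<Longrightarrow> (\<eta> has_field_derivative exp s * lattice_correction (s / of_nat r) / of_nat r) (at s)"
    "\<eta> 0 = 0"
    and s: "0 \<le> Re s" "Re s \<le> B * real r" "\<bar>Im s\<bar> \<le> pi * real r"
  shows "norm (\<eta> s) \<le> G * (\<bar>Im s\<bar> + exp (Re s)) / real r"
proof -
  have imp: "\<bar>Im w\<bar> < 2 * pi * real r" if "\<bar>Im w\<bar> \<le> pi * real r" for w
  proof -
    have "0 < pi * real r" using r by simp
    then show ?thesis using that by linarith
  qed
  have g: "norm (exp w * lattice_correction (w / of_nat r) / of_nat r) \<le> G * exp (Re w) / real r"
    if "0 \<le> Re w" "Re w \<le> B * real r" "\<bar>Im w\<bar> \<le> pi * real r" for w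
  proof -
    have "norm (lattice_correction (w / of_nat r)) \<le> G"
      using that r by (intro G(2)) (auto simp: Re_divide_of_nat Im_divide_of_nat field_simps)
    then have "exp (Re w) * norm (lattice_correction (w / of_nat r)) \<le> exp (Re w) * G"
      by (intro mult_left_mono) auto
    then show ?thesis by (simp add: norm_mult norm_divide divide_right_mono mult.commute)
  qed
  let ?t = "Im s" and ?x = "Re s"
  have "norm (\<eta> (Complex 0 ?t) - \<eta> 0) \<le> G / real r * norm (Complex 0 ?t - 0)"
  proof (rule field_differentiable_bound[where S = "closed_segment 0 (Complex 0 ?t)"])
    fix w assume w: "w \<in> closed_segment 0 (Complex 0 ?t)"
    then obtain u where u: "0 \<le> u" "u \<le> 1" "w = of_real u * Complex 0 ?t"
      by (auto simp: closed_segment_def scaleR_conv_of_real)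
    have rew: "Re w = 0" using u by simp
    have "\<bar>Im w\<bar> = u * \<bar>?t\<bar>" using u by (simp add: abs_mult)
    also have "\<dots> \<le> 1 * \<bar>?t\<bar>" using u by (intro mult_right_mono) auto
    finally have imw: "\<bar>Im w\<bar> \<le> pi * real r" using s by simp
    show "(\<eta> has_field_derivative exp w * lattice_correction (w / of_nat r) / of_nat r) (at w within closed_segment 0 (Complex 0 ?t))"
      by (rule has_field_derivative_at_within[OF \<eta>(1)[OF imp[OF imw]]])
    have "0 \<le> B * real r" using s by linarith
    then show "norm (exp w * lattice_correction (w / of_nat r) / of_nat r) \<le> G / real r"
      using g[of w] rew imw by simp
  qed auto
  then have 1: "norm (\<eta> (Complex 0 ?t)) \<le> G * \<bar>?t\<bar> / real r"
    by (simp add: \<eta>(2) complex_norm)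
  have 2: "norm (\<eta> s - \<eta> (Complex 0 ?t)) \<le> G * exp ?x / real r"
  proof (cases "?x = 0")
    case True
    then have "Complex 0 ?t = s" by (simp add: complex_eq_iff)
    then show ?thesis using G by simp
  next
    case False
    then have x: "0 < ?x" using s by simp
    have dv: "((\<lambda>y. \<eta> (Complex y ?t)) has_vector_derivative
       exp (Complex y ?t) * lattice_correction (Complex y ?t / of_nat r) / of_nat r) (at y)" for y
    proof -
      have "((\<lambda>y. Complex y ?t) has_vector_derivative 1) (at y)"
        unfolding Complex_eq by (auto intro!: derivative_eq_intros)
      from field_vector_diff_chain_at[OF this \<eta>(1)[OF imp]] show ?thesis using s
        by (simp add: o_def)
    qed
    have dp: "((\<lambda>y. G * exp y / real r) has_vector_derivative G * exp y / real r) (at y)" for y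
      unfolding has_real_derivative_iff_has_vector_derivative[symmetric]
      using r by (auto intro!: derivative_eq_intros)
    have "norm (\<eta> (Complex ?x ?t) - \<eta> (Complex 0 ?t)) \<le> G * exp ?x / real r - G * exp 0 / real r"
    proof (rule differentiable_bound_general[OF x])
      show "continuous_on {0..?x} (\<lambda>y. \<eta> (Complex y ?t))"
        using dv by (intro continuous_at_imp_continuous_on ballI) (blast intro: has_vector_derivative_continuous)
      show "continuous_on {0..?x} (\<lambda>y. G * exp y / real r)"
        using r by (intro continuous_intros) auto
      show "norm (exp (Complex y ?t) * lattice_correction (Complex y ?t / of_nat r) / of_nat r) \<le> G * exp y / real r"
        if "0 < y" "y < ?x" for y
        using g[of "Complex y ?t"] that s by simp
    qed (use dv dp in auto)
    also have "\<dots> \<le> G * exp ?x / real r" using G by simp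
    finally show ?thesis by simp
  qed
  have "norm (\<eta> s) \<le> norm (\<eta> s - \<eta> (Complex 0 ?t)) + norm (\<eta> (Complex 0 ?t))"
    using norm_triangle_ineq[of "\<eta> s - \<eta> (Complex 0 ?t)" "\<eta> (Complex 0 ?t)"] by simp
  also have "\<dots> \<le> G * exp ?x / real r + G * \<bar>?t\<bar> / real r" using 1 2 by (intro add_mono)
  finally show ?thesis by (simp add: algebra_simps add_divide_distrib)
qed

section \<open>Comparison along a bent line\<close>

lemma norm_exp_minus_one_le: "norm (exp z - 1 :: complex) \<le> norm z * exp (norm z)"
proof -
  have "norm (exp z - exp 0) \<le> exp (norm z) * norm (z - 0)"
  proof (rule field_differentiable_bound[where S = "cball 0 (norm z)"])
    fix w :: complex assume w: "w \<in> cball 0 (norm z)"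
    show "(exp has_field_derivative exp w) (at w within cball 0 (norm z))"
      by (rule has_field_derivative_at_within[OF DERIV_exp])
    have "Re w \<le> norm z" using w complex_Re_le_cmod[of w] by (simp add: dist_norm)
    then show "norm (exp w) \<le> exp (norm z)" by simp
  qed auto
  then show ?thesis by (simp add: mult.commute)
qed

text \<open>The modulus of the continuous integrand \<open>exp (- v s) exp (- I s) / s\<close> on the path.\<close>
definition path_weight :: "real \<Rightarrow> real \<Rightarrow> real \<Rightarrow> real" where
  "path_weight v T t = exp (log_growth (ln (max T \<bar>t\<bar>)) t) / norm (bent_line T t) * exp (- v * ln (max T \<bar>t\<bar>))"

definition path_kernel :: "real \<Rightarrow> real \<Rightarrow> real \<Rightarrow> complex" where
  "path_kernel v T t = exp (- of_real v * bent_line T t) *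
     (exp (- I_fun (bent_line T t)) / (- bent_line T t)) * bent_line_deriv T t"

lemma norm_path_kernel_le:
  assumes "1 < T"
  shows "norm (path_kernel v T t) \<le> 2 * path_weight v T t"
proof -
  let ?b = "bent_line T"
  have "?b t = Complex (ln (max T \<bar>t\<bar>)) t" by (simp add: bent_line_def)
  then have "norm (exp (- I_fun (?b t))) = exp (log_growth (ln (max T \<bar>t\<bar>)) t)"
    by (simp only: norm_exp_minus_I_fun)
  moreover have "norm (exp (- of_real v * ?b t)) = exp (- v * ln (max T \<bar>t\<bar>))"
    by (simp add: bent_line_def)
  ultimately have eq: "norm (path_kernel v T t) = path_weight v T t * norm (bent_line_deriv T t)"
    by (simp add: path_kernel_def path_weight_def norm_mult norm_divide mult.commute)
  have "norm (bent_line_deriv T t) \<le> 2"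
  proof (cases "\<bar>t\<bar> < T")
    case False
    then have "\<bar>1 / t\<bar> \<le> 1" using assms by (simp add: abs_divide divide_le_eq)
    then show ?thesis using False cmod_le[of "Complex (1 / t) 1"] by (simp add: bent_line_deriv_def)
  qed (simp add: bent_line_deriv_def)
  then have "path_weight v T t * norm (bent_line_deriv T t) \<le> path_weight v T t * 2"
    by (intro mult_left_mono) (simp_all add: path_weight_def)
  then show ?thesis by (simp add: eq mult.commute)
qed

text \<open>The integrand differs from \<open>path_kernel\<close>, which depends on \<open>n / r\<close> only, by the factor \<open>\<phi> = exp (- \<eta>)\<close>. The bound
\<open>T \<le> A r\<close> keeps \<open>\<eta>\<close> bounded, so that \<open>\<phi> - 1\<close> is as small as \<open>\<eta>\<close>.\<close>
lemma normalized_path_integral: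
  assumes A: "4 \<le> A"
  obtains E where "0 < E"
    "\<And>n r T. 0 < r \<Longrightarrow> 1 < T \<Longrightarrow> T \<le> A * real r \<Longrightarrow>
      \<exists>\<phi>. ((\<lambda>t. path_kernel (real n / real r) T t * \<phi> t) has_integral
            2 * of_real pi * \<i> * of_real (kappa n r * exp (harm r) - 1)) {- (pi * real r)..pi * real r}
        \<and> (\<forall>t. \<bar>t\<bar> \<le> pi * real r \<longrightarrow> norm (\<phi> t - 1) \<le> E * max T \<bar>t\<bar> / real r)"
proof -
  obtain G where G: "0 < G" "\<And>x. 0 \<le> Re x \<Longrightarrow> Re x \<le> A \<Longrightarrow> \<bar>Im x\<bar> \<le> pi \<Longrightarrow> norm (lattice_correction x) \<le> G"
    using lattice_correction_bounded[of A] by blast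
  define E where "E = 2 * G * exp (2 * G * A)"
  have "0 < E" using G by (simp add: E_def)
  moreover have "\<exists>\<phi>. ((\<lambda>t. path_kernel (real n / real r) T t * \<phi> t) has_integral
            2 * of_real pi * \<i> * of_real (kappa n r * exp (harm r) - 1)) {- (pi * real r)..pi * real r}
        \<and> (\<forall>t. \<bar>t\<bar> \<le> pi * real r \<longrightarrow> norm (\<phi> t - 1) \<le> E * max T \<bar>t\<bar> / real r)"
    if r: "0 < r" and T: "1 < T" "T \<le> A * real r" for n r T
  proof -
    obtain \<eta> where \<eta>:
      "\<And>s. \<bar>Im s\<bar> < 2 * pi * real r \<Longrightarrow> (\<eta> has_field_derivative exp s * lattice_correction (s / of_nat r) / of_nat r) (at s)"
      "\<eta> 0 = 0"
      "\<And>s. \<bar>Im s\<bar> < 2 * pi * real r \<Longrightarrow> s \<noteq> 0 \<Longrightarrow>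
         exp (- short_cycle_poly r (exp (s / of_nat r))) / (1 - exp (s / of_nat r)) =
         of_nat r * of_real (exp (- harm r)) * (exp (- I_fun s) / (- s)) * exp (- \<eta> s)"
      by (rule lattice_transform_ratio[OF r], rule that)
    let ?b = "bent_line T" and ?X = "pi * real r"
    have X: "0 < ?X" using r by simp
    have b0: "?b t \<noteq> 0" for t using T by (auto simp: bent_line_def complex_eq_iff)
    have imb: "Im (?b t) = t" "Re (?b t) = ln (max T \<bar>t\<bar>)" for t by (auto simp: bent_line_def)
    let ?c = "of_nat r * of_real (exp (- harm r)) :: complex"
    have c0: "?c \<noteq> 0" using r by simp
    have 1: "((\<lambda>t. exp (- of_nat n * (?b t / of_nat r)) *
        (exp (- short_cycle_poly r (exp (?b t / of_nat r))) / (1 - exp (?b t / of_nat r)))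
        * bent_line_deriv T t) has_integral
     2 * of_real pi * of_nat r * \<i> * of_real (kappa n r - exp (- harm r))) {- ?X..?X}"
      by (rule kappa_path_integral[OF r T(1)])
    have 2: "((\<lambda>t. ?c * (path_kernel (real n / real r) T t * exp (- \<eta> (?b t)))) has_integral
     2 * of_real pi * of_nat r * \<i> * of_real (kappa n r - exp (- harm r))) {- ?X..?X}"
    proof (rule has_integral_eq[OF _ 1])
      fix t assume "t \<in> {- ?X..?X}"
      then have "\<bar>Im (?b t)\<bar> < 2 * pi * real r" using X unfolding imb by auto
      then have e: "exp (- short_cycle_poly r (exp (?b t / of_nat r))) / (1 - exp (?b t / of_nat r)) =
         ?c * (exp (- I_fun (?b t)) / (- ?b t)) * exp (- \<eta> (?b t))"
        using \<eta>(3) b0 by blast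
      have "- of_nat n * (?b t / of_nat r) = - of_real (real n / real r) * ?b t" by simp
      then show "exp (- of_nat n * (?b t / of_nat r)) *
        (exp (- short_cycle_poly r (exp (?b t / of_nat r))) / (1 - exp (?b t / of_nat r)))
        * bent_line_deriv T t = ?c * (path_kernel (real n / real r) T t * exp (- \<eta> (?b t)))"
        unfolding e path_kernel_def by (simp only: mult_ac)
    qed
    from has_integral_mult_right[OF 2, of "1 / ?c"]
    have 3: "((\<lambda>t. path_kernel (real n / real r) T t * exp (- \<eta> (?b t))) has_integral
            1 / ?c * (2 * of_real pi * of_nat r * \<i> * of_real (kappa n r - exp (- harm r)))) {- ?X..?X}"
    proof (rule has_integral_eq[rotated])
      have "1 / c * (c * w) = w" if "c \<noteq> 0" for c w :: complex using that by simp
      then show "1 / ?c * (?c * (path_kernel (real n / real r) T t * exp (- \<eta> (?b t)))) = path_kernel (real n / real r) T t * exp (- \<eta> (?b t))" for t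
        using c0 by blast
    qed
    have "1 / ?c * (2 * of_real pi * of_nat r * \<i> * of_real (kappa n r - exp (- harm r)))
        = 2 * of_real pi * \<i> * of_real (kappa n r * exp (harm r) - 1)"
    proof -
      have "of_real (kappa n r - exp (- harm r)) = (of_real (exp (- harm r)) * of_real (kappa n r * exp (harm r) - 1) :: complex)"
        unfolding of_real_mult[symmetric] by (simp add: algebra_simps flip: exp_add)
      moreover have "1 / (R * e) * (2 * p * R * i * (e * k)) = 2 * p * i * k"
        if "R \<noteq> 0" "e \<noteq> 0" for R e p i k :: complex using that by simp
      ultimately show ?thesis using r by simp
    qed
    note 3 = 3[unfolded this]
    have "norm (exp (- \<eta> (?b t)) - 1) \<le> E * max T \<bar>t\<bar> / real r" if t: "\<bar>t\<bar> \<le> ?X" for t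
    proof -
      let ?m = "max T \<bar>t\<bar>"
      have m1: "1 < ?m" using T by simp
      have mA: "?m \<le> A * real r"
      proof -
        have "?X \<le> A * real r" using A pi_less_4 by (intro mult_right_mono) auto
        then show ?thesis using t T by auto
      qed
      have "norm (\<eta> (?b t)) \<le> G * (\<bar>Im (?b t)\<bar> + exp (Re (?b t))) / real r"
      proof (rule lattice_ratio_bound[OF r G \<eta>(1,2)])
        show "0 \<le> Re (?b t)" using m1 by (simp add: imb)
        have "ln ?m \<le> ?m - 1" using m1 by (intro ln_le_minus_one) simp
        then have "ln ?m \<le> A * real r" using mA by linarith
        then show "Re (?b t) \<le> A * real r" by (simp only: imb)
        show "\<bar>Im (?b t)\<bar> \<le> ?X" using t by (simp add: imb)
      qed auto
      also have "\<dots> = G * (\<bar>t\<bar> + ?m) / real r" using m1 by (simp add: imb)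
      also have "\<dots> \<le> G * (?m + ?m) / real r" using G by (intro divide_right_mono mult_left_mono add_right_mono) auto
      finally have ne: "norm (\<eta> (?b t)) \<le> 2 * G * ?m / real r" by (simp add: algebra_simps)
      have "2 * G * ?m \<le> 2 * G * (A * real r)" using mA G by (intro mult_left_mono) auto
      then have "2 * G * ?m / real r \<le> 2 * G * A" using r by (simp add: field_simps)
      with ne have ne2: "norm (\<eta> (?b t)) \<le> 2 * G * A" by linarith
      have "norm (exp (- \<eta> (?b t)) - 1) \<le> norm (\<eta> (?b t)) * exp (norm (\<eta> (?b t)))"
        using norm_exp_minus_one_le[of "- \<eta> (?b t)"] by simp
      also have "\<dots> \<le> (2 * G * ?m / real r) * exp (2 * G * A)"
        using ne ne2 G m1 by (intro mult_mono) auto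
      finally show ?thesis by (simp add: E_def algebra_simps)
    qed
    with 3 show ?thesis
      by (intro exI[of _ "\<lambda>t. exp (- \<eta> (?b t))"] conjI allI impI)
  qed
  ultimately show ?thesis using that by blast
qed

text \<open>Refining the lattice at a fixed ratio \<open>n / r\<close> identifies the limit of the normalized integrals as a value of
the Buchstab function.\<close>
lemma kappa_refine_limit:
  assumes r: "0 < r" and n: "r < n"
  shows "(\<lambda>m. kappa (n * Suc m) (r * Suc m) * exp (harm (r * Suc m))) \<longlonglongrightarrow>
     exp euler_mascheroni * buchstab (real n / real r)"
proof -
  let ?R = "\<lambda>m. r * Suc m"
  obtain C where C: "\<And>n' r'. 0 < r' \<Longrightarrow> r' < n' \<Longrightarrow> real n' \<le> real n / real r * real r' \<Longrightarrow>
       \<bar>real r' * kappa n' r' - buchstab (real n' / real r')\<bar> \<le> C / real r'"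
    by (rule kappa_buchstab_bounded[of "real n / real r"], rule that)
  have inv: "(\<lambda>m. c / real (?R m)) \<longlonglongrightarrow> 0" for c
  proof -
    have "(\<lambda>m. c / real r * inverse (real (Suc m))) \<longlonglongrightarrow> c / real r * 0"
      by (intro tendsto_intros LIMSEQ_inverse_real_of_nat)
    moreover have "c / real r * inverse (real (Suc m)) = c / real (?R m)" for m
      by (simp add: divide_simps del: of_nat_Suc mult_Suc_right)
    ultimately show ?thesis by simp
  qed
  have q: "real (n * Suc m) / real (?R m) = real n / real r" for m
    using r by (simp del: of_nat_Suc mult_Suc_right)
  have a: "(\<lambda>m. real (?R m) * kappa (n * Suc m) (?R m) - buchstab (real n / real r)) \<longlonglongrightarrow> 0"
  proof (rule Lim_null_comparison[OF _ inv[of C]], rule always_eventually, rule allI)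
    fix m
    have "\<bar>real (?R m) * kappa (n * Suc m) (?R m) - buchstab (real (n * Suc m) / real (?R m))\<bar> \<le> C / real (?R m)"
    proof (rule C)
      show "0 < ?R m" using r by simp
      show "?R m < n * Suc m" using n by (intro mult_less_mono1) auto
      show "real (n * Suc m) \<le> real n / real r * real (?R m)"
        using r by (simp del: of_nat_Suc mult_Suc_right)
    qed
    then show "norm (real (?R m) * kappa (n * Suc m) (?R m) - buchstab (real n / real r)) \<le> C / real (?R m)"
      unfolding q by simp
  qed
  have b: "(\<lambda>m. real (?R m) * exp (- harm (?R m) + euler_mascheroni) - 1) \<longlonglongrightarrow> 0"
  proof (rule Lim_null_comparison[OF _ inv[of 2]], rule always_eventually, rule allI)
    fix m
    show "norm (real (?R m) * exp (- harm (?R m) + euler_mascheroni) - 1) \<le> 2 / real (?R m)"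
      using abs_exp_harm_diff_le[of "?R m"] r by simp
  qed
  have a': "(\<lambda>m. real (?R m) * kappa (n * Suc m) (?R m)) \<longlonglongrightarrow> buchstab (real n / real r)"
    using a by (rule LIM_zero_cancel)
  have b': "(\<lambda>m. real (?R m) * exp (- harm (?R m) + euler_mascheroni)) \<longlonglongrightarrow> 1"
    using b by (rule LIM_zero_cancel)
  have "(\<lambda>m. exp euler_mascheroni * (real (?R m) * kappa (n * Suc m) (?R m)) / (real (?R m) * exp (- harm (?R m) + euler_mascheroni)))
      \<longlonglongrightarrow> exp euler_mascheroni * buchstab (real n / real r) / 1"
    by (intro tendsto_intros a' b') simp
  moreover have "exp euler_mascheroni * (real (?R m) * kappa (n * Suc m) (?R m)) / (real (?R m) * exp (- harm (?R m) + euler_mascheroni))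
     = kappa (n * Suc m) (?R m) * exp (harm (?R m))" for m
  proof -
    have gen: "g * (R * k) / (R * (g / h)) = k * h" if "R \<noteq> 0" "g \<noteq> 0" "h \<noteq> 0" for g R k h :: real
      using that by simp
    have "exp (- harm (?R m) + euler_mascheroni) = exp euler_mascheroni / exp (harm (?R m) :: real)"
      by (simp add: exp_diff del: mult_Suc_right)
    moreover have "real (?R m) \<noteq> 0" using r by (simp del: mult_Suc_right)
    ultimately show ?thesis using gen exp_not_eq_zero by metis
  qed
  ultimately show ?thesis by simp
qed

lemma arctan_integral_bound:
  assumes "0 < (a::real)" "0 \<le> X"
  obtains i where "((\<lambda>t. 1 / (1 + (t / a)\<^sup>2)) has_integral i) {- X..X}" "i \<le> pi * a"
proof -
  have "((\<lambda>t. 1 / (1 + (t / a)\<^sup>2)) has_integral (a * arctan (X / a) - a * arctan (- X / a))) {- X..X}"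
  proof (rule fundamental_theorem_of_calculus)
    fix t assume "t \<in> {- X..X}"
    have "((\<lambda>t. a * arctan (t / a)) has_real_derivative a * (inverse (1 + (t / a)\<^sup>2) * (1 / a))) (at t)"
      using assms by (intro DERIV_cmult DERIV_chain2[OF DERIV_arctan]) (auto intro!: derivative_eq_intros)
    moreover have "a * (inverse (1 + (t / a)\<^sup>2) * (1 / a)) = 1 / (1 + (t / a)\<^sup>2)"
      using assms by (simp add: divide_inverse)
    ultimately show "((\<lambda>t. a * arctan (t / a)) has_vector_derivative 1 / (1 + (t / a)\<^sup>2)) (at t within {- X..X})"
      by (simp add: has_real_derivative_iff_has_vector_derivative has_vector_derivative_at_within)
  qed (use assms in auto)
  moreover have "a * arctan (X / a) - a * arctan (- X / a) \<le> pi * a"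
  proof -
    have "arctan (X / a) \<le> pi / 2" "- (pi / 2) \<le> arctan (- X / a)"
      using arctan_ubound[of "X / a"] arctan_lbound[of "- X / a"] by linarith+
    then have "arctan (X / a) - arctan (- X / a) \<le> pi" by linarith
    then have "a * (arctan (X / a) - arctan (- X / a)) \<le> a * pi" using assms by (intro mult_left_mono) auto
    then show ?thesis by (simp add: algebra_simps)
  qed
  ultimately show ?thesis using that by blast
qed

text \<open>The integrals for \<open>(n, r)\<close> and for \<open>(n m, r m)\<close> have the same kernel. Their factors differ by \<open>O(max T |t| / r)\<close>, also
outside \<open>[- \<pi> r, \<pi> r]\<close>, where the first one is read as \<open>0\<close> and \<open>|t| / r \<ge> \<pi>\<close>. The resulting bound does not involve \<open>m\<close>,
and \<open>m\<close> tends to infinity. The majorant is chosen for its elementary integral, an arc tangent.\<close>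
lemma kappa_buchstab_path_bound:
  assumes A: "4 \<le> A"
  obtains C where "0 < C"
    "\<And>n r T K a. 0 < r \<Longrightarrow> r < n \<Longrightarrow> 1 < T \<Longrightarrow> T \<le> A * real r \<Longrightarrow> 0 \<le> K \<Longrightarrow> 0 < a \<Longrightarrow>
      (\<forall>t. path_weight (real n / real r) T t * max T \<bar>t\<bar> \<le> K / (1 + (t / a)\<^sup>2)) \<Longrightarrow>
      \<bar>kappa n r * exp (harm r) - exp euler_mascheroni * buchstab (real n / real r)\<bar> \<le> C * K * a / real r"
proof -
  obtain E where E: "0 < E"
    "\<And>n r T. 0 < r \<Longrightarrow> 1 < T \<Longrightarrow> T \<le> A * real r \<Longrightarrow>
      \<exists>\<phi>. ((\<lambda>t. path_kernel (real n / real r) T t * \<phi> t) has_integral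
            2 * of_real pi * \<i> * of_real (kappa n r * exp (harm r) - 1)) {- (pi * real r)..pi * real r}
        \<and> (\<forall>t. \<bar>t\<bar> \<le> pi * real r \<longrightarrow> norm (\<phi> t - 1) \<le> E * max T \<bar>t\<bar> / real r)"
    by (rule normalized_path_integral[OF A], rule that)
  define C where "C = 2 * E + 1"
  have main: "\<bar>kappa n r * exp (harm r) - exp euler_mascheroni * buchstab (real n / real r)\<bar> \<le> C * K * a / real r"
    if r: "0 < r" "r < n" and T: "1 < T" "T \<le> A * real r" and Ka: "0 \<le> K" "0 < a"
      and w: "\<forall>t. path_weight (real n / real r) T t * max T \<bar>t\<bar> \<le> K / (1 + (t / a)\<^sup>2)" for n r T K a
  proof -
    let ?v = "real n / real r"
    let ?k = "path_kernel ?v T"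
    let ?Y = "\<lambda>n r. kappa n r * exp (harm r) - 1"
    obtain \<phi> where \<phi>: "((\<lambda>t. ?k t * \<phi> t) has_integral
            2 * of_real pi * \<i> * of_real (?Y n r)) {- (pi * real r)..pi * real r}"
        "\<And>t. \<bar>t\<bar> \<le> pi * real r \<Longrightarrow> norm (\<phi> t - 1) \<le> E * max T \<bar>t\<bar> / real r"
      using E(2)[OF r(1) T, of n] by blast
    have step: "\<bar>?Y (n * Suc m) (r * Suc m) - ?Y n r\<bar> \<le> C * K * a / real r" for m
    proof -
      let ?M = "real (r * Suc m)"
      have rM: "real r \<le> ?M" by (simp del: of_nat_Suc mult_Suc_right add: mult_le_cancel_left1)
      have T': "T \<le> A * ?M"
      proof -
        have "A * real r \<le> A * ?M" using A rM by (intro mult_left_mono) auto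
        then show ?thesis using T by linarith
      qed
      have q: "real (n * Suc m) / ?M = ?v" using r by (simp del: of_nat_Suc mult_Suc_right)
      obtain \<psi> where \<psi>: "((\<lambda>t. ?k t * \<psi> t) has_integral
            2 * of_real pi * \<i> * of_real (?Y (n * Suc m) (r * Suc m))) {- (pi * ?M)..pi * ?M}"
        "\<And>t. \<bar>t\<bar> \<le> pi * ?M \<Longrightarrow> norm (\<psi> t - 1) \<le> E * max T \<bar>t\<bar> / ?M"
        using E(2)[OF _ T(1) T', of "n * Suc m"] r unfolding q by auto
      \<comment> \<open>\<open>\<phi>\<close> is extended by zero, so that both integrals extend over the same interval.\<close>
      define \<theta> where "\<theta> t = (if t \<in> {- (pi * real r)..pi * real r} then \<phi> t else 0)" for t
      have sub: "{- (pi * real r)..pi * real r} \<subseteq> {- (pi * ?M)..pi * ?M}"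
        using rM by (auto intro: order_trans simp del: of_nat_mult)
      have "((\<lambda>t. if t \<in> {- (pi * real r)..pi * real r} then ?k t * \<phi> t else 0) has_integral
            2 * of_real pi * \<i> * of_real (?Y n r)) {- (pi * ?M)..pi * ?M}"
        by (rule iffD2[OF has_integral_restrict[OF sub] \<phi>(1)])
      then have "((\<lambda>t. ?k t * \<theta> t) has_integral
            2 * of_real pi * \<i> * of_real (?Y n r)) {- (pi * ?M)..pi * ?M}"
        by (rule has_integral_eq[rotated]) (simp add: \<theta>_def)
      from has_integral_diff[OF \<psi>(1) this]
      have I: "((\<lambda>t. ?k t * (\<psi> t - \<theta> t)) has_integral
          2 * of_real pi * \<i> * of_real (?Y (n * Suc m) (r * Suc m) - ?Y n r)) {- (pi * ?M)..pi * ?M}"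
        by (simp only: left_diff_distrib right_diff_distrib of_real_diff)
      have bd: "norm (?k t * (\<psi> t - \<theta> t)) \<le> 2 * C * K / real r * (1 / (1 + (t / a)\<^sup>2))"
        if t: "t \<in> {- (pi * ?M)..pi * ?M}" for t
      proof -
        let ?m = "max T \<bar>t\<bar>"
        have m0: "0 < ?m" using T by simp
        have "norm (\<psi> t - 1) \<le> E * ?m / ?M" using t by (intro \<psi>(2)) auto
        also have "\<dots> \<le> E * ?m / real r" 
        proof (intro divide_left_mono mult_pos_pos rM)
          show "0 < ?M" using rM r by linarith
        qed (use r E(1) m0 in auto)
        finally have p: "norm (\<psi> t - 1) \<le> E * ?m / real r" .
        have c: "norm (\<theta> t - 1) \<le> (E + 1) * ?m / real r"
        proof (cases "t \<in> {- (pi * real r)..pi * real r}")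
          case True
          then have "\<bar>t\<bar> \<le> pi * real r" by auto
          then have "norm (\<theta> t - 1) \<le> E * ?m / real r" using \<phi>(2)[of t] True by (simp add: \<theta>_def)
          also have "\<dots> \<le> (E + 1) * ?m / real r" using m0 by (intro divide_right_mono mult_right_mono) auto
          finally show ?thesis .
        next
          case False
          then have "pi * real r \<le> \<bar>t\<bar>" by auto
          moreover have "1 * real r \<le> pi * real r" using pi_gt3 by (intro mult_right_mono) auto
          ultimately have "real r \<le> ?m" by linarith
          then have "1 \<le> 1 * ?m / real r" using r by simp
          also have "\<dots> \<le> (E + 1) * ?m / real r" using E(1) m0 by (intro divide_right_mono mult_right_mono) auto
          finally have "norm (0 - 1 :: complex) \<le> (E + 1) * ?m / real r" by simp
          moreover have "\<theta> t = 0" using False unfolding \<theta>_def by (rule if_not_P)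
          ultimately show ?thesis by simp
        qed
        have "norm (\<psi> t - \<theta> t) \<le> norm (\<psi> t - 1) + norm (\<theta> t - 1)"
          using norm_triangle_ineq4[of "\<psi> t - 1" "\<theta> t - 1"] by simp
        also have "\<dots> \<le> E * ?m / real r + (E + 1) * ?m / real r" using p c by (rule add_mono)
        also have "\<dots> = C * ?m / real r" by (simp add: C_def add_divide_distrib[symmetric] algebra_simps)
        finally have pc: "norm (\<psi> t - \<theta> t) \<le> C * ?m / real r" .
        have "norm (?k t * (\<psi> t - \<theta> t)) \<le> 2 * path_weight ?v T t * (C * ?m / real r)"
          unfolding norm_mult
        proof (intro mult_mono order_refl pc norm_ge_zero norm_path_kernel_le T)
          show "0 \<le> 2 * path_weight ?v T t" by (simp add: path_weight_def)
        qed
        also have "\<dots> = (2 * C / real r) * (path_weight ?v T t * ?m)" by simp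
        also have "\<dots> \<le> (2 * C / real r) * (K / (1 + (t / a)\<^sup>2))"
          using w E(1) by (intro mult_left_mono) (auto simp: C_def)
        finally show ?thesis by simp
      qed
      have "0 \<le> pi * ?M" by simp
      then obtain i where i: "((\<lambda>t. 1 / (1 + (t / a)\<^sup>2)) has_integral i) {- (pi * ?M)..pi * ?M}" "i \<le> pi * a"
        using arctan_integral_bound[OF Ka(2)] by blast
      have "norm (2 * of_real pi * \<i> * of_real (?Y (n * Suc m) (r * Suc m) - ?Y n r)) \<le> (2 * C * K / real r * i) \<bullet> 1"
        by (rule has_integral_norm_bound_integral_component[OF I has_integral_mult_right[OF i(1)]])
           (use bd in simp)
      also have "\<dots> = 2 * C * K / real r * i" by simp
      also have "\<dots> \<le> 2 * C * K / real r * (pi * a)"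
        using i(2) Ka E(1) by (intro mult_left_mono) (auto simp: C_def)
      finally have "2 * pi * \<bar>?Y (n * Suc m) (r * Suc m) - ?Y n r\<bar> \<le> 2 * pi * (C * K * a / real r)"
        by (simp add: norm_mult mult_ac del: of_real_diff)
      then show ?thesis by (rule mult_left_le_imp_le) simp
    qed
    have "(\<lambda>m. \<bar>?Y (n * Suc m) (r * Suc m) - ?Y n r\<bar>) \<longlonglongrightarrow> \<bar>(exp euler_mascheroni * buchstab ?v - 1) - ?Y n r\<bar>"
      by (intro tendsto_rabs tendsto_diff tendsto_const kappa_refine_limit r)
    then have "\<bar>(exp euler_mascheroni * buchstab ?v - 1) - ?Y n r\<bar> \<le> C * K * a / real r"
      by (rule LIMSEQ_le_const2) (use step in blast)
    then show ?thesis by (simp add: abs_minus_commute)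
  qed
  have "0 < C" using E by (simp add: C_def)
  then show ?thesis by (rule that[OF _ main])
qed

section \<open>The saddle point\<close>

text \<open>By the mean value theorem two positive solutions would give, together with the solution \<open>0\<close>, two points at which the injective function
\<open>exp\<close> takes the value \<open>v\<close>.\<close>
lemma xi_unique:
  assumes "0 < a" "exp a = 1 + v * a" "0 < b" "exp b = 1 + v * (b::real)"
  shows "a = b"
proof -
  have False if ab: "0 < a" "a < b" "exp a = 1 + v * a" "exp b = 1 + v * b" for a b :: real
  proof -
    have "\<exists>z. 0 < z \<and> z < a \<and> exp a - exp 0 = (a - 0) * exp z"
      using ab by (intro MVT2) (auto intro!: derivative_eq_intros)
    then obtain z where z: "0 < z" "z < a" "exp a - 1 = a * exp z" by auto
    have "\<exists>y. a < y \<and> y < b \<and> exp b - exp a = (b - a) * exp y"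
      using ab by (intro MVT2) (auto intro!: derivative_eq_intros)
    then obtain y where y: "a < y" "y < b" "exp b - exp a = (b - a) * exp y" by auto
    have "exp z = v" using z ab by simp
    moreover have "exp y = v" 
    proof -
      have "(b - a) * exp y = (b - a) * v" using y ab by (simp add: algebra_simps)
      then show ?thesis using ab by simp
    qed
    ultimately have "exp z = exp y" by simp
    then show False using z y by simp
  qed
  from this[of a b] this[of b a] show ?thesis using assms by (cases a b rule: linorder_cases) auto
qed

lemma xi_exists:
  assumes "1 < v"
  shows "\<exists>x. 0 < x \<and> exp x = 1 + v * (x::real)"
proof -
  let ?h = "\<lambda>x::real. exp x - 1 - v * x"
  have l: "?h (ln v) \<le> 0"
  proof -
    have "ln v \<ge> 1 - 1 / v"
    proof -
      have "ln (1 / v) \<le> 1 / v - 1" using assms by (intro ln_le_minus_one) auto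
      then show ?thesis using assms by (simp add: ln_div)
    qed
    then have "v * ln v \<ge> v * (1 - 1 / v)" using assms by simp
    then show ?thesis using assms by (simp add: algebra_simps)
  qed
  have u: "?h (2 * v) \<ge> 0"
  proof -
    have "1 + 2 * v + (2 * v)\<^sup>2 / 2 \<le> exp (2 * v)"
      using assms by (intro exp_lower_Taylor_quadratic) auto
    then show ?thesis using assms by (simp add: power2_eq_square)
  qed
  have "ln v \<le> 2 * v" using assms ln_le_minus_one[of v] by simp
  then have "\<exists>x\<ge>ln v. x \<le> 2 * v \<and> ?h x = 0"
    using l u by (intro IVT') (auto intro!: continuous_intros)
  then obtain x where "x \<ge> ln v" "exp x - 1 - v * x = 0" by auto
  moreover have "ln v > 0" using assms by simp
  ultimately show ?thesis by (intro exI[of _ x]) auto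
qed

lemma xi_pos: "1 < v \<Longrightarrow> 0 < xi v"
  and exp_xi: "1 < v \<Longrightarrow> exp (xi v) = 1 + v * xi v"
proof -
  assume "1 < v"
  then have "\<exists>!x. 0 < x \<and> exp x = 1 + v * x" using xi_exists xi_unique by blast
  from theI'[OF this] show "0 < xi v" "exp (xi v) = 1 + v * xi v" by (simp_all add: xi_def)
qed

lemma xi_le:
  assumes "1 < v"
  shows "xi v \<le> 2 * v"
proof -
  have "1 + xi v + (xi v)\<^sup>2 / 2 \<le> exp (xi v)"
    using xi_pos[OF assms] by (intro exp_lower_Taylor_quadratic) auto
  then have "xi v * (xi v / 2) \<le> xi v * (v - 1)"
    unfolding exp_xi[OF assms] by (simp add: power2_eq_square algebra_simps)
  then show ?thesis using xi_pos[OF assms] by simp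
qed

lemma ln_le_xi:
  assumes "1 < v"
  shows "ln v \<le> xi v"
proof (rule ccontr)
  assume "\<not> ln v \<le> xi v"
  then have lt: "xi v < ln v" by simp
  have "\<exists>z. 0 < z \<and> z < xi v \<and> exp (xi v) - exp 0 = (xi v - 0) * exp z"
    using xi_pos[OF assms] by (intro MVT2) (auto intro!: derivative_eq_intros)
  then obtain z where z: "0 < z" "z < xi v" "exp (xi v) - 1 = xi v * exp z" by auto
  have "exp z = v" using z exp_xi[OF assms] by simp
  then have "z = ln v" by (metis ln_exp)
  then show False using z lt by simp
qed

lemma xi_le_2_ln:
  assumes "16 \<le> v"
  shows "xi v \<le> 2 * ln v"
proof (rule ccontr)
  assume "\<not> xi v \<le> 2 * ln v"
  then have lt: "2 * ln v < xi v" by simp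
  have v: "1 < v" using assms by simp
  have "\<exists>z. 0 < z \<and> z < 2 * ln v \<and> exp (2 * ln v) - exp 0 = (2 * ln v - 0) * exp z"
    using v by (intro MVT2) (auto intro!: derivative_eq_intros)
  then obtain z where z: "0 < z" "z < 2 * ln v" "exp (2 * ln v) - 1 = 2 * ln v * exp z" by auto
  have "\<exists>y. 2 * ln v < y \<and> y < xi v \<and> exp (xi v) - exp (2 * ln v) = (xi v - 2 * ln v) * exp y"
    using lt by (intro MVT2) (auto intro!: derivative_eq_intros)
  then obtain y where y: "2 * ln v < y" "y < xi v" "exp (xi v) - exp (2 * ln v) = (xi v - 2 * ln v) * exp y" by auto
  have "exp (2 * ln v) = v\<^sup>2" using v by (simp add: exp_double)
  have "ln v \<le> v / 4"
  proof -
    have "ln (v / 16) \<le> v / 16 - 1" using assms by (intro ln_le_minus_one) auto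
    moreover have "ln v = ln (v / 16) + 4 * ln 2"
    proof -
      have "ln v - ln 16 = ln (v / 16)" using v by (simp add: ln_div)
      moreover have "ln (16::real) = 4 * ln 2" using ln_realpow[of 2 4] by simp
      ultimately show ?thesis by simp
    qed
    ultimately show ?thesis using ln2_le_25_over_36 assms by linarith
  qed
  then have "2 * (v * ln v) \<le> v * v / 2" using v by (simp add: mult.commute)
  moreover have "v * v \<ge> 16 * 16" using assms by (intro mult_mono) auto
  moreover have "(xi v - 2 * ln v) * exp y \<ge> (xi v - 2 * ln v) * v"
  proof (intro mult_left_mono)
    have "v = exp (ln v)" using v by simp
    also have "\<dots> \<le> exp y" using y v ln_gt_zero[OF v] unfolding exp_le_cancel_iff by linarith
    finally show "v \<le> exp y" .
  qed (use lt in auto)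
  moreover have "exp (xi v) = 1 + v * xi v" by (rule exp_xi[OF v])
  ultimately show False using y(3) \<open>exp (2 * ln v) = v\<^sup>2\<close>
    unfolding power2_eq_square by (simp add: algebra_simps)
qed

text \<open>The equation says \<open>exp z = - (v z - 1)\<close>, so \<open>z\<close> is a logarithm of \<open>v z - 1\<close> plus an odd multiple of \<open>i \<pi>\<close>; in the
disc the imaginary part of \<open>z\<close> lies in \<open>[- 2 \<pi>, 0]\<close>, which leaves only \<open>- i \<pi>\<close>.\<close>
lemma zeta0_equation_iff_Ln:
  fixes z :: complex
  assumes v: "1 < v" and z: "norm (z - of_real (xi v) + \<i> * of_real pi) \<le> pi" and xi: "2 * pi \<le> xi v"
  shows "exp z = 1 - of_real v * z \<longleftrightarrow> z = Ln (of_real v * z - 1) - \<i> * of_real pi"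
proof -
  have "\<bar>Re (z - of_real (xi v) + \<i> * of_real pi)\<bar> \<le> pi" "\<bar>Im (z - of_real (xi v) + \<i> * of_real pi)\<bar> \<le> pi"
    using z abs_Re_le_cmod abs_Im_le_cmod order_trans by blast+
  then have re: "Re z \<ge> pi" and im: "- 2 * pi \<le> Im z" "Im z \<le> 0" using xi by auto
  let ?y = "of_real v * z - 1"
  have "v * Re z > 1 * 1" using v re pi_gt3 by (intro mult_strict_mono) auto
  then have rey: "Re ?y > 0" by simp
  then have y0: "?y \<noteq> 0" by (metis less_irrefl zero_complex.sel(1))
  have imL: "\<bar>Im (Ln ?y)\<bar> < pi / 2" using rey Re_Ln_pos_lt[OF y0] by simp
  have e: "exp (Ln ?y - \<i> * of_real pi) = 1 - of_real v * z"
    using y0 exp_minus[of "\<i> * of_real pi"] by (simp add: exp_diff)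
  show ?thesis
  proof
    assume "z = Ln ?y - \<i> * of_real pi"
    then show "exp z = 1 - of_real v * z" using e by simp
  next
    assume "exp z = 1 - of_real v * z"
    then have "exp z = exp (Ln ?y - \<i> * of_real pi)" using e by simp
    then obtain n :: int where n: "z = Ln ?y - \<i> * of_real pi + (of_int (2 * n) * pi) * \<i>"
      unfolding exp_eq by blast
    have "Im z = Im (Ln ?y) - pi + 2 * (real_of_int n * pi)"
      using arg_cong[OF n, of Im] by simp
    then have "real_of_int n * pi < 1 * pi" "(- 1) * pi < real_of_int n * pi"
      using im imL pi_gt3 by linarith+
    then have "real_of_int n < 1" "real_of_int n > - 1"
      using pi_gt_zero mult_less_cancel_right_pos by blast+
    then have "n = 0" by linarith
    then show "z = Ln ?y - \<i> * of_real pi" using n by simp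
  qed
qed

text \<open>The map \<open>z \<mapsto> Ln (v z - 1) - i \<pi>\<close> is a contraction of the disc, as its derivative \<open>v / (v z - 1)\<close> is small for
large \<open>Re z\<close>. It moves the disc close to its centre \<open>xi v - i \<pi>\<close>, because \<open>xi v = ln (1 + v xi v)\<close>.\<close>
lemma zeta0_exists_unique_near:
  assumes "0 < e" "e \<le> pi"
  shows "\<exists>V>1. \<forall>v\<ge>V. (\<exists>!z. is_zeta0 v z) \<and>
    (\<forall>z. is_zeta0 v z \<longrightarrow> norm (z - of_real (xi v) + \<i> * of_real pi) \<le> e)"
proof -
  define d where "d = min e 1"
  define V where "V = exp (2 * (2 * pi + 2) / d + 10)"
  have d: "0 < d" "d \<le> 1" "d \<le> e" using assms by (auto simp: d_def)
  have V1: "V > 1" unfolding V_def using d by (simp add: add_nonneg_pos)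
  show ?thesis
  proof (intro exI[of _ V] conjI allI V1 impI)
    fix v assume vV: "V \<le> v"
    have v: "1 < v" using V1 vV by simp
    let ?x = "xi v"
    have xiL: "?x \<ge> 2 * (2 * pi + 2) / d + 10"
    proof -
      have "2 * (2 * pi + 2) / d + 10 = ln V" by (simp add: V_def)
      also have "\<dots> \<le> ln v" using V1 vV by simp
      also have "\<dots> \<le> ?x" by (rule ln_le_xi[OF v])
      finally show ?thesis .
    qed
    let ?c = "of_real ?x - \<i> * of_real pi :: complex"
    let ?T = "\<lambda>z. Ln (of_real v * z - 1) - \<i> * of_real pi"
    have "2 * (2 * pi + 2) / d \<le> ?x" using xiL by linarith
    then have xe: "(2 * pi + 2) * 2 \<le> d * ?x" using d by (simp add: field_simps)
    also have "d * ?x \<le> 1 * ?x" using d xi_pos[OF v] by (intro mult_right_mono) auto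
    finally have "4 * pi + 4 \<le> ?x" by simp
    moreover have "0 \<le> pi" by simp
    ultimately have xi2: "2 * pi \<le> ?x" by (smt (verit))
    have rez: "Re z \<ge> pi" if "z \<in> cball ?c pi" for z
    proof -
      have "\<bar>Re (?c - z)\<bar> \<le> pi"
        using that abs_Re_le_cmod[of "?c - z"] by (simp add: dist_norm)
      then show ?thesis using xi2 by auto
    qed
    have rey: "Re (of_real v * z - 1) \<ge> 2 * v" if "z \<in> cball ?c pi" for z
    proof -
      have "v * Re z \<ge> v * 3" using v rez[OF that] pi_gt3 by (intro mult_left_mono) auto
      then have "v * Re z - 1 \<ge> 2 * v" using v by linarith
      then show ?thesis by simp
    qed
    have Tnear: "norm (?T z - ?c) \<le> e" if z: "z \<in> cball ?c pi" for z
    proof -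
      let ?q = "(of_real v * z - 1) / of_real (exp ?x)"
      have "Ln ?q = Ln (of_real v * z - 1) - of_real (ln (exp ?x))"
      proof (intro Ln_divide_of_real)
        show "of_real v * z - 1 \<noteq> 0" using rey[OF z] v by (metis less_irrefl mult_pos_pos order_less_le_trans zero_complex.sel(1) zero_less_numeral zero_less_one order.strict_trans)
      qed simp
      then have eq: "?T z - ?c = Ln (1 + (?q - 1))" by simp
      have "?q - 1 = (of_real v * (z - of_real ?x) - 2) / of_real (exp ?x)"
      proof -
        have nz: "of_real (exp ?x) \<noteq> (0::complex)" by simp
        have "of_real (exp ?x) = (1 + of_real v * of_real ?x :: complex)"
          unfolding exp_xi[OF v] by simp
        then have "of_real v * z - 1 - of_real (exp ?x) = of_real v * (z - of_real ?x) - 2"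
          by (simp add: algebra_simps)
        then show ?thesis using nz by (metis diff_divide_distrib divide_self)
      qed
      also have "norm \<dots> \<le> (v * (2 * pi) + 2) / exp ?x"
      proof -
        have zx: "norm (z - of_real ?x) \<le> 2 * pi"
        proof -
          have "norm (z - of_real ?x) = norm ((z - ?c) - \<i> * of_real pi)" by (simp add: algebra_simps)
          also have "\<dots> \<le> norm (z - ?c) + norm (\<i> * of_real pi :: complex)" by (rule norm_triangle_ineq4)
          also have "\<dots> \<le> 2 * pi" using z by (simp add: dist_norm norm_mult norm_minus_commute)
          finally show ?thesis .
        qed
        have "norm (of_real v * (z - of_real ?x) - 2) \<le> v * norm (z - of_real ?x) + 2"
          using norm_triangle_ineq4[of "of_real v * (z - of_real ?x)" 2] v by (simp add: norm_mult)
        also have "\<dots> \<le> v * (2 * pi) + 2" using zx v by simp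
        finally show ?thesis
          by (simp add: norm_divide divide_right_mono flip: of_real_exp)
      qed
      finally have q: "norm (?q - 1) \<le> (v * (2 * pi) + 2) / exp ?x" .
      have "2 * (v * (2 * pi) + 2) \<le> v * ((2 * pi + 2) * 2)" using v by (simp add: algebra_simps)
      also have "\<dots> \<le> v * (d * ?x)" using xe v by (intro mult_left_mono) auto
      also have "\<dots> < d * exp ?x" using d exp_xi[OF v] by (simp add: algebra_simps)
      finally have "(v * (2 * pi) + 2) / exp ?x < d / 2" by (simp add: field_simps)
      with q have q2: "norm (?q - 1) < d / 2" by linarith
      then have "norm (Ln (1 + (?q - 1))) \<le> 2 * norm (?q - 1)" using d by (intro norm_Ln_le) linarith
      then show ?thesis unfolding eq using q2 d by linarith
    qed
    have lip: "dist (?T x) (?T y) \<le> 1 / 2 * dist x y" if "x \<in> cball ?c pi" "y \<in> cball ?c pi" for x y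
      unfolding dist_norm
    proof (rule field_differentiable_bound[OF convex_cball _ _ that(1) that(2)])
      fix z assume z: "z \<in> cball ?c pi"
      have nz: "of_real v * z - 1 \<notin> \<real>\<^sub>\<le>\<^sub>0" using rey[OF z] v by (auto simp: complex_nonpos_Reals_iff)
      show "(?T has_field_derivative of_real v / (of_real v * z - 1)) (at z within cball ?c pi)"
        using nz by (auto intro!: derivative_eq_intros simp: divide_inverse)
      have "2 * v \<le> norm (of_real v * z - 1)" using rey[OF z] complex_Re_le_cmod order_trans by blast
      then show "norm (of_real v / (of_real v * z - 1)) \<le> 1 / 2" using v
        by (simp add: norm_divide divide_simps)
    qed
    have mem: "z \<in> cball ?c pi \<longleftrightarrow> norm (z - of_real ?x + \<i> * of_real pi) \<le> pi" for z
      by (simp add: dist_norm norm_minus_commute algebra_simps)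
    have fp: "is_zeta0 v z \<longleftrightarrow> z \<in> cball ?c pi \<and> ?T z = z" for z
      unfolding is_zeta0_def mem using zeta0_equation_iff_Ln[OF v _ xi2, of z] by metis
    have "\<exists>!z\<in>cball ?c pi. ?T z = z"
    proof (rule Banach_fix)
      show "?T ` cball ?c pi \<subseteq> cball ?c pi"
      proof (rule image_subsetI)
        fix z assume "z \<in> cball ?c pi"
        then have "norm (?T z - ?c) \<le> pi" using Tnear[of z] assms by linarith
        then show "?T z \<in> cball ?c pi" by (simp only: mem_cball dist_norm norm_minus_commute)
      qed
      show "dist (?T x) (?T y) \<le> 1 / 2 * dist x y" if "x \<in> cball ?c pi" "y \<in> cball ?c pi" for x y
        using lip that by blast
    qed (auto intro: closed_cball simp: complete_eq_closed)
    then show "\<exists>!z. is_zeta0 v z" unfolding fp by blast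
    fix z assume "is_zeta0 v z"
    then have "norm (?T z - ?c) \<le> e" "?T z = z" using Tnear[of z] fp by blast+
    then show "norm (z - of_real ?x + \<i> * of_real pi) \<le> e" by (simp add: algebra_simps)
  qed
qed

section \<open>The weight along the path through the saddle point\<close>

text \<open>Here \<open>z\<close> is the conjugate of the saddle point and \<open>w\<close> the modulus of \<open>exp (- I z) / z\<close>. For \<open>|t| \<le> 3 x\<close> the modulus on
the vertical line is at most \<open>exp 2 * w\<close>. Farther up the line the crude bound has the exponent \<open>exp x / (3 x)\<close>, while \<open>w\<close> has an
exponent of at least about \<open>exp x / (2 x)\<close>; this gap pays for all powers of \<open>exp x\<close>. On the bent part the
factor \<open>|t| powr (1 - v)\<close> beats the polynomial growth as soon as \<open>v \<ge> 4\<close>.\<close>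
lemma path_weight_bound:
  fixes v x t0 :: real
  defines "z \<equiv> Complex x t0"
  defines "w \<equiv> exp (log_growth x t0) / norm z"
  assumes v: "4 \<le> v" and x: "8 \<le> x"
    and big: "\<bar>log_growth 0 1\<bar> + \<bar>log_growth 4 pi - exp 4 / 8\<bar> + 5 * x + 3 \<le> exp x / (6 * x)"
    and t0: "pi \<le> t0" "t0 \<le> pi + pi / 3"
    and eq: "exp z = 1 - of_real v * z"
  shows "path_weight v (exp x) t * max (exp x) \<bar>t\<bar> \<le> 2 * exp 2 * w * exp ((1 - v) * x) / (1 + (t / (3 * x))\<^sup>2)"
proof -
  let ?c = "\<bar>log_growth 0 1\<bar>" and ?d = "\<bar>log_growth 4 pi - exp 4 / 8\<bar>"
  have z0: "z \<noteq> 0" using x by (auto simp: z_def complex_eq_iff)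
  have nz: "norm z = sqrt (x\<^sup>2 + t0\<^sup>2)" by (simp add: z_def cmod_def)
  then have nz2: "(norm z)\<^sup>2 = x\<^sup>2 + t0\<^sup>2" by simp
  have zs: "x \<le> norm z" using complex_Re_le_cmod[of z] by (simp add: z_def)
  have z2s: "norm z \<le> 2 * x"
  proof -
    have "norm z \<le> \<bar>Re z\<bar> + \<bar>Im z\<bar>" by (rule cmod_le)
    also have "\<dots> = x + t0" using x t0 pi_gt3 by (simp add: z_def)
    finally show ?thesis using t0 x pi_less_4 by linarith
  qed
  have q: "expm1_div z = - of_real v" using z0 eq by (simp add: expm1_div_def)
  have crit: "exp x * (x * sin t0 - t0 * cos t0) + t0 = 0"
  proof -
    have "(exp x * (x * sin t0 - t0 * cos t0) + t0) / (x\<^sup>2 + t0\<^sup>2) = Im (expm1_div z)"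
      unfolding z_def using x by (subst Im_expm1_div) auto
    also have "\<dots> = 0" by (simp add: q)
    finally show ?thesis using z0 unfolding nz2[symmetric] by simp
  qed
  define N where "N = (\<lambda>t. sqrt (x\<^sup>2 + t\<^sup>2) + x * cos t + t * sin t)"
  define D where "D = (\<lambda>t. x\<^sup>2 + t\<^sup>2 - x)"
  have N_pos: "0 \<le> N t" for t using abs_x_cos_plus_t_sin_le[of x t] unfolding N_def by linarith
  have D_pos: "0 < D t" for t
  proof -
    have "8 * x \<le> x * x" using x by (intro mult_right_mono) auto
    then show ?thesis unfolding D_def power2_eq_square using x zero_le_square[of t] by linarith
  qed
  \<comment> \<open>At the saddle point \<open>exp z / z = 1 / z - v\<close> is almost a negative real number, so \<open>1 + cos \<psi>\<close> is tiny there.\<close>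
  have damp: "exp x * (N t0 / D t0) \<le> 2"
  proof -
    let ?f = "exp z / z"
    have f: "?f = 1 / z - of_real v" using z0 by (simp add: eq field_simps)
    have f1: "norm ?f = exp x / norm z" by (simp add: norm_divide z_def)
    have f2: "Re ?f = exp x * (x * cos t0 + t0 * sin t0) / (norm z)\<^sup>2"
      unfolding nz2 by (simp add: Re_divide z_def Re_exp Im_exp algebra_simps)
    have "norm ?f \<le> norm (1 / z) + v"
      unfolding f using norm_triangle_ineq4[of "1 / z" "of_real v"] v by simp
    moreover have "Re ?f \<le> norm (1 / z) - v" unfolding f using complex_Re_le_cmod[of "1 / z"] by simp
    ultimately have "norm ?f + Re ?f \<le> 2 / norm z" by (simp add: norm_divide)
    then have "(norm z)\<^sup>2 * (norm ?f + Re ?f) \<le> (norm z)\<^sup>2 * (2 / norm z)" by (intro mult_left_mono) auto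
    moreover have "(norm z)\<^sup>2 * (norm ?f + Re ?f) = exp x * N t0"
      unfolding f1 f2 N_def nz[symmetric] using z0 by (simp add: field_simps power2_eq_square)
    moreover have "(norm z)\<^sup>2 * (2 / norm z) = 2 * norm z" using z0 by (simp add: power2_eq_square)
    ultimately have "exp x * N t0 \<le> 2 * norm z" by simp
    also have "\<dots> \<le> 2 * D t0"
    proof -
      have "2 * norm z \<le> norm z * norm z" using zs x by (intro mult_right_mono) auto
      moreover have "D t0 = norm z * norm z - x" unfolding D_def nz2[symmetric] by (simp add: power2_eq_square)
      ultimately show ?thesis using zs by linarith
    qed
    finally show ?thesis using D_pos[of t0] by (simp add: divide_le_eq)
  qed
  have vert: "exp (log_growth x t) / norm (Complex x t) \<le> exp 2 * w" if t: "0 \<le> t" for t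
  proof (cases "t \<le> t0")
    case True
    have "log_growth x t \<le> log_growth x t0"
      using x t True by (intro log_growth_le_critical[OF _ t0(2) crit]) auto
    then have "exp (log_growth x t) / norm (Complex x t) \<le> exp (log_growth x t0) / x"
      using x complex_Re_le_cmod[of "Complex x t"] by (intro frac_le) auto
    also have "\<dots> \<le> exp (log_growth x t0) / (norm z / 2)"
      using z2s z0 x by (intro divide_left_mono) auto
    also have "\<dots> = 2 * w" by (simp add: w_def)
    also have "\<dots> \<le> exp 2 * w"
      using exp_ge_add_one_self[of 2] by (intro mult_right_mono) (auto simp: w_def)
    finally show ?thesis .
  next
    case False
    have "log_growth x t - ln (x\<^sup>2 + t\<^sup>2) / 2 + exp x * (N t / D t)
       \<le> log_growth x t0 - ln (x\<^sup>2 + t0\<^sup>2) / 2 + exp x * (N t0 / D t0)"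
      unfolding N_def D_def using False x t0 pi_gt3 by (intro damped_log_growth_antimono) auto
    moreover have "0 \<le> exp x * (N t / D t)" using N_pos D_pos by (simp add: less_imp_le)
    ultimately have "log_growth x t - ln (x\<^sup>2 + t\<^sup>2) / 2 \<le> 2 + (log_growth x t0 - ln (x\<^sup>2 + t0\<^sup>2) / 2)"
      using damp by linarith
    then have "exp (log_growth x t - ln (x\<^sup>2 + t\<^sup>2) / 2) \<le> exp 2 * exp (log_growth x t0 - ln (x\<^sup>2 + t0\<^sup>2) / 2)"
      by (simp flip: exp_add)
    moreover have "exp (log_growth x y - ln (x\<^sup>2 + y\<^sup>2) / 2) = exp (log_growth x y) / norm (Complex x y)" for y
    proof -
      have p: "0 < x\<^sup>2 + y\<^sup>2" using x by (simp add: add_pos_nonneg)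
      then have "ln (x\<^sup>2 + y\<^sup>2) / 2 = ln (norm (Complex x y))" by (simp add: cmod_def ln_sqrt)
      moreover have "0 < norm (Complex x y)" using p by (simp add: cmod_def)
      ultimately show ?thesis by (simp add: exp_diff)
    qed
    ultimately show ?thesis by (simp add: w_def z_def)
  qed
  have w_big: "exp (exp x / (2 * x) - ?d - x) \<le> w"
  proof -
    have "exp x / (2 * x) - ?d \<le> log_growth x pi" using log_growth_at_pi[of x] x by linarith
    also have "\<dots> \<le> log_growth x t0"
      using x t0 by (intro log_growth_le_critical[OF _ t0(2) crit]) auto
    finally have 1: "exp (exp x / (2 * x) - ?d) \<le> exp (log_growth x t0)" by simp
    have "1 + x + x\<^sup>2 / 2 \<le> exp x" using x by (intro exp_lower_Taylor_quadratic) auto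
    moreover have "8 * x \<le> x\<^sup>2" using x unfolding power2_eq_square by (intro mult_right_mono) auto
    ultimately have "2 * x \<le> exp x" using x by linarith
    then have "norm z \<le> exp x" using z2s by linarith
    then have "exp (exp x / (2 * x) - ?d) / exp x \<le> exp (log_growth x t0) / norm z"
      using 1 z0 by (intro frac_le) auto
    then show ?thesis by (simp add: w_def exp_diff)
  qed
  have e6: "exp x / (2 * x) = 3 * (exp x / (6 * x))" "exp x / (3 * x) = 2 * (exp x / (6 * x))" by simp_all
  let ?K = "2 * exp 2 * w * exp ((1 - v) * x)"
  have w0: "0 < w" using z0 by (simp add: w_def)
  have main: "path_weight v (exp x) t * max (exp x) t \<le> ?K / (1 + (t / (3 * x))\<^sup>2)" if t: "0 \<le> t" for t
  proof -
    let ?q = "1 + (t / (3 * x))\<^sup>2"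
    have q1: "1 \<le> ?q" by simp
    then have q0: "0 < ?q" by linarith
    have qe: "?q \<le> exp (2 * c + 1)" if c: "t \<le> exp c" "0 \<le> c" for c
    proof -
      have "t / (3 * x) \<le> t / 1" using x t by (intro divide_left_mono) auto
      then have "(t / (3 * x))\<^sup>2 \<le> (exp c)\<^sup>2" using c t x by (intro power_mono) auto
      also have "(exp c)\<^sup>2 = exp (2 * c)" by (simp add: exp_double)
      finally have "?q \<le> 1 + exp (2 * c)" by simp
      also have "\<dots> \<le> 2 * exp (2 * c)" using c by simp
      also have "\<dots> \<le> exp 1 * exp (2 * c)" using exp_ge_add_one_self[of 1] by (intro mult_right_mono) auto
      finally show ?thesis by (simp add: exp_add mult.commute)
    qed
    consider "t \<le> 3 * x" "t \<le> exp x" | "3 * x < t" "t \<le> exp x" | "exp x < t" by linarith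
    then show ?thesis
    proof cases
      case 1
      have "(t / (3 * x))\<^sup>2 \<le> 1\<^sup>2" using 1 t x by (intro power_mono) auto
      then have q2: "?q \<le> 2" by simp
      have "path_weight v (exp x) t * max (exp x) t = exp (log_growth x t) / norm (Complex x t) * exp ((1 - v) * x)"
        using 1 t by (simp add: path_weight_def bent_line_def max_def algebra_simps flip: exp_add)
      also have "\<dots> \<le> exp 2 * w * exp ((1 - v) * x)" using vert[OF t] by (intro mult_right_mono) auto
      also have "\<dots> = ?K / 2" by simp
      also have "\<dots> \<le> ?K / ?q" using w0 by (intro divide_left_mono[OF q2] mult_pos_pos q0) auto
      finally show ?thesis .
    next
      case 2
      then have t1: "1 \<le> t" using x by linarith
      have lt: "ln t \<le> x" using 2 t1 by (metis less_le_trans ln_exp ln_le_cancel_iff zero_less_one exp_gt_zero)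
      have "exp x / t \<le> exp x / (3 * x)" using 2 x by (intro divide_left_mono) auto
      moreover have "x / t \<le> 1" using 2 x by simp
      ultimately have "(exp x + x) / t \<le> exp x / (3 * x) + 1" by (simp add: add_divide_distrib)
      then have lg: "log_growth x t \<le> ?c + 2 * x + exp x / (3 * x) + 1"
        using log_growth_crude[of x t] x t1 lt by linarith
      have qe: "?q \<le> exp (2 * x + 1)" using 2 x by (intro qe) auto
      have n1: "1 \<le> norm (Complex x t)" using complex_Re_le_cmod[of "Complex x t"] x by simp
      have "exp (log_growth x t) / norm (Complex x t) * ?q \<le> exp (log_growth x t) / 1 * exp (2 * x + 1)"
        using n1 qe q1 by (intro mult_mono divide_left_mono) auto
      also have "\<dots> = exp (log_growth x t + (2 * x + 1))" by (simp add: exp_add)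
      also have "\<dots> \<le> exp (exp x / (2 * x) - ?d - x)"
        unfolding exp_le_cancel_iff using lg big x unfolding e6 by linarith
      also have "\<dots> \<le> w" by (rule w_big)
      also have "\<dots> \<le> 2 * exp 2 * w" using w0 exp_ge_add_one_self[of 2] by (simp add: mult_le_cancel_right1)
      finally have "exp (log_growth x t) / norm (Complex x t) \<le> 2 * exp 2 * w / ?q"
        by (subst pos_le_divide_eq[OF q0])
      then have "exp (log_growth x t) / norm (Complex x t) * exp ((1 - v) * x) \<le> 2 * exp 2 * w / ?q * exp ((1 - v) * x)"
        by (intro mult_right_mono) auto
      moreover have "path_weight v (exp x) t * max (exp x) t = exp (log_growth x t) / norm (Complex x t) * exp ((1 - v) * x)"
        using 2 t by (simp add: path_weight_def bent_line_def max_def algebra_simps flip: exp_add)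
      ultimately show ?thesis by simp
    next
      case 3
      define y where "y = ln t"
      have t1: "1 < t" using 3 x one_le_exp_iff[of x] by linarith
      then have ty: "t = exp y" by (simp add: y_def)
      \<comment> \<open>On the bent part the abscissa is \<open>y = ln t\<close>.\<close>
      have y_x: "x < y" using 3 unfolding ty by simp
      have "y \<le> t" unfolding ty using exp_ge_add_one_self[of y] by linarith
      then have "(exp y + y) / t \<le> 2" using t1 by (simp add: ty[symmetric] divide_le_eq)
      then have lg: "log_growth y t \<le> ?c + 2 * y + 2"
        using log_growth_crude[of y t] y_x x t1 unfolding y_def[symmetric] by linarith
      have qe: "?q \<le> exp (2 * y + 1)" using ty y_x x by (intro qe) auto
      have nt: "t \<le> norm (Complex y t)" using abs_Im_le_cmod[of "Complex y t"] t by simp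
      have "exp (log_growth y t) / norm (Complex y t) * exp ((1 - v) * y) * ?q
          \<le> exp (log_growth y t) / exp y * exp ((1 - v) * y) * exp (2 * y + 1)"
      proof -
        have "0 < norm (Complex y t)" using nt t1 by linarith
        then show ?thesis using nt qe q1 t1 unfolding ty[symmetric]
          by (intro mult_mono divide_left_mono mult_nonneg_nonneg mult_pos_pos) auto
      qed
      also have "\<dots> = exp (log_growth y t - y + (1 - v) * y + (2 * y + 1))"
        by (simp only: exp_add exp_diff)
      also have "\<dots> \<le> exp ((exp x / (2 * x) - ?d - x) + (1 - v) * x)"
      proof -
        have "(4 - v) * y \<le> (4 - v) * x" using v y_x by (intro mult_left_mono_neg) auto
        then have "(1 - v) * y + 3 * y \<le> (1 - v) * x + 3 * x" by (simp add: algebra_simps)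
        then show ?thesis unfolding exp_le_cancel_iff using lg big x unfolding e6 by linarith
      qed
      also have "\<dots> = exp (exp x / (2 * x) - ?d - x) * exp ((1 - v) * x)" by (simp only: exp_add)
      also have "\<dots> \<le> (2 * exp 2 * w) * exp ((1 - v) * x)"
      proof (intro mult_right_mono)
        have "w \<le> 2 * exp 2 * w" using w0 exp_ge_add_one_self[of 2] by (simp add: mult_le_cancel_right1)
        then show "exp (exp x / (2 * x) - ?d - x) \<le> 2 * exp 2 * w" using w_big by linarith
      qed auto
      finally have "exp (log_growth y t) / norm (Complex y t) * exp ((1 - v) * y) \<le> ?K / ?q"
        by (subst pos_le_divide_eq[OF q0])
      moreover have "path_weight v (exp x) t * max (exp x) t = exp (log_growth y t) / norm (Complex y t) * exp ((1 - v) * y)"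
      proof -
        have m: "max (exp x) \<bar>t\<bar> = exp y" "max (exp x) t = exp y" using 3 t ty by auto
        show ?thesis unfolding path_weight_def bent_line_def m ln_exp by (simp add: algebra_simps flip: exp_add)
      qed
      ultimately show ?thesis by simp
    qed
  qed
  show ?thesis
  proof (cases "0 \<le> t")
    case True
    then show ?thesis using main[of t] by simp
  next
    case False
    have "path_weight v (exp x) t = path_weight v (exp x) (- t)"
      by (simp add: path_weight_def bent_line_def log_growth_minus cmod_def)
    then show ?thesis using main[of "- t"] False by simp
  qed
qed

section \<open>Assembling the estimate\<close>

definition saddle_amplitude :: "real \<Rightarrow> real" where
  "saddle_amplitude v = norm (exp (- of_real v * zeta0 v - I_fun (zeta0 v)) /
                 (zeta0 v * csqrt (2 * of_real pi * of_real v * (1 - 1 / zeta0 v))))"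

lemma R_fun_eq: "R_fun v1 v = (if v < v1 then 1 else saddle_amplitude v)"
  by (simp add: R_fun_def saddle_amplitude_def)

text \<open>\<open>0\<close> solves the equation but lies outside the disc; \<open>1\<close> does not solve it. Hence the denominator of
\<open>saddle_amplitude\<close> does not vanish.\<close>
lemma is_zeta0_nonzero:
  assumes v: "1 < v" and z: "is_zeta0 v z"
  shows "z \<noteq> 0" "z \<noteq> 1"
proof -
  show "z \<noteq> 0"
  proof
    assume "z = 0"
    then have "norm (Complex (- xi v) pi) \<le> pi"
      using z by (simp add: is_zeta0_def Complex_eq)
    then have "(norm (Complex (- xi v) pi))\<^sup>2 \<le> pi\<^sup>2" by (intro power_mono) auto
    then have "(xi v)\<^sup>2 \<le> 0" by (simp add: cmod_power2)
    then show False using xi_pos[OF v] by simp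
  qed
  show "z \<noteq> 1"
  proof
    assume "z = 1"
    then have "exp 1 = (1 - of_real v :: complex)" using z by (simp add: is_zeta0_def)
    then have "Re (exp 1) = Re (1 - of_real v :: complex)" by simp
    then have "exp 1 = 1 - v" by (simp add: Re_exp)
    then show False using v exp_gt_zero[of "1::real"] by linarith
  qed
qed

lemma saddle_denominator:
  assumes v: "1 < v" and z: "z \<noteq> 0" "z \<noteq> (1::complex)"
  shows "0 < norm (z * csqrt (2 * of_real pi * of_real v * (1 - 1 / z)))"
    "norm (z * csqrt (2 * of_real pi * of_real v * (1 - 1 / z))) \<le> 4 * sqrt v * (norm z + 1)"
proof -
  have "1 - 1 / z \<noteq> 0" using z by (simp add: field_simps)
  then show "0 < norm (z * csqrt (2 * of_real pi * of_real v * (1 - 1 / z)))" using v z by simp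
  let ?y = "norm (1 - 1 / z)"
  have y: "?y \<le> 1 + 1 / norm z" using norm_triangle_ineq4[of 1 "1 / z"] by (simp add: norm_divide)
  have "norm (2 * of_real pi * of_real v * (1 - 1 / z)) = 2 * pi * v * ?y" using v by (simp add: norm_mult)
  also have "\<dots> \<le> 16 * v * (1 + 1 / norm z)\<^sup>2"
  proof -
    have "1 + 1 / norm z \<le> (1 + 1 / norm z)\<^sup>2"
      unfolding power2_eq_square using mult_right_mono[of 1 "1 + 1 / norm z" "1 + 1 / norm z"] by simp
    then have "?y \<le> (1 + 1 / norm z)\<^sup>2" using y by linarith
    then show ?thesis using v pi_less_4 by (intro mult_mono) auto
  qed
  also have "\<dots> = (4 * sqrt v * (1 + 1 / norm z))\<^sup>2"
    using v by (simp add: power_mult_distrib)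
  finally have a: "norm (2 * of_real pi * of_real v * (1 - 1 / z)) \<le> (4 * sqrt v * (1 + 1 / norm z))\<^sup>2" .
  have "norm (csqrt (2 * of_real pi * of_real v * (1 - 1 / z))) \<le> 4 * sqrt v * (1 + 1 / norm z)"
  proof (rule power2_le_imp_le)
    show "(norm (csqrt (2 * of_real pi * of_real v * (1 - 1 / z))))\<^sup>2 \<le> (4 * sqrt v * (1 + 1 / norm z))\<^sup>2"
      using a by (simp only: norm_power[symmetric] power2_csqrt)
  qed (use v in auto)
  then have "norm z * norm (csqrt (2 * of_real pi * of_real v * (1 - 1 / z))) \<le> norm z * (4 * sqrt v * (1 + 1 / norm z))"
    by (intro mult_left_mono) auto
  also have "\<dots> = 4 * sqrt v * (norm z + 1)" using z by (simp add: field_simps)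
  finally show "norm (z * csqrt (2 * of_real pi * of_real v * (1 - 1 / z))) \<le> 4 * sqrt v * (norm z + 1)"
    by (simp only: norm_mult)
qed

lemma harm_rescale:
  assumes r: "0 < r" and b: "\<bar>kappa n r * exp (harm r) - exp euler_mascheroni * w\<bar> \<le> B / real r"
  shows "\<bar>kappa n r - exp (- harm r + euler_mascheroni) * w\<bar> \<le> B / (real r)\<^sup>2"
proof -
  have B: "0 \<le> B / real r" using b by linarith
  have "kappa n r - exp (- harm r + euler_mascheroni) * w
     = exp (- harm r) * (kappa n r * exp (harm r) - exp euler_mascheroni * w)"
  proof -
    have "exp (- harm r) * exp (harm r) = (1::real)" by (simp flip: exp_add)
    then have "kappa n r - exp (- harm r) * exp euler_mascheroni * w
       = (exp (- harm r) * exp (harm r)) * kappa n r - exp (- harm r) * exp euler_mascheroni * w" by simp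
    also have "\<dots> = exp (- harm r) * (kappa n r * exp (harm r) - exp euler_mascheroni * w)"
      by (simp only: right_diff_distrib mult_ac)
    finally show ?thesis unfolding exp_add .
  qed
  then have "\<bar>kappa n r - exp (- harm r + euler_mascheroni) * w\<bar> = exp (- harm r) * \<bar>kappa n r * exp (harm r) - exp euler_mascheroni * w\<bar>"
    by (simp add: abs_mult)
  also have "\<dots> \<le> (1 / real r) * (B / real r)"
  proof (intro mult_mono b)
    have "ln (real r) \<le> ln (real r + 1)" using r by simp
    also have "\<dots> \<le> harm r" by (rule ln_le_harm)
    finally have "exp (- harm r) \<le> exp (- ln (real r))" by simp
    also have "\<dots> = 1 / real r" using r by (simp add: exp_minus divide_inverse)
    finally show "exp (- harm r) \<le> 1 / real r" .
  qed (use r in auto)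
  finally show ?thesis by (simp add: power2_eq_square)
qed

text \<open>The path through the conjugate of the saddle point is used with \<open>T = exp (Re \<zeta>)\<close>, so that it bends where
\<open>|exp s|\<close> equals \<open>|Im s|\<close>.\<close>
lemma kappa_buchstab_large:
  obtains V C where "1 < V" "0 < C"
    "\<And>n r. 0 < r \<Longrightarrow> r < n \<Longrightarrow> sqrt (real n * ln (real n)) \<le> real r \<Longrightarrow> V \<le> real n / real r \<Longrightarrow>
      \<bar>kappa n r - exp (- harm r + euler_mascheroni) * buchstab (real n / real r)\<bar>
       \<le> C * (saddle_amplitude (real n / real r) * (real n / real r) powr (3/2) * (ln (real n / real r + 1))\<^sup>2) / (real r)\<^sup>2"
proof -
  let ?c = "\<bar>log_growth 0 1\<bar> + \<bar>log_growth 4 pi - exp 4 / 8\<bar>"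
  have "eventually (\<lambda>x::real. ?c + 5 * x + 3 \<le> exp x / (6 * x)) at_top" by real_asymp
  then obtain s1 where s1: "\<And>x. s1 \<le> x \<Longrightarrow> ?c + 5 * x + 3 \<le> exp x / (6 * x)"
    unfolding eventually_at_top_linorder by blast
  obtain V0 where V0: "1 < V0" "\<And>v. V0 \<le> v \<Longrightarrow> \<exists>!z. is_zeta0 v z"
    "\<And>v z. V0 \<le> v \<Longrightarrow> is_zeta0 v z \<Longrightarrow> norm (z - of_real (xi v) + \<i> * of_real pi) \<le> 1"
    using zeta0_exists_unique_near[of 1] pi_gt3 by auto
  obtain C0 where C0: "0 < C0"
    "\<And>n r T K a. 0 < r \<Longrightarrow> r < n \<Longrightarrow> 1 < T \<Longrightarrow> T \<le> 64 * real r \<Longrightarrow> 0 \<le> K \<Longrightarrow> 0 < a \<Longrightarrow>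
      (\<forall>t. path_weight (real n / real r) T t * max T \<bar>t\<bar> \<le> K / (1 + (t / a)\<^sup>2)) \<Longrightarrow>
      \<bar>kappa n r * exp (harm r) - exp euler_mascheroni * buchstab (real n / real r)\<bar> \<le> C0 * K * a / real r"
    by (rule kappa_buchstab_path_bound[of 64], simp, rule that)
  define V where "V = max V0 (max 16 (exp (max s1 8 + 2)))"
  define C where "C = 768 * C0 * exp 2"
  show ?thesis
  proof (rule that[of V C])
    show "1 < V" "0 < C" using V0 C0 by (simp_all add: V_def C_def)
    fix n r :: nat
    assume r: "0 < r" "r < n" and sq: "sqrt (real n * ln (real n)) \<le> real r" and Vv: "V \<le> real n / real r"
    define v where "v = real n / real r"
    have v: "V0 \<le> v" "16 \<le> v" "exp (max s1 8 + 2) \<le> v" using Vv by (auto simp: V_def v_def)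
    then have v1: "1 < v" by simp
    have lnv: "max s1 8 + 2 \<le> ln v" using v by (subst ln_ge_iff) auto
    define \<zeta> where "\<zeta> = zeta0 v"
    have \<zeta>: "is_zeta0 v \<zeta>" unfolding \<zeta>_def zeta0_def using V0(2)[OF v(1)] by (rule theI')
    have near: "norm (\<zeta> - of_real (xi v) + \<i> * of_real pi) \<le> 1" by (rule V0(3)[OF v(1) \<zeta>])
    define x where "x = Re \<zeta>"
    define t0 where "t0 = - Im \<zeta>"
    define z where "z = Complex x t0"
    have zc: "z = cnj \<zeta>" by (simp add: z_def x_def t0_def complex_eq_iff)
    have "\<bar>Re (\<zeta> - of_real (xi v) + \<i> * of_real pi)\<bar> \<le> 1" "\<bar>Im (\<zeta> - of_real (xi v) + \<i> * of_real pi)\<bar> \<le> 1"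
      using near abs_Re_le_cmod abs_Im_le_cmod order_trans by blast+
    then have x_xi: "\<bar>x - xi v\<bar> \<le> 1" and t0_pi: "\<bar>pi - t0\<bar> \<le> 1" by (simp_all add: x_def t0_def)
    have x: "s1 \<le> x" "8 \<le> x" using ln_le_xi[OF v1] lnv x_xi by linarith+
    have eqz: "exp z = 1 - of_real v * z"
    proof -
      have "exp \<zeta> = 1 - of_real v * \<zeta>" using \<zeta> by (simp add: is_zeta0_def)
      then have "cnj (exp \<zeta>) = cnj (1 - of_real v * \<zeta>)" by simp
      then show ?thesis by (simp add: zc exp_cnj)
    qed
    \<comment> \<open>The imaginary part of \<open>exp z = 1 - v z\<close> forces \<open>sin t0 < 0\<close>.\<close>
    have t0: "pi \<le> t0" "t0 \<le> pi + pi / 3"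
    proof -
      have "Im (exp z) = Im (1 - of_real v * z)" by (simp only: eqz)
      then have "exp x * sin t0 = - (v * t0)" by (simp add: z_def Im_exp)
      moreover have "0 < t0" using t0_pi pi_gt3 by linarith
      then have "0 < v * t0" using v1 by simp
      ultimately have "exp x * sin t0 < 0" by linarith
      then have "sin t0 < 0" by (simp add: mult_less_0_iff)
      then have "\<not> t0 \<le> pi" using sin_ge_zero[of t0] \<open>0 < t0\<close> by linarith
      then show "pi \<le> t0" by simp
      show "t0 \<le> pi + pi / 3" using t0_pi pi_gt3 by linarith
    qed
    have nz: "norm z = norm \<zeta>" by (simp add: zc)
    have z_x: "x \<le> norm \<zeta>" by (simp add: x_def complex_Re_le_cmod)
    define l where "l = ln (v + 1)"
    have l: "ln v \<le> l" "l \<le> 2 * ln v"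
    proof -
      show "ln v \<le> l" unfolding l_def using v1 by simp
      have "v + 1 \<le> v\<^sup>2" using v(2) unfolding power2_eq_square
        using mult_right_mono[of 2 v v] by linarith
      then have "ln (v + 1) \<le> ln (v\<^sup>2)" using v1 by (intro ln_mono) auto
      then show "l \<le> 2 * ln v" using v1 by (simp add: l_def ln_realpow)
    qed
    have z_le: "norm \<zeta> + 1 \<le> 4 * l"
    proof -
      have "norm \<zeta> \<le> \<bar>Re \<zeta>\<bar> + \<bar>Im \<zeta>\<bar>" by (rule cmod_le)
      also have "\<dots> = x + t0" using x t0 pi_gt3 by (simp add: x_def t0_def)
      also have "\<dots> \<le> (2 * ln v + 1) + (pi + 1)"
        using x_xi t0_pi xi_le_2_ln[OF v(2)] by linarith
      finally show ?thesis using l(1) lnv pi_less_4 by linarith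
    qed
    have T_le: "exp x \<le> 2 * v * norm \<zeta>"
    proof -
      have "exp x = norm (exp z)" by (simp add: z_def)
      also have "\<dots> \<le> 1 + v * norm \<zeta>"
        unfolding eqz nz[symmetric] using norm_triangle_ineq4[of 1 "of_real v * z"] v1 by (simp add: norm_mult)
      also have "\<dots> \<le> 2 * v * norm \<zeta>"
      proof -
        have "1 * 1 \<le> v * norm \<zeta>" using v1 z_x x by (intro mult_mono) auto
        then show ?thesis by simp
      qed
      finally show ?thesis .
    qed
    \<comment> \<open>Here the lower bound on \<open>r\<close> enters: \<open>r\<^sup>2 \<ge> n ln n \<ge> u r ln u\<close>.\<close>
    have Tr: "exp x \<le> 64 * real r"
    proof -
      have rv: "v * ln v \<le> real r"
      proof -
        have nvr: "real n = v * real r" using r by (simp add: v_def)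
        have "v * 1 \<le> v * real r" using v1 r by (intro mult_left_mono) auto
        then have "ln v \<le> ln (real n)" using nvr v1 by simp
        then have "real n * ln v \<le> real n * ln (real n)" by (intro mult_left_mono) auto
        also have "\<dots> \<le> (real r)\<^sup>2"
        proof -
          have "0 \<le> real n * ln (real n)" using r by simp
          then have "real n * ln (real n) = (sqrt (real n * ln (real n)))\<^sup>2" by simp
          also have "\<dots> \<le> (real r)\<^sup>2" using sq \<open>0 \<le> real n * ln (real n)\<close> by (intro power_mono) auto
          finally show ?thesis .
        qed
        finally have "real r * (v * ln v) \<le> real r * real r"
          unfolding nvr by (simp add: power2_eq_square mult_ac)
        then show ?thesis using r by simp
      qed
      have "2 * v * norm \<zeta> \<le> 2 * v * (8 * ln v)"
        using z_le l v1 by (intro mult_left_mono) auto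
      then show ?thesis using T_le rv by linarith
    qed
    define w where "w = exp (log_growth x t0) / norm z"
    define K where "K = 2 * exp 2 * w * exp ((1 - v) * x)"
    have "\<bar>kappa n r * exp (harm r) - exp euler_mascheroni * buchstab (real n / real r)\<bar> \<le> C0 * K * (3 * x) / real r"
    proof (rule C0(2)[OF r _ Tr])
      show "1 < exp x" "0 < 3 * x" using x by auto
      show "0 \<le> K" by (simp add: K_def w_def)
      show "\<forall>t. path_weight (real n / real r) (exp x) t * max (exp x) \<bar>t\<bar> \<le> K / (1 + (t / (3 * x))\<^sup>2)"
        unfolding K_def w_def v_def[symmetric] z_def
        using v x s1[OF x(1)] t0 eqz unfolding z_def by (intro allI path_weight_bound) auto
    qed
    also have "C0 * K * (3 * x) \<le> C * (saddle_amplitude v * v powr (3/2) * l\<^sup>2)"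
    proof -
      let ?M = "norm (exp (- of_real v * \<zeta> - I_fun \<zeta>))"
      have M: "?M = exp (log_growth x t0 - v * x)"
      proof -
        have "Re (I_fun \<zeta>) = Re (I_fun z)" unfolding zc I_fun_cnj by simp
        then show ?thesis by (simp add: log_growth_def z_def x_def)
      qed
      \<comment> \<open>The length \<open>3 x\<close> of the main part of the path is compensated by the denominator \<open>|z|\<close> in \<open>w\<close>.\<close>
      have wK: "K * x \<le> 2 * exp 2 * (?M * exp x)"
      proof -
        have z0: "0 < norm z" using z_x x nz by linarith
        have "w * x = exp (log_growth x t0) * (x / norm z)" by (simp add: w_def)
        also have "\<dots> \<le> exp (log_growth x t0) * 1"
          using z_x z0 unfolding nz by (intro mult_left_mono) (auto simp: divide_le_eq)
        finally have "w * x * exp ((1 - v) * x) \<le> exp (log_growth x t0) * exp ((1 - v) * x)"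
          by (intro mult_right_mono) auto
        also have "\<dots> = ?M * exp x" unfolding M by (simp add: algebra_simps flip: exp_add)
        finally have "2 * exp 2 * (w * x * exp ((1 - v) * x)) \<le> 2 * exp 2 * (?M * exp x)"
          by (intro mult_left_mono) auto
        then show ?thesis by (simp add: K_def mult_ac)
      qed
      have Ms: "?M \<le> saddle_amplitude v * (4 * sqrt v * (norm \<zeta> + 1))"
      proof -
        let ?den = "norm (\<zeta> * csqrt (2 * of_real pi * of_real v * (1 - 1 / \<zeta>)))"
        have den: "0 < ?den" "?den \<le> 4 * sqrt v * (norm \<zeta> + 1)"
          using saddle_denominator[OF v1 is_zeta0_nonzero[OF v1 \<zeta>]] by auto
        have "saddle_amplitude v = ?M / ?den" unfolding saddle_amplitude_def \<zeta>_def[symmetric] norm_divide ..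
        moreover have "?den \<noteq> 0" using den(1) by (rule less_imp_neq[symmetric])
        ultimately have "?M = saddle_amplitude v * ?den" by (metis nonzero_eq_divide_eq)
        also have "\<dots> \<le> saddle_amplitude v * (4 * sqrt v * (norm \<zeta> + 1))"
          using den by (intro mult_left_mono) (auto simp: saddle_amplitude_def)
        finally show ?thesis .
      qed
      have S0: "0 \<le> saddle_amplitude v" by (simp add: saddle_amplitude_def)
      have l0: "0 \<le> l" using l lnv by linarith
      have "?M * exp x \<le> (saddle_amplitude v * (4 * sqrt v * (4 * l))) * (2 * v * (4 * l))"
      proof (intro mult_mono)
        have "saddle_amplitude v * (4 * sqrt v * (norm \<zeta> + 1)) \<le> saddle_amplitude v * (4 * sqrt v * (4 * l))"
          using z_le S0 v1 by (intro mult_left_mono) auto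
        then show "?M \<le> saddle_amplitude v * (4 * sqrt v * (4 * l))" using Ms by linarith
        have "2 * v * norm \<zeta> \<le> 2 * v * (4 * l)" using z_le v1 by (intro mult_left_mono) auto
        then show "exp x \<le> 2 * v * (4 * l)" using T_le by linarith
      qed (use S0 v1 l0 in auto)
      also have "\<dots> = 128 * (saddle_amplitude v * (v * sqrt v) * l\<^sup>2)" by (simp add: power2_eq_square)
      also have "v * sqrt v = v powr (3/2)"
      proof -
        have "v powr (3/2) = v powr (1 + 1/2)" by simp
        also have "\<dots> = v powr 1 * v powr (1/2)" by (rule powr_add)
        finally show ?thesis using v1 by (simp add: powr_half_sqrt)
      qed
      finally have "2 * exp 2 * (?M * exp x) \<le> 2 * exp 2 * (128 * (saddle_amplitude v * v powr (3/2) * l\<^sup>2))"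
        by (rule mult_left_mono) simp
      with wK have "K * x \<le> 2 * exp 2 * (128 * (saddle_amplitude v * v powr (3/2) * l\<^sup>2))"
        by (rule order_trans)
      then have "3 * C0 * (K * x) \<le> 3 * C0 * (2 * exp 2 * (128 * (saddle_amplitude v * v powr (3/2) * l\<^sup>2)))"
        using C0(1) by (intro mult_left_mono) auto
      also have "\<dots> = (3 * 2 * 128 * C0 * exp 2) * (saddle_amplitude v * v powr (3/2) * l\<^sup>2)" by simp
      also have "\<dots> \<le> C * (saddle_amplitude v * v powr (3/2) * l\<^sup>2)"
        using S0 C0(1) by (intro mult_right_mono mult_nonneg_nonneg) (auto simp: C_def)
      finally show ?thesis by (simp add: mult_ac)
    qed
    finally have "\<bar>kappa n r * exp (harm r) - exp euler_mascheroni * buchstab (real n / real r)\<bar>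
       \<le> C * (saddle_amplitude v * v powr (3/2) * l\<^sup>2) / real r"
      by (simp add: divide_right_mono)
    from harm_rescale[OF r(1) this]
    show "\<bar>kappa n r - exp (- harm r + euler_mascheroni) * buchstab (real n / real r)\<bar>
       \<le> C * (saddle_amplitude (real n / real r) * (real n / real r) powr (3/2) * (ln (real n / real r + 1))\<^sup>2) / (real r)\<^sup>2"
      by (simp add: l_def v_def)
  qed
qed

lemma kappa_buchstab_small:
  obtains C where "0 < C"
    "\<And>n r. 0 < r \<Longrightarrow> r < n \<Longrightarrow> real n / real r \<le> U \<Longrightarrow>
       \<bar>kappa n r - exp (- harm r + euler_mascheroni) * buchstab (real n / real r)\<bar> \<le> C / (real r)\<^sup>2"
proof -
  obtain C where C: "0 < C"
    "\<And>n r. 0 < r \<Longrightarrow> r < n \<Longrightarrow> real n \<le> U * real r \<Longrightarrow> \<bar>real r * kappa n r - buchstab (real n / real r)\<bar> \<le> C / real r"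
    by (rule kappa_buchstab_bounded[of U], rule that)
  obtain L where L: "0 < L"
    "\<And>a b. 1 \<le> a \<Longrightarrow> a \<le> U \<Longrightarrow> 1 \<le> b \<Longrightarrow> b \<le> U \<Longrightarrow> \<bar>buchstab a - buchstab b\<bar> \<le> L * \<bar>a - b\<bar>"
    by (rule buchstab_lipschitz[of U], rule that)
  define B where "B = 1 + L * \<bar>U\<bar>"
  show ?thesis
  proof (rule that[of "C + 2 * B"])
    show "0 < C + 2 * B" using C L by (simp add: B_def add_pos_nonneg)
    fix n r :: nat assume r: "0 < r" "r < n" and u: "real n / real r \<le> U"
    let ?u = "real n / real r"
    have u1: "1 \<le> ?u" using r by simp
    have "\<bar>buchstab ?u - buchstab 1\<bar> \<le> L * \<bar>?u - 1\<bar>" using u u1 by (intro L(2)) auto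
    also have "\<dots> \<le> L * \<bar>U\<bar>" using u u1 L by (intro mult_left_mono) auto
    finally have wB: "\<bar>buchstab ?u\<bar> \<le> B" using buchstab_on_1_2[of 1] by (simp add: B_def)
    have "\<bar>real r * kappa n r - buchstab ?u\<bar> \<le> C / real r"
      using r u by (intro C(2)) (auto simp: divide_le_eq)
    moreover have "\<bar>(real r * exp (- harm r + euler_mascheroni) - 1) * buchstab ?u\<bar> \<le> 2 / real r * B"
      unfolding abs_mult using abs_exp_harm_diff_le[OF r(1)] wB by (intro mult_mono) auto
    moreover have "real r * (kappa n r - exp (- harm r + euler_mascheroni) * buchstab ?u) =
      (real r * kappa n r - buchstab ?u) - (real r * exp (- harm r + euler_mascheroni) - 1) * buchstab ?u"
      by (simp add: algebra_simps)
    ultimately have "\<bar>real r * (kappa n r - exp (- harm r + euler_mascheroni) * buchstab ?u)\<bar> \<le> C / real r + 2 / real r * B"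
      by linarith
    then have "real r * \<bar>kappa n r - exp (- harm r + euler_mascheroni) * buchstab ?u\<bar> \<le> (C + 2 * B) / real r"
      by (simp add: abs_mult add_divide_distrib)
    then show "\<bar>kappa n r - exp (- harm r + euler_mascheroni) * buchstab ?u\<bar> \<le> (C + 2 * B) / (real r)\<^sup>2"
      using r by (simp add: field_simps power2_eq_square)
  qed
qed

text \<open>On bounded ranges \<open>zeta0 v\<close> stays in a fixed disc, on which \<open>I_fun\<close> is bounded.\<close>
lemma R_fun_bounded_below:
  assumes v1: "admissible v1"
  obtains c where "0 < c" "\<And>v. 1 < v \<Longrightarrow> v \<le> U \<Longrightarrow> c \<le> R_fun v1 v"
proof -
  define Z where "Z = 2 * \<bar>U\<bar> + 2 * pi"
  have Z0: "0 \<le> Z" by (simp add: Z_def)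
  have "continuous_on (cball 0 Z) I_fun"
    using has_field_derivative_I_fun by (intro continuous_at_imp_continuous_on ballI) (blast intro: DERIV_isCont)
  then have "bounded (I_fun ` cball 0 Z)"
    by (intro compact_imp_bounded compact_continuous_image compact_cball)
  then obtain Y where Y: "0 < Y" "\<And>z. norm z \<le> Z \<Longrightarrow> norm (I_fun z) \<le> Y"
    unfolding bounded_pos by auto
  define c where "c = min 1 (exp (- (\<bar>U\<bar> * Z) - Y) / (4 * sqrt (\<bar>U\<bar> + 1) * (Z + 1)))"
  show ?thesis
  proof (rule that[of c])
    show "0 < c" using Z0 by (simp add: c_def add_nonneg_pos)
    fix v assume v: "1 < v" "v \<le> U"
    show "c \<le> R_fun v1 v"
    proof (cases "v < v1")
      case True
      then show ?thesis by (simp add: R_fun_eq c_def)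
    next
      case False
      then have "\<exists>!z. is_zeta0 v z" using v1 by (simp add: admissible_def)
      then have \<zeta>: "is_zeta0 v (zeta0 v)" unfolding zeta0_def by (rule theI')
      let ?z = "zeta0 v"
      have nz: "norm ?z \<le> Z"
      proof -
        have "norm ?z = norm ((?z - of_real (xi v) + \<i> * of_real pi) + (of_real (xi v) - \<i> * of_real pi))" by simp
        also have "\<dots> \<le> norm (?z - of_real (xi v) + \<i> * of_real pi) + norm (of_real (xi v) - \<i> * of_real pi :: complex)"
          by (rule norm_triangle_ineq)
        also have "norm (of_real (xi v) - \<i> * of_real pi :: complex) \<le> xi v + pi"
          using norm_triangle_ineq4[of "of_real (xi v) :: complex" "\<i> * of_real pi"] xi_pos[OF v(1)]
          by (simp add: norm_mult)
        finally show ?thesis using \<zeta> xi_le[OF v(1)] v by (simp add: is_zeta0_def Z_def)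
      qed
      let ?den = "norm (?z * csqrt (2 * of_real pi * of_real v * (1 - 1 / ?z)))"
      have den: "0 < ?den" "?den \<le> 4 * sqrt v * (norm ?z + 1)"
        using saddle_denominator[OF v(1) is_zeta0_nonzero[OF v(1) \<zeta>]] by auto
      have "4 * sqrt v * (norm ?z + 1) \<le> 4 * sqrt (\<bar>U\<bar> + 1) * (Z + 1)"
        using v nz Z0 by (intro mult_mono) auto
      with den have den': "?den \<le> 4 * sqrt (\<bar>U\<bar> + 1) * (Z + 1)" by linarith
      have "exp (- (\<bar>U\<bar> * Z) - Y) \<le> norm (exp (- of_real v * ?z - I_fun ?z))"
      proof -
        have "v * Re ?z \<le> v * norm ?z" using v complex_Re_le_cmod[of ?z] by (intro mult_left_mono) auto
        also have "\<dots> \<le> \<bar>U\<bar> * Z" using v nz by (intro mult_mono) auto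
        finally have "v * Re ?z \<le> \<bar>U\<bar> * Z" .
        moreover have "Re (I_fun ?z) \<le> Y" using Y(2)[OF nz] complex_Re_le_cmod order_trans by blast
        ultimately show ?thesis by simp
      qed
      then have "exp (- (\<bar>U\<bar> * Z) - Y) / (4 * sqrt (\<bar>U\<bar> + 1) * (Z + 1)) \<le> norm (exp (- of_real v * ?z - I_fun ?z)) / ?den"
        using den den' by (intro frac_le) auto
      then have "c \<le> saddle_amplitude v" unfolding saddle_amplitude_def norm_divide by (simp add: c_def)
      then show ?thesis using False by (simp add: R_fun_eq)
    qed
  qed
qed

lemma admissible_exists: "\<exists>v1. admissible v1"
proof -
  obtain V where "1 < V" "\<And>v. V \<le> v \<Longrightarrow> \<exists>!z. is_zeta0 v z"
    using zeta0_exists_unique_near[of pi] pi_gt_zero by auto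
  then have "admissible V" by (simp add: admissible_def)
  then show ?thesis ..
qed

theorem theorem3p6:
  shows "(\<exists>v1. admissible v1) \<and>
    (\<forall>v1. admissible v1 \<longrightarrow>
      (\<exists>C::real. \<forall>(n::nat) (r::nat). 0 < r \<and> sqrt (real n * ln (real n)) \<le> real r \<and> r < n \<longrightarrow>
        (let u = real n / real r in
          \<bar>kappa n r - exp (- harm r + euler_mascheroni) * buchstab u\<bar>
            \<le> C * (R_fun v1 u * u powr (3/2) * (ln (u + 1))\<^sup>2 / (real r)\<^sup>2))))"
proof (intro conjI allI impI admissible_exists)
  fix v1 assume v1: "admissible v1"
  obtain V C1 where C1: "1 < V" "0 < C1"
    "\<And>n r. 0 < r \<Longrightarrow> r < n \<Longrightarrow> sqrt (real n * ln (real n)) \<le> real r \<Longrightarrow> V \<le> real n / real r \<Longrightarrow>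
      \<bar>kappa n r - exp (- harm r + euler_mascheroni) * buchstab (real n / real r)\<bar>
       \<le> C1 * (saddle_amplitude (real n / real r) * (real n / real r) powr (3/2) * (ln (real n / real r + 1))\<^sup>2) / (real r)\<^sup>2"
    by (rule kappa_buchstab_large, rule that)
  define U where "U = max V v1"
  obtain C2 where C2: "0 < C2"
    "\<And>n r. 0 < r \<Longrightarrow> r < n \<Longrightarrow> real n / real r \<le> U \<Longrightarrow>
       \<bar>kappa n r - exp (- harm r + euler_mascheroni) * buchstab (real n / real r)\<bar> \<le> C2 / (real r)\<^sup>2"
    by (rule kappa_buchstab_small[of U], rule that)
  obtain c where c: "0 < c" "\<And>v. 1 < v \<Longrightarrow> v \<le> U \<Longrightarrow> c \<le> R_fun v1 v"
    by (rule R_fun_bounded_below[OF v1, of U], rule that)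
  define C where "C = max C1 (4 * C2 / c)"
  have "\<bar>kappa n r - exp (- harm r + euler_mascheroni) * buchstab u\<bar>
            \<le> C * (R_fun v1 u * u powr (3/2) * (ln (u + 1))\<^sup>2 / (real r)\<^sup>2)"
    if r: "0 < r" "r < n" and sq: "sqrt (real n * ln (real n)) \<le> real r" and u_def: "u = real n / real r" for n r u
  proof -
    let ?F = "R_fun v1 u * u powr (3/2) * (ln (u + 1))\<^sup>2 / (real r)\<^sup>2"
    have u1: "1 < u" using r by (simp add: u_def)
    have F0: "0 \<le> ?F" by (simp add: R_fun_eq saddle_amplitude_def)
    show ?thesis
    proof (cases "u \<le> U")
      case True
      have "1 / 2 \<le> ln (u + 1)"
      proof -
        have "2 / 3 \<le> ln (2::real)" by (rule ln2_ge_two_thirds)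
        also have "\<dots> \<le> ln (u + 1)" using u1 by simp
        finally show ?thesis by simp
      qed
      then have "(1 / 2)\<^sup>2 \<le> (ln (u + 1))\<^sup>2" by (intro power_mono) auto
      moreover have "1 \<le> u powr (3/2)" using u1 by (intro ge_one_powr_ge_zero) auto
      ultimately have "c * 1 * (1 / 2)\<^sup>2 \<le> R_fun v1 u * u powr (3/2) * (ln (u + 1))\<^sup>2"
        using c(1) c(2)[OF u1 True] by (intro mult_mono) auto
      then have "4 * C2 / c * (c / 4 / (real r)\<^sup>2) \<le> 4 * C2 / c * ?F"
        using C2(1) c(1) by (intro mult_left_mono divide_right_mono) (auto simp: power2_eq_square)
      moreover have "4 * C2 / c * (c / 4 / (real r)\<^sup>2) = C2 / (real r)\<^sup>2" using c(1) by simp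
      moreover have "4 * C2 / c * ?F \<le> C * ?F" using F0 by (intro mult_right_mono) (auto simp: C_def)
      moreover have "\<bar>kappa n r - exp (- harm r + euler_mascheroni) * buchstab u\<bar> \<le> C2 / (real r)\<^sup>2"
        using C2(2)[OF r] True by (simp add: u_def)
      ultimately show ?thesis by linarith
    next
      case False
      then have "V \<le> u" "\<not> u < v1" by (auto simp: U_def)
      then have "\<bar>kappa n r - exp (- harm r + euler_mascheroni) * buchstab u\<bar> \<le> C1 * ?F"
        using C1(3)[OF r sq] by (simp add: u_def R_fun_eq)
      also have "\<dots> \<le> C * ?F" using F0 by (intro mult_right_mono) (auto simp: C_def)
      finally show ?thesis .
    qed
  qed
  then show "\<exists>C::real. \<forall>(n::nat) (r::nat). 0 < r \<and> sqrt (real n * ln (real n)) \<le> real r \<and> r < n \<longrightarrow>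
        (let u = real n / real r in
          \<bar>kappa n r - exp (- harm r + euler_mascheroni) * buchstab u\<bar>
            \<le> C * (R_fun v1 u * u powr (3/2) * (ln (u + 1))\<^sup>2 / (real r)\<^sup>2))"
    unfolding Let_def by blast
qed

end
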